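(* Let $q_1,q_2\in L^1([0,1])$ be real-valued and let $h_1,h_2,H\in\mathbb{R}$. Let $S$ be an infinite set with $$S\subset \sigma(A_{q_1,h_1,H})\cap\sigma(A_{q_2,h_2,H}).$$ Let $a\in\left(0,\frac12\right]$ and $p\in[1,+\infty)$. Suppose that $q_1=q_2$ (almost everywhere) on $[a,1]$ and that $q_1-q_2\in L^p([0,a])$. Let $A$ denote either $A_{q_1,h_1,H}$ or $A_{q_2,h_2,H}$, and assume that there exists a real number $C$ such that $$2a\,n_{\sigma(A)}(t)+C\ \geq\ n_S(t)\ \geq\ 2a\,n_{\sigma(A)}(t)+\frac{1}{2p}-2a$$ for all sufficiently large $t\in S$. Then $h_1=h_2$ and $q_1=q_2$ (almost everywhere on $[0,1]$).
   Context: For a real-valued $q\in L^1([0,1])$ and $h,H\in\mathbb{R}$, $A_{q,h,H}$ denotes the Schrödinger operator $-\frac{d^2}{dx^2}+q$ on $[0,1]$ with boundary conditions $u'(0)+hu(0)=0$ and $u'(1)+Hu(1)=0$. Its spectrum $\sigma(A_{q,h,H})$ is a sequence of simple real eigenvalues, written in increasing order as $(\lambda_j(q,h,H))_{j\ge 0}$. For a sequence (or countable set) $\alpha=(\alpha_j)_{j\ge0}$ of complex numbers and $t\ge 0$, the counting function is $n_\alpha(t)=\sharp\{j\in\mathbb{N}\cup\{0\} : |\alpha_j|\le t\}$. Thus $n_{\sigma(A)}(t)$ is the number of eigenvalues $\lambda$ of $A$ with $|\lambda|\le t$, and $n_S(t)$ is the number of elements $s\in S$ with $|s|\le t$. *)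

theory Defs
  imports "HOL-Analysis.Analysis"
begin

definition Lp_on :: "real \<Rightarrow> real set \<Rightarrow> (real \<Rightarrow> 'a::{banach, second_countable_topology}) \<Rightarrow> bool" where
  "Lp_on p X f \<longleftrightarrow> f \<in> borel_measurable (lebesgue_on X)
     \<and> integrable (lebesgue_on X) (\<lambda>x. norm (f x) powr p)"

definition L2_norm :: "(real \<Rightarrow> complex) \<Rightarrow> real" where
  "L2_norm f = sqrt (LINT x|lebesgue_on {0..1}. (norm (f x))\<^sup>2)"

text \<open>Absolute continuity of \<open>u\<close> on the unit interval with (almost everywhere) derivative \<open>w\<close>,
  in the form of the fundamental theorem of calculus for the Lebesgue integral.\<close>

definition AC_with_derivative :: "(real \<Rightarrow> complex) \<Rightarrow> (real \<Rightarrow> complex) \<Rightarrow> bool" where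
  "AC_with_derivative u w \<longleftrightarrow> integrable (lebesgue_on {0..1}) w
     \<and> (\<forall>x\<in>{0..1}. u x = u 0 + (LINT t|lebesgue_on {0..x}. w t))"

text \<open>The graph of the operator on complex \<open>L\<^sup>2\<close>: \<open>schroedinger q h H u g\<close> says that \<open>u\<close> lies in the
  domain and that \<open>g\<close> represents its image. The domain consists of the \<open>u\<close> for which \<open>u\<close> and
  \<open>u'\<close> are absolutely continuous, \<open>- u'' + q u\<close> is in \<open>L\<^sup>2\<close> and the boundary conditions hold.
  Below, \<open>v\<close> is \<open>u'\<close> and \<open>w\<close> is \<open>u''\<close>; as \<open>v\<close> is itself absolutely continuous, it is the
  derivative of \<open>u\<close> at every point of the unit interval (one-sided at the end points), so its
  boundary values are meaningful. The function \<open>u\<close> is the continuous representative of its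
  \<open>L\<^sup>2\<close> class; only values on the unit interval matter.\<close>

definition schroedinger ::
    "(real \<Rightarrow> real) \<Rightarrow> real \<Rightarrow> real \<Rightarrow> (real \<Rightarrow> complex) \<Rightarrow> (real \<Rightarrow> complex) \<Rightarrow> bool" where
  "schroedinger q h H u g \<longleftrightarrow> Lp_on 2 {0..1} g
     \<and> (\<exists>v w. AC_with_derivative u v \<and> AC_with_derivative v w
          \<and> (AE x in lebesgue_on {0..1}. g x = - w x + of_real (q x) * u x)
          \<and> v 0 + of_real h * u 0 = 0
          \<and> v 1 + of_real H * u 1 = 0)"

text \<open>The resolvent set: \<open>A - z\<close> is a bijection from the domain onto \<open>L\<^sup>2\<close> with bounded inverse.
  The equation \<open>(A - z) u = f\<close> is written as \<open>A u = f + z u\<close>.\<close>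

definition resolvent_set :: "(real \<Rightarrow> real) \<Rightarrow> real \<Rightarrow> real \<Rightarrow> complex set" where
  "resolvent_set q h H = {z. \<exists>M. \<forall>f. Lp_on 2 {0..1} f \<longrightarrow>
     (\<exists>u. schroedinger q h H u (\<lambda>x. f x + z * u x)
        \<and> L2_norm u \<le> M * L2_norm f
        \<and> (\<forall>u'. schroedinger q h H u' (\<lambda>x. f x + z * u' x) \<longrightarrow> (\<forall>x\<in>{0..1}. u' x = u x)))}"

definition spectrum :: "(real \<Rightarrow> real) \<Rightarrow> real \<Rightarrow> real \<Rightarrow> complex set" where
  "spectrum q h H = - resolvent_set q h H"

text \<open>The eigenvalues are simple, so they are counted as elements of the spectrum. The spectrum is
  discrete, so \<open>card\<close> is only applied to finite sets here.\<close>

definition counting :: "complex set \<Rightarrow> real \<Rightarrow> nat" where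
  "counting X t = card {z \<in> X. norm z \<le> t}"

end

theory Submission
  imports Defs "HOL-Complex_Analysis.Complex_Analysis"
begin

text \<open>Let \<open>\<phi>\<^sub>j(x, z)\<close> be the solution of
  \<open>- u'' + q\<^sub>j u = z u\<close> with \<open>u(0) = 1\<close> and
  \<open>u'(0) = - h\<^sub>j\<close>. The eigenvalues of
  \<open>A(q\<^sub>j, h\<^sub>j, H)\<close> are the zeros of the entire function
  \<open>\<phi>\<^sub>j'(1, z) + H \<phi>\<^sub>j(1, z)\<close>
  (\<open>spectrum_eq_zeros\<close>). At a common eigenvalue the two solutions satisfy the same boundary
  condition at \<open>1\<close>, so the cross Wronskian
  \<open>W(z) = \<phi>\<^sub>1(1, z) \<phi>\<^sub>2'(1, z) - \<phi>\<^sub>1'(1, z) \<phi>\<^sub>2(1, z)\<close>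
  vanishes on \<open>S\<close>. Since the potentials agree on \<open>[a, 1]\<close>, Lagrange's identity
  expresses \<open>W(z)\<close> as \<open>h\<^sub>1 - h\<^sub>2\<close> plus the integral of
  \<open>(q\<^sub>2 - q\<^sub>1) \<phi>\<^sub>1 \<phi>\<^sub>2\<close> over
  \<open>[0, a]\<close>. The theorem has two halves: \<open>W\<close> vanishes identically, and this
  determines the operator.

  For the first half write \<open>z = k\<^sup>2\<close>. Each solution is
  \<open>O(exp (\<bar>Im k\<bar> x))\<close>, and because \<open>q\<^sub>1 - q\<^sub>2\<close>
  is in \<open>L\<^sup>p\<close>, the function \<open>W(k\<^sup>2)\<close> is bounded by
  \<open>D(\<bar>Im k\<bar>) exp (2 a \<bar>Im k\<bar>)\<close> with
  \<open>D(y) = o(y powr (1/p - 1))\<close> (\<open>cross_wronskian_growth\<close>,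
  \<open>Lp_exp_weighted_integral_decay\<close>). On the other hand, comparison with the free operator by
  Rouche's theorem shows that an eigenvalue \<open>t\<close> has at least
  \<open>sqrt t / \<pi> + 1 - O(1 / sqrt t)\<close> eigenvalues of modulus at
  most \<open>t\<close> (\<open>counting_spectrum_lower\<close>). The lower bound on the counting function of
  \<open>S\<close> then forces the \<open>j\<close>-th element of \<open>S\<close> below
  \<open>(\<pi> / (2 a))\<^sup>2 (j - 1/(2p))\<^sup>2 + O(1)\<close>. These zeros are
  as dense as the growth permits: in Jensen's inequality on the circle of radius
  \<open>(\<pi> n / (2 a))\<^sup>2\<close> the growth of \<open>W\<close> allows
  \<open>2 n - (1 - 1/p) log n + O(1)\<close> for the sum over the zeros, and by
  Stirling's formula the first \<open>n\<close> elements of \<open>S\<close> use up all of it. The little-o in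
  the bound on \<open>D\<close> makes the allowance smaller than that by an arbitrary constant, so
  \<open>W\<close> cannot be nonzero anywhere on the real axis (\<open>entire_zero_of_dense_zeros\<close>);
  here Jensen's inequality is centred at the point of the real axis in question.

  The second half is a Borg-Marchenko theorem (\<open>borg_marchenko\<close>). If \<open>W\<close> is zero
  then \<open>\<phi>\<^sub>1\<close> and \<open>\<phi>\<^sub>2\<close> have the same logarithmic derivative at
  \<open>1\<close> for every energy. Following Bennewitz, an entire function built from the solutions
  normalized at \<open>1\<close> tends to zero on large circles and therefore vanishes
  (\<open>transfer_entire_zero\<close>), from which \<open>\<phi>\<^sub>1 = \<phi>\<^sub>2\<close>
  follows at one non-real energy.

  The coefficients are only integrable, so the underlying theory of the equation (existence, Gronwall
  estimates, Wronskians, holomorphy in the energy) is developed for functions that are indefinite Lebesgue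
  integrals.\<close>

section \<open>Indefinite Lebesgue integrals\<close>

lemma absolutely_integrable_mult_continuous:
  fixes f g :: "real \<Rightarrow> 'a::{real_normed_algebra,euclidean_space}"
  assumes f: "f absolutely_integrable_on {a..b}" and g: "continuous_on {a..b} g"
  shows "(\<lambda>x. f x * g x) absolutely_integrable_on {a..b}"
    and "(\<lambda>x. g x * f x) absolutely_integrable_on {a..b}"
proof -
  have bl: "bilinear (\<lambda>x y :: 'a. x * y)"
    using bounded_bilinear_mult bilinear_conv_bounded_bilinear by blast
  then have bl': "bilinear (\<lambda>x y :: 'a. y * x)"
    by (auto simp: bilinear_def)
  have m: "g \<in> borel_measurable (lebesgue_on {a..b})"
    by (rule continuous_imp_measurable_on_sets_lebesgue[OF g]) auto
  have b: "bounded (g ` {a..b})"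
    by (intro compact_imp_bounded compact_continuous_image g compact_Icc)
  show "(\<lambda>x. g x * f x) absolutely_integrable_on {a..b}"
    using absolutely_integrable_bounded_measurable_product[OF bl m _ b f] by simp
  show "(\<lambda>x. f x * g x) absolutely_integrable_on {a..b}"
    using absolutely_integrable_bounded_measurable_product[OF bl' m _ b f] by simp
qed

text \<open>Local estimates add up along a uniform partition of mesh below \<open>\<delta>\<close>.\<close>

lemma norm_increment_le_of_local:
  fixes D :: "real \<Rightarrow> 'a::real_normed_vector" and M :: "real \<Rightarrow> real"
  assumes "\<delta> > 0" "a \<le> b"
    and loc: "\<And>c d. a \<le> c \<Longrightarrow> c \<le> d \<Longrightarrow> d \<le> b \<Longrightarrow> d - c < \<delta> \<Longrightarrow> norm (D d - D c) \<le> M d - M c"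
  shows "norm (D b - D a) \<le> M b - M a"
proof -
  obtain n :: nat where n: "(b - a) / \<delta> < real n" and n0: "n > 0"
  proof -
    obtain m :: nat where "(b - a) / \<delta> < real m" using reals_Archimedean2 by blast
    then show ?thesis using that[of "Suc m"] by simp
  qed
  define x where "x i = a + real i * ((b - a) / n)" for i
  have st: "(b - a) / n < \<delta>"
    using n n0 \<open>\<delta> > 0\<close> by (simp add: field_simps)
  have xb: "x i \<le> b" if "i \<le> n" for i
  proof -
    have "real i * (b - a) \<le> real n * (b - a)" using that \<open>a \<le> b\<close> by (intro mult_right_mono) auto
    then show ?thesis using n0 by (simp add: x_def field_simps)
  qed
  have xa: "a \<le> x i" for i using \<open>a \<le> b\<close> by (simp add: x_def)
  have xs: "x (Suc i) - x i = (b - a) / n" for i using n0 by (simp add: x_def field_simps)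
  have "norm (D (x i) - D a) \<le> M (x i) - M a" if "i \<le> n" for i
    using that
  proof (induction i)
    case 0
    then show ?case by (simp add: x_def)
  next
    case (Suc i)
    have "norm (D (x (Suc i)) - D (x i)) \<le> M (x (Suc i)) - M (x i)"
      using xs[of i] st xa \<open>a \<le> b\<close> Suc.prems xb[of "Suc i"] n0
      by (intro loc) (auto simp: x_def divide_right_mono mult_right_mono)
    moreover have "norm (D (x (Suc i)) - D a) \<le> norm (D (x (Suc i)) - D (x i)) + norm (D (x i) - D a)"
      using norm_triangle_ineq[of "D (x (Suc i)) - D (x i)" "D (x i) - D a"] by simp
    ultimately show ?case using Suc by simp
  qed
  from this[of n] show ?thesis using n0 by (simp add: x_def)
qed

lemma continuous_on_primitive:
  fixes f F :: "real \<Rightarrow> 'a::euclidean_space"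
  assumes "f absolutely_integrable_on {a..b}" and "\<And>x. x \<in> {a..b} \<Longrightarrow> F x = F a + integral {a..x} f"
  shows "continuous_on {a..b} F"
proof -
  have "continuous_on {a..b} (\<lambda>x. F a + integral {a..x} f)"
    using assms(1) by (intro continuous_intros indefinite_integral_continuous_1) (simp add: absolutely_integrable_on_def)
  then show ?thesis
    using continuous_on_cong[of "{a..b}" "{a..b}" F "\<lambda>x. F a + integral {a..x} f"] assms(2) by blast
qed

lemma primitive_diff:
  fixes f F :: "real \<Rightarrow> 'a::euclidean_space"
  assumes "f absolutely_integrable_on {a..b}" and "\<And>x. x \<in> {a..b} \<Longrightarrow> F x = F a + integral {a..x} f"
    and "a \<le> c" "c \<le> d" "d \<le> b"
  shows "(f has_integral (F d - F c)) {c..d}"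
proof -
  have "f integrable_on {a..d}" "f integrable_on {c..d}"
    using assms by (auto simp: absolutely_integrable_on_def intro: integrable_subinterval_real)
  then show ?thesis
    using Henstock_Kurzweil_Integration.integral_combine[of a c d f] assms(3-5) assms(2)[of c] assms(2)[of d]
    by (simp add: has_integral_iff del: add_diff_cancel_left) (simp add: algebra_simps)
qed

text \<open>The primitives are differentiable only almost everywhere, so the classical fundamental theorem does not apply
  to \<open>F * G\<close>. On an interval where \<open>F\<close> and \<open>G\<close> vary by at most
  \<open>\<epsilon>\<close>, however, the two sides differ by at most \<open>\<epsilon>\<close> times the
  integral of \<open>norm f + norm g\<close>, and such estimates are additive.\<close>

lemma has_integral_product_rule:
  fixes f g F G :: "real \<Rightarrow> 'a::{real_normed_algebra,euclidean_space}"
  assumes ab: "a \<le> b"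
    and f: "f absolutely_integrable_on {a..b}" and g: "g absolutely_integrable_on {a..b}"
    and F: "\<And>x. x \<in> {a..b} \<Longrightarrow> F x = F a + integral {a..x} f"
    and G: "\<And>x. x \<in> {a..b} \<Longrightarrow> G x = G a + integral {a..x} g"
  shows "((\<lambda>x. f x * G x + F x * g x) has_integral (F b * G b - F a * G a)) {a..b}"
proof -
  note cF = continuous_on_primitive[OF f F] and cG = continuous_on_primitive[OF g G]
  let ?h = "\<lambda>x. f x * G x + F x * g x"
  have hi: "?h absolutely_integrable_on {a..b}"
    by (rule set_integral_add(1)[OF absolutely_integrable_mult_continuous(1)[OF f cG]
      absolutely_integrable_mult_continuous(2)[OF g cF]])
  then have hi': "?h integrable_on {c..d}" if "a \<le> c" "d \<le> b" for c d
    using that by (auto simp: absolutely_integrable_on_def intro: integrable_subinterval_real)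
  \<comment> \<open>\<open>D\<close> is constant exactly if the product rule holds\<close>
  define D where "D x = F x * G x - integral {a..x} ?h" for x
  define N where "N x = norm (f x) + norm (g x)" for x
  have Ni: "N integrable_on {a..b}"
    using f g unfolding N_def absolutely_integrable_on_def by (intro integrable_add) auto
  have est: "norm (D b - D a) \<le> \<epsilon> * integral {a..b} N" if e: "\<epsilon> > 0" for \<epsilon>
  proof -
    have "uniformly_continuous_on {a..b} F" "uniformly_continuous_on {a..b} G"
      using cF cG by (auto intro: compact_uniformly_continuous)
    then obtain \<delta>1 \<delta>2 where d: "\<delta>1 > 0" "\<delta>2 > 0"
      and d1: "\<And>x y. x \<in> {a..b} \<Longrightarrow> y \<in> {a..b} \<Longrightarrow> dist y x < \<delta>1 \<Longrightarrow> dist (F y) (F x) < \<epsilon>"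
      and d2: "\<And>x y. x \<in> {a..b} \<Longrightarrow> y \<in> {a..b} \<Longrightarrow> dist y x < \<delta>2 \<Longrightarrow> dist (G y) (G x) < \<epsilon>"
      unfolding uniformly_continuous_on_def using e by metis
    have "norm (D b - D a) \<le> \<epsilon> * integral {a..b} N - \<epsilon> * integral {a..a} N"
    proof (rule norm_increment_le_of_local[where \<delta> = "min \<delta>1 \<delta>2" and M = "\<lambda>x. \<epsilon> * integral {a..x} N"])
      fix c d assume cd: "a \<le> c" "c \<le> d" "d \<le> b" "d - c < min \<delta>1 \<delta>2"
      have hF: "(f has_integral (F d - F c)) {c..d}" by (rule primitive_diff[OF f F cd(1-3)])
      have hG: "(g has_integral (G d - G c)) {c..d}" by (rule primitive_diff[OF g G cd(1-3)])
      have hh: "(?h has_integral integral {c..d} ?h) {c..d}"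
        using hi' cd by (simp add: integrable_integral)
      have H: "((\<lambda>x. f x * G d + F c * g x - ?h x) has_integral
          ((F d - F c) * G d + F c * (G d - G c) - integral {c..d} ?h)) {c..d}"
        by (intro has_integral_diff has_integral_add hh has_integral_mult_left has_integral_mult_right hF hG)
      have comb: "integral {a..c} ?h + integral {c..d} ?h = integral {a..d} ?h"
        using cd by (intro Henstock_Kurzweil_Integration.integral_combine hi') auto
      have Dd: "D d - D c = (F d - F c) * G d + F c * (G d - G c) - integral {c..d} ?h"
        using comb by (simp add: D_def algebra_simps)
      have Nc: "N integrable_on {c..d}" using Ni cd by (auto intro: integrable_subinterval_real)
      have "norm (integral {c..d} (\<lambda>x. f x * G d + F c * g x - ?h x)) \<le> integral {c..d} (\<lambda>x. \<epsilon> * N x)"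
      proof (rule integral_norm_bound_integral)
        show "(\<lambda>x. f x * G d + F c * g x - ?h x) integrable_on {c..d}" using H by blast
        show "(\<lambda>x. \<epsilon> * N x) integrable_on {c..d}" using integrable_cmul[OF Nc, of \<epsilon>] by simp
        fix x assume x: "x \<in> {c..d}"
        have "norm (G d - G x) \<le> \<epsilon>" "norm (F c - F x) \<le> \<epsilon>"
          using d1[of x c] d2[of x d] x cd by (auto simp: dist_norm)
        then have "norm (f x * (G d - G x)) \<le> norm (f x) * \<epsilon>" "norm ((F c - F x) * g x) \<le> \<epsilon> * norm (g x)"
          by (auto intro!: order_trans[OF norm_mult_ineq] mult_left_mono mult_right_mono)
        moreover have "f x * G d + F c * g x - ?h x = f x * (G d - G x) + (F c - F x) * g x"
          by (simp add: algebra_simps)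
        ultimately show "norm (f x * G d + F c * g x - ?h x) \<le> \<epsilon> * N x"
          using norm_triangle_ineq[of "f x * (G d - G x)" "(F c - F x) * g x"]
          unfolding N_def by (simp add: algebra_simps)
      qed
      also have "integral {c..d} (\<lambda>x. \<epsilon> * N x) = \<epsilon> * integral {c..d} N" by simp
      also have "integral {c..d} N = integral {a..d} N - integral {a..c} N"
        using Henstock_Kurzweil_Integration.integral_combine[of a c d N] cd
          integrable_subinterval_real[OF Ni, of a d] by (auto simp: algebra_simps)
      finally show "norm (D d - D c) \<le> \<epsilon> * integral {a..d} N - \<epsilon> * integral {a..c} N"
        using H Dd by (simp add: integral_unique right_diff_distrib)
    qed (use d ab in auto)
    then show ?thesis by simp
  qed
  have "norm (D b - D a) \<le> 0"
  proof (rule field_le_epsilon)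
    fix e :: real assume "e > 0"
    have N0: "integral {a..b} N \<ge> 0" by (rule integral_nonneg[OF Ni]) (simp add: N_def)
    have "norm (D b - D a) \<le> (e / (integral {a..b} N + 1)) * integral {a..b} N"
      using \<open>e > 0\<close> N0 by (intro est) simp
    also have "\<dots> \<le> e" using N0 \<open>e > 0\<close> by (simp add: field_simps)
    finally show "norm (D b - D a) \<le> 0 + e" by simp
  qed
  then have "F b * G b - F a * G a = integral {a..b} ?h"
    by (simp add: D_def algebra_simps)
  then show ?thesis using hi' by (simp add: has_integral_iff)
qed

text \<open>Lebesgue's differentiation theorem: for almost every \<open>x\<close>, the value \<open>f x\<close> is the
  limit of the averages of \<open>f\<close> over \<open>{x..x + h}\<close>, and these averages vanish.\<close>

lemma indefinite_integral_zero_imp_AE_zero: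
  fixes f :: "real \<Rightarrow> 'a::euclidean_space"
  assumes f: "f absolutely_integrable_on {a..b}" and z: "\<And>x. x \<in> {a..b} \<Longrightarrow> integral {a..x} f = 0"
  shows "AE x in lebesgue_on {a..b}. f x = 0"
proof -
  define g where "g x = (if x \<in> {a..b} then f x else 0)" for x
  have gi: "g integrable_on UNIV"
    using f unfolding g_def absolutely_integrable_on_def by (simp add: integrable_restrict_UNIV del: atLeastAtMost_iff)
  then have gc: "g integrable_on cbox c d" for c d using integrable_on_subcbox by blast
  obtain N where N: "negligible N"
    and lim: "\<And>x e. \<lbrakk>x \<notin> N; 0 < e\<rbrakk> \<Longrightarrow>
               \<exists>d>0. \<forall>h. 0 < h \<and> h < d \<longrightarrow>
                         norm(integral (cbox x (x + h *\<^sub>R One)) g /\<^sub>R h ^ DIM(real) - g x) < e"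
    using integrable_ccontinuous_explicit[OF gc] by blast
  have "f x = 0" if x: "x \<in> {a..b}" "x \<notin> N \<union> {b}" for x
  proof (rule ccontr)
    assume nz: "f x \<noteq> 0"
    then obtain d where d: "d > 0" "\<And>h. 0 < h \<Longrightarrow> h < d \<Longrightarrow> norm(integral {x..x + h} g /\<^sub>R h - g x) < norm (f x)"
      using lim[of x "norm (f x)"] x by auto
    define h where "h = min (d/2) (b - x)"
    have h: "h > 0" "h < d" "x + h \<le> b" using d x by (auto simp: h_def min_def)
    have "integral {x..x+h} g = integral {x..x+h} f"
      using h x by (intro Henstock_Kurzweil_Integration.integral_cong) (auto simp: g_def)
    also have "\<dots> = integral {a..x+h} f - integral {a..x} f"
      using Henstock_Kurzweil_Integration.integral_combine[of a x "x+h" f] x h f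
        integrable_subinterval_real[of f a b a "x+h"]
      by (auto simp: absolutely_integrable_on_def algebra_simps)
    also have "\<dots> = 0" using z x h by auto
    finally show False using d(2)[OF h(1,2)] x by (simp add: g_def)
  qed
  moreover have "negligible (N \<union> {b})" using N by (simp add: negligible_Un)
  ultimately have "AE x in lebesgue. x \<in> {a..b} \<longrightarrow> f x = 0"
    unfolding negligible_iff_null_sets by (intro AE_I'[where N = "N \<union> {b}"]) auto
  then show ?thesis
    by (subst AE_restrict_space_iff) auto
qed

section \<open>Absolutely continuous functions on the unit interval\<close>

text \<open>The Lebesgue integrals in the definition are gauge integrals of absolutely integrable functions; the calculus
  on intervals is carried out for the latter.\<close>

lemma AC_with_derivative_iff:
  "AC_with_derivative u w \<longleftrightarrow> w absolutely_integrable_on {0..1} \<and>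
     (\<forall>x\<in>{0..1}. u x = u 0 + integral {0..x} w)"
proof -
  have "integrable (lebesgue_on {0..1}) w \<longleftrightarrow> w absolutely_integrable_on {0..1}"
    by (simp add: set_integrable_def integrable_restrict_space)
  moreover have "(LINT t|lebesgue_on {0..x}. w t) = integral {0..x} w"
    if "integrable (lebesgue_on {0..1}) w" "x \<in> {0..1}" for x
    by (rule lebesgue_integral_eq_integral[OF
          Equivalence_Lebesgue_Henstock_Integration.integrable_subinterval[OF that(1)]]) (use that(2) in auto)
  ultimately show ?thesis
    unfolding AC_with_derivative_def by (metis (no_types, lifting))
qed

lemma AC_I:
  assumes "w absolutely_integrable_on {0..1}"
    and "\<And>x. x \<in> {0..1} \<Longrightarrow> (w has_integral (u x - u 0)) {0..x}"
  shows "AC_with_derivative u w"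
  using assms unfolding AC_with_derivative_iff by (fastforce dest: integral_unique)

lemma AC_absolutely_integrable: "AC_with_derivative u w \<Longrightarrow> w absolutely_integrable_on {0..1}"
  by (simp add: AC_with_derivative_iff)

lemma AC_increment: "AC_with_derivative u w \<Longrightarrow> x \<in> {0..1} \<Longrightarrow> u x = u 0 + integral {0..x} w"
  unfolding AC_with_derivative_iff by blast

lemma AC_has_integral:
  assumes "AC_with_derivative u w" "0 \<le> c" "c \<le> d" "d \<le> 1"
  shows "(w has_integral (u d - u c)) {c..d}"
  by (rule primitive_diff[OF AC_absolutely_integrable[OF assms(1)] AC_increment[OF assms(1)] assms(2-4)])

lemma AC_continuous: "AC_with_derivative u w \<Longrightarrow> continuous_on {0..1} u"
  by (rule continuous_on_primitive[OF AC_absolutely_integrable AC_increment])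

lemma AC_cong:
  assumes "AC_with_derivative u w" "\<And>x. x \<in> {0..1} \<Longrightarrow> u' x = u x" "\<And>x. x \<in> {0..1} \<Longrightarrow> w' x = w x"
  shows "AC_with_derivative u' w'"
proof (rule AC_I)
  show "w' absolutely_integrable_on {0..1}"
    using AC_absolutely_integrable[OF assms(1)] assms(3)
    by (metis (no_types, lifting) absolutely_integrable_spike negligible_empty DiffE)
  fix x :: real assume x: "x \<in> {0..1}"
  have "(w has_integral (u' x - u' 0)) {0..x}"
    using AC_has_integral[OF assms(1), of 0 x] x assms(2)[of x] assms(2)[of 0] by simp
  then show "(w' has_integral (u' x - u' 0)) {0..x}"
    by (rule has_integral_eq[rotated]) (use x assms(3) in auto)
qed

lemma AC_cong_AE:
  assumes "AC_with_derivative u w" "AE x in lebesgue_on {0..1}. w' x = w x"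
  shows "AC_with_derivative u w'"
proof -
  have "AE x in lebesgue. x \<in> {0..1} \<longrightarrow> w' x = w x"
    using assms(2) by (subst (asm) AE_restrict_space_iff) auto
  then obtain N where N: "N \<in> null_sets lebesgue" "{x. \<not> (x \<in> {0..1} \<longrightarrow> w' x = w x)} \<subseteq> N"
    unfolding eventually_ae_filter by auto
  then have neg: "negligible N" and eq: "\<And>x. x \<in> {0..1} - N \<Longrightarrow> w' x = w x"
    by (auto simp: negligible_iff_null_sets)
  show ?thesis
  proof (rule AC_I)
    show "w' absolutely_integrable_on {0..1}"
      using absolutely_integrable_spike[OF AC_absolutely_integrable[OF assms(1)] neg eq] .
    fix x :: real assume x: "x \<in> {0..1}"
    show "(w' has_integral (u x - u 0)) {0..x}"
      by (rule has_integral_spike[OF neg _ AC_has_integral[OF assms(1)]]) (use x eq in auto)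
  qed
qed

lemma AC_derivative_unique:
  assumes "AC_with_derivative u w" "AC_with_derivative u w'"
  shows "AE x in lebesgue_on {0..1}. w x = w' x"
proof -
  have "AE x in lebesgue_on {0..1}. w x - w' x = 0"
  proof (rule indefinite_integral_zero_imp_AE_zero)
    show "(\<lambda>x. w x - w' x) absolutely_integrable_on {0..1}"
      using assms by (intro set_integral_diff AC_absolutely_integrable)
    fix x :: real assume "x \<in> {0..1}"
    then have "((\<lambda>x. w x - w' x) has_integral ((u x - u 0) - (u x - u 0))) {0..x}"
      using assms by (intro has_integral_diff AC_has_integral) auto
    then show "integral {0..x} (\<lambda>x. w x - w' x) = 0" by (simp add: has_integral_iff)
  qed
  then show ?thesis by simp
qed

lemma AC_add:
  assumes "AC_with_derivative u w" "AC_with_derivative u' w'"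
  shows "AC_with_derivative (\<lambda>x. u x + u' x) (\<lambda>x. w x + w' x)"
proof (rule AC_I)
  fix x :: real assume "x \<in> {0..1}"
  then have "((\<lambda>x. w x + w' x) has_integral ((u x - u 0) + (u' x - u' 0))) {0..x}"
    using assms by (intro has_integral_add AC_has_integral) auto
  then show "((\<lambda>x. w x + w' x) has_integral (u x + u' x - (u 0 + u' 0))) {0..x}"
    by (simp add: algebra_simps)
qed (use assms in \<open>intro set_integral_add AC_absolutely_integrable\<close>)

lemma AC_cmult:
  assumes "AC_with_derivative u w"
  shows "AC_with_derivative (\<lambda>x. c * u x) (\<lambda>x. c * w x)"
proof (rule AC_I)
  show "(\<lambda>x. c * w x) absolutely_integrable_on {0..1}"
    using absolutely_integrable_mult_continuous(2)[OF AC_absolutely_integrable[OF assms], of "\<lambda>_. c"] by simp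
  fix x :: real assume "x \<in> {0..1}"
  then have "((\<lambda>x. c * w x) has_integral (c * (u x - u 0))) {0..x}"
    using assms by (intro has_integral_mult_right AC_has_integral) auto
  then show "((\<lambda>x. c * w x) has_integral (c * u x - c * u 0)) {0..x}"
    by (simp add: algebra_simps)
qed

lemma AC_diff:
  assumes "AC_with_derivative u w" "AC_with_derivative u' w'"
  shows "AC_with_derivative (\<lambda>x. u x - u' x) (\<lambda>x. w x - w' x)"
  using AC_add[OF assms(1) AC_cmult[OF assms(2), of "-1"]] by simp

text \<open>The instance of the product rule on which Lagrange's identity and variation of constants rest.\<close>

lemma AC_mult:
  assumes "AC_with_derivative u w" "AC_with_derivative u' w'"
  shows "AC_with_derivative (\<lambda>x. u x * u' x) (\<lambda>x. w x * u' x + u x * w' x)"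
proof (rule AC_I)
  note a = AC_absolutely_integrable[OF assms(1)] AC_absolutely_integrable[OF assms(2)]
  show "(\<lambda>x. w x * u' x + u x * w' x) absolutely_integrable_on {0..1}"
    by (rule set_integral_add(1)[OF absolutely_integrable_mult_continuous(1)[OF a(1) AC_continuous[OF assms(2)]]
          absolutely_integrable_mult_continuous(2)[OF a(2) AC_continuous[OF assms(1)]]])
  fix x :: real assume x: "x \<in> {0..1}"
  show "((\<lambda>x. w x * u' x + u x * w' x) has_integral (u x * u' x - u 0 * u' 0)) {0..x}"
  proof (rule has_integral_product_rule)
    show "w absolutely_integrable_on {0..x}" "w' absolutely_integrable_on {0..x}"
      using x by (auto intro: absolutely_integrable_on_subinterval[OF a(1)] absolutely_integrable_on_subinterval[OF a(2)])
    show "u y = u 0 + integral {0..y} w" "u' y = u' 0 + integral {0..y} w'" if "y \<in> {0..x}" for y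
      using that x AC_increment[OF assms(1), of y] AC_increment[OF assms(2), of y] by simp_all
  qed (use x in simp)
qed

lemma AC_cnj:
  assumes "AC_with_derivative u w"
  shows "AC_with_derivative (\<lambda>x. cnj (u x)) (\<lambda>x. cnj (w x))"
proof (rule AC_I)
  have bl: "bounded_linear cnj" by (rule bounded_linear_cnj)
  show "(\<lambda>x. cnj (w x)) absolutely_integrable_on {0..1}"
    using absolutely_integrable_linear[OF AC_absolutely_integrable[OF assms] bl] by (simp add: o_def)
  fix x :: real assume "x \<in> {0..1}"
  then show "((\<lambda>x. cnj (w x)) has_integral (cnj (u x) - cnj (u 0))) {0..x}"
    using has_integral_linear[OF AC_has_integral[OF assms, of 0 x] bl] by (simp add: o_def)
qed

lemma AC_of_vector_derivative:
  assumes "\<And>x. x \<in> {0..1} \<Longrightarrow> (u has_vector_derivative w x) (at x within {0..1})" "continuous_on {0..1} w"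
  shows "AC_with_derivative u w"
proof (rule AC_I)
  show "w absolutely_integrable_on {0..1}" using assms(2) by (rule absolutely_integrable_continuous_real)
  fix x :: real assume "x \<in> {0..1}"
  then show "(w has_integral (u x - u 0)) {0..x}"
    by (intro fundamental_theorem_of_calculus has_vector_derivative_within_subset[OF assms(1)]) auto
qed

lemma AC_has_vector_derivative:
  assumes "AC_with_derivative u w" "continuous_on {0..1} w" "x \<in> {0..1}"
  shows "(u has_vector_derivative w x) (at x within {0..1})"
proof -
  have "((\<lambda>x. u 0 + integral {0..x} w) has_vector_derivative 0 + w x) (at x within {0..1})"
    by (intro has_vector_derivative_add has_vector_derivative_const integral_has_vector_derivative assms(2,3))
  then have "((\<lambda>x. u 0 + integral {0..x} w) has_vector_derivative w x) (at x within {0..1})" by simp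
  then show ?thesis
    by (rule has_vector_derivative_transform[OF assms(3), rotated]) (rule AC_increment[OF assms(1)])
qed

lemma AC_reflect:
  assumes "AC_with_derivative u w"
  shows "AC_with_derivative (\<lambda>x. u (1 - x)) (\<lambda>x. - w (1 - x))"
proof (rule AC_I)
  have *: "((\<lambda>x. - w (1 - x)) has_integral (u (1 - d) - u (1 - c))) {c..d}" if "0 \<le> c" "c \<le> d" "d \<le> 1" for c d
  proof -
    have "(w has_integral (u (1 - c) - u (1 - d))) {1 - d..1 - c}"
      using assms that by (intro AC_has_integral) auto
    from has_integral_affinity[where m="-1" and c=1, OF this[unfolded cbox_interval[symmetric]]]
    have "((\<lambda>x. w (1 - x)) has_integral (u (1 - c) - u (1 - d))) {c..d}"
      using that by (simp add: image_affinity_atLeastAtMost)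
    then show ?thesis by (metis has_integral_neg minus_diff_eq)
  qed
  have "(\<lambda>x. norm (w x)) integrable_on {0..1}" "w integrable_on {0..1}"
    using AC_absolutely_integrable[OF assms] by (auto simp: absolutely_integrable_on_def)
  from this(1)[THEN integrable_integral]
    have "((\<lambda>x. norm (w x)) has_integral (integral {0..1} (\<lambda>x. norm (w x)))) (cbox 0 (1::real))" by simp
  from has_integral_affinity[where m="-1" and c=1, OF this]
  have "(\<lambda>x. norm (w (1 - x))) integrable_on {0..1}"
    by (auto simp: image_affinity_atLeastAtMost)
  moreover have "(\<lambda>x. - w (1 - x)) integrable_on {0..1}"
    using *[of 0 1] by (auto simp: has_integral_iff)
  ultimately show "(\<lambda>x. - w (1 - x)) absolutely_integrable_on {0..1}"
    by (simp add: absolutely_integrable_on_def)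
  fix x :: real assume "x \<in> {0..1}"
  then show "((\<lambda>x. - w (1 - x)) has_integral (u (1 - x) - u (1 - 0))) {0..x}"
    using *[of 0 x] by simp
qed

text \<open>Powers of an indefinite integral, divided by factorials, are the majorants both in Gronwall's inequality and
  in the Picard iteration when the coefficients are merely integrable.\<close>

lemma has_integral_power_indefinite_integral:
  fixes g :: "real \<Rightarrow> real"
  assumes g: "g absolutely_integrable_on {0..1}" and x: "x \<in> {0..1}"
  defines "p \<equiv> \<lambda>n t. integral {0..t} g ^ n / fact n"
  shows "((\<lambda>t. g t * p n t) has_integral p (Suc n) x) {0..x}"
proof -
  let ?G = "\<lambda>t. integral {0..t} g"
  have cG: "continuous_on {0..1} ?G"
    using g by (intro indefinite_integral_continuous_1) (simp add: absolutely_integrable_on_def)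
  have "\<forall>x\<in>{0..1}. ((\<lambda>t. real (Suc n) * (g t * ?G t ^ n)) has_integral ?G x ^ Suc n) {0..x}"
  proof (induction n)
    case 0
    show ?case using g
      by (auto simp: absolutely_integrable_on_def intro!: integrable_integral intro: integrable_subinterval_real)
  next
    case (Suc n)
    show ?case
    proof
      fix x :: real assume x: "x \<in> {0..1}"
      have gx: "g absolutely_integrable_on {0..x}"
        using g by (rule absolutely_integrable_on_subinterval) (use x in auto)
      have cx: "continuous_on {0..x} (\<lambda>t. ?G t ^ n)"
        using x by (intro continuous_intros continuous_on_subset[OF cG]) auto
      have "(\<lambda>t. g t * ?G t ^ n) absolutely_integrable_on {0..x}"
        by (rule absolutely_integrable_mult_continuous[OF gx cx])
      then have ai: "(\<lambda>t. real (Suc n) * (g t * ?G t ^ n)) absolutely_integrable_on {0..x}"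
        by (simp only: set_integrable_mult_right)
      have "((\<lambda>t. g t * ?G t ^ Suc n + ?G t * (real (Suc n) * (g t * ?G t ^ n))) has_integral
          (?G x * ?G x ^ Suc n - ?G 0 * ?G 0 ^ Suc n)) {0..x}"
      proof (rule has_integral_product_rule[OF _ gx ai])
        fix y assume "y \<in> {0..x}"
        then show "?G y ^ Suc n = ?G 0 ^ Suc n + integral {0..y} (\<lambda>t. real (Suc n) * (g t * ?G t ^ n))"
          using Suc.IH x by (auto simp: has_integral_iff simp del: integral_mult_right)
      qed (use x in auto)
      then show "((\<lambda>t. real (Suc (Suc n)) * (g t * ?G t ^ Suc n)) has_integral ?G x ^ Suc (Suc n)) {0..x}"
        by (simp add: algebra_simps)
    qed
  qed
  then have "((\<lambda>t. (real (Suc n) * (g t * ?G t ^ n)) / fact (Suc n)) has_integral ?G x ^ Suc n / fact (Suc n)) {0..x}"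
    using x by (intro has_integral_divide) blast
  then show ?thesis
    by (simp add: p_def field_simps del: of_nat_Suc)
qed

text \<open>Iterating the hypothesis \<open>n\<close> times bounds \<open>u\<close> by \<open>c\<close> times the
  \<open>n\<close>-th partial sum of the exponential series of \<open>integral {0..x} g\<close>, plus a
  remainder \<open>M * p n x\<close> that tends to zero.\<close>

lemma gronwall:
  fixes u g :: "real \<Rightarrow> real"
  assumes g: "g absolutely_integrable_on {0..1}" and g0: "\<And>x. x \<in> {0..1} \<Longrightarrow> g x \<ge> 0"
    and u: "continuous_on {0..1} u"
    and le: "\<And>x. x \<in> {0..1} \<Longrightarrow> u x \<le> c + integral {0..x} (\<lambda>t. g t * u t)"
    and x: "x \<in> {0..1}"
  shows "u x \<le> c * exp (integral {0..x} g)"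
proof -
  define p where "p n t = integral {0..t} g ^ n / fact n" for n t
  have pint: "((\<lambda>t. g t * p n t) has_integral p (Suc n) x) {0..x}" if "x \<in> {0..1}" for n x
    unfolding p_def by (rule has_integral_power_indefinite_integral[OF g that])
  obtain M where M: "\<And>x. x \<in> {0..1} \<Longrightarrow> u x \<le> M"
    using continuous_attains_sup[OF compact_Icc _ u] that by fastforce
  have it: "\<forall>x\<in>{0..1}. u x \<le> c * (\<Sum>j<n. p j x) + M * p n x" for n
  proof (induction n)
    case 0
    then show ?case using M by (simp add: p_def)
  next
    case (Suc n)
    show ?case
    proof
      fix x :: real assume x: "x \<in> {0..1}"
      have H: "((\<lambda>t. c * (\<Sum>j<n. g t * p j t) + M * (g t * p n t)) has_integral
          (c * (\<Sum>j<n. p (Suc j) x) + M * p (Suc n) x)) {0..x}"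
        using x by (intro has_integral_add has_integral_mult_right has_integral_sum pint) auto
      have "(\<lambda>t. g t * u t) absolutely_integrable_on {0..1}"
        by (rule absolutely_integrable_mult_continuous[OF g u])
      then have gu: "(\<lambda>t. g t * u t) integrable_on {0..x}"
        using x by (auto simp: absolutely_integrable_on_def intro: integrable_subinterval_real)
      have "integral {0..x} (\<lambda>t. g t * u t) \<le> c * (\<Sum>j<n. p (Suc j) x) + M * p (Suc n) x"
      proof (rule has_integral_le[OF integrable_integral[OF gu] H])
        fix t assume t: "t \<in> {0..x}"
        then have "g t * u t \<le> g t * (c * (\<Sum>j<n. p j t) + M * p n t)"
          using Suc.IH x g0[of t] by (intro mult_left_mono) auto
        then show "g t * u t \<le> c * (\<Sum>j<n. g t * p j t) + M * (g t * p n t)"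
          by (simp add: sum_distrib_left algebra_simps)
      qed
      then have "u x \<le> c + (c * (\<Sum>j<n. p (Suc j) x) + M * p (Suc n) x)"
        using le[OF x] by linarith
      also have "\<dots> = c * (\<Sum>j<Suc n. p j x) + M * p (Suc n) x"
        by (simp only: sum.lessThan_Suc_shift) (simp add: p_def algebra_simps)
      finally show "u x \<le> c * (\<Sum>j<Suc n. p j x) + M * p (Suc n) x" .
    qed
  qed
  have s: "(\<lambda>n. p n x) sums exp (integral {0..x} g)"
    using exp_converges[of "integral {0..x} g"] by (simp add: p_def field_simps)
  have "(\<lambda>n. c * (\<Sum>j<n. p j x) + M * p n x) \<longlonglongrightarrow> c * exp (integral {0..x} g) + M * 0"
    using s by (intro tendsto_intros) (auto simp: sums_def dest: sums_summable intro: summable_LIMSEQ_zero[OF sums_summable[OF s]])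
  then have "u x \<le> c * exp (integral {0..x} g) + M * 0"
    by (rule LIMSEQ_le_const) (use it x in auto)
  then show ?thesis by simp
qed

section \<open>Linear second-order equations with integrable coefficients\<close>

text \<open>The equation \<open>u'' = Q u - f\<close> as a system with \<open>v = u'\<close>. The
  sign of \<open>f\<close> is such that, for \<open>Q = q - z\<close>, the equation reads
  \<open>- u'' + q u = f + z u\<close>.\<close>

definition solves :: "(real \<Rightarrow> complex) \<Rightarrow> (real \<Rightarrow> complex) \<Rightarrow> (real \<Rightarrow> complex) \<Rightarrow> (real \<Rightarrow> complex) \<Rightarrow> bool" where
  "solves Q f u v \<longleftrightarrow> AC_with_derivative u v \<and> AC_with_derivative v (\<lambda>x. Q x * u x - f x)"

lemma sums_integral_mult_series:
  fixes Q :: "real \<Rightarrow> complex"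
  assumes Q: "Q absolutely_integrable_on {0..1}" and d: "\<And>n. continuous_on {0..1} (d n)"
    and m: "\<And>n x. x \<in> {0..1} \<Longrightarrow> norm (d n x) \<le> m n" "summable m" and x: "x \<in> {0..1}"
  shows "(\<lambda>n. integral {0..x} (\<lambda>t. Q t * d n t)) sums integral {0..x} (\<lambda>t. Q t * (\<Sum>n. d n t))"
proof -
  have sn: "summable (\<lambda>n. norm (d n t))" if "t \<in> {0..1}" for t
    by (rule summable_comparison_test'[OF m(2), of 0]) (use m(1)[OF that] in auto)
  have Qd: "(\<lambda>t. Q t * d n t) integrable_on {0..x}" for n
    using absolutely_integrable_mult_continuous(1)[OF Q d[of n]] x
    by (auto simp: absolutely_integrable_on_def intro: integrable_subinterval_real)
  have nQ: "(\<lambda>t. norm (Q t)) integrable_on {0..x}"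
    using Q x by (auto simp: absolutely_integrable_on_def intro: integrable_subinterval_real)
  have "(\<lambda>N. integral {0..x} (\<lambda>t. \<Sum>n<N. Q t * d n t)) \<longlonglongrightarrow> integral {0..x} (\<lambda>t. Q t * (\<Sum>n. d n t))"
  proof (rule dominated_convergence(2))
    show "(\<lambda>t. \<Sum>n<N. Q t * d n t) integrable_on {0..x}" for N
      by (intro integrable_sum Qd) auto
    show "(\<lambda>t. suminf m * norm (Q t)) integrable_on {0..x}"
      using integrable_cmul[OF nQ, of "suminf m"] by simp
    fix t assume t: "t \<in> {0..x}"
    then have t1: "t \<in> {0..1}" using x by auto
    show "norm (\<Sum>n<N. Q t * d n t) \<le> suminf m * norm (Q t)" for N
    proof -
      have "norm (\<Sum>n<N. d n t) \<le> (\<Sum>n<N. m n)"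
        by (rule sum_norm_le) (use m(1)[OF t1] in auto)
      also have "\<dots> \<le> suminf m"
        by (rule sum_le_suminf[OF m(2)]) (use m(1)[OF t1] norm_ge_zero order_trans in blast)+
      finally have "norm (\<Sum>n<N. d n t) \<le> suminf m" .
      from mult_right_mono[OF this norm_ge_zero[of "Q t"]] show ?thesis
        by (simp add: sum_distrib_left[symmetric] norm_mult mult.commute)
    qed
    have "(\<lambda>n. Q t * d n t) sums (Q t * (\<Sum>n. d n t))"
      by (rule sums_mult[OF summable_sums[OF summable_norm_cancel[OF sn[OF t1]]]])
    then show "(\<lambda>N. \<Sum>n<N. Q t * d n t) \<longlonglongrightarrow> Q t * (\<Sum>n. d n t)"
      by (simp add: sums_def)
  qed
  moreover have "integral {0..x} (\<lambda>t. \<Sum>n<N. Q t * d n t) = (\<Sum>n<N. integral {0..x} (\<lambda>t. Q t * d n t))" for N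
    using Henstock_Kurzweil_Integration.integral_sum[OF finite_lessThan Qd, of "\<lambda>n. n" N] by blast
  ultimately show ?thesis
    unfolding sums_def by simp
qed

text \<open>Caratheodory's existence theorem by Picard iteration: \<open>u\<close> is the sum of functions
  \<open>d n\<close>, where \<open>d (n + 1)\<close> is the double primitive of
  \<open>Q * d n\<close>. With \<open>G\<close> the primitive of \<open>norm Q\<close>, each
  \<open>d n\<close> is bounded by \<open>M * G ^ n / fact n\<close>, so the series
  converges uniformly.\<close>

theorem solves_exists:
  fixes Q f :: "real \<Rightarrow> complex"
  assumes Q: "Q absolutely_integrable_on {0..1}" and f: "f absolutely_integrable_on {0..1}"
  obtains u v where "solves Q f u v" "u 0 = \<alpha>" "v 0 = \<beta>"
proof -
  define g where "g t = norm (Q t)" for t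
  have g: "g absolutely_integrable_on {0..1}"
    using absolutely_integrable_norm[OF Q] unfolding g_def o_def .
  have gi: "g integrable_on {0..x}" if "x \<in> {0..1}" for x
    using g that by (auto simp: absolutely_integrable_on_def intro: integrable_subinterval_real)
  define p where "p n t = integral {0..t} g ^ n / fact n" for n t
  have pint: "((\<lambda>t. g t * p n t) has_integral p (Suc n) x) {0..x}" if "x \<in> {0..1}" for n x
    unfolding p_def by (rule has_integral_power_indefinite_integral[OF g that])
  have Gmono: "integral {0..x} g \<le> integral {0..y} g" if "0 \<le> x" "x \<le> y" "y \<le> 1" for x y
    using that by (intro integral_subset_le gi) (auto simp: g_def)
  have G0: "integral {0..x} g \<ge> 0" if "x \<in> {0..1}" for x
    by (rule integral_nonneg[OF gi[OF that]]) (simp add: g_def)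
  have pmono: "p n x \<le> p n y" if "0 \<le> x" "x \<le> y" "y \<le> 1" for n x y
    using that G0[of x] Gmono[of x y] unfolding p_def by (intro divide_right_mono power_mono) auto
  define v0 where "v0 x = \<beta> - integral {0..x} f" for x
  define d0 where "d0 x = \<alpha> + integral {0..x} v0" for x
  have cv0: "continuous_on {0..1} v0"
    unfolding v0_def using f
    by (intro continuous_intros indefinite_integral_continuous_1) (simp add: absolutely_integrable_on_def)
  have ci: "continuous_on {0..1} (\<lambda>x. integral {0..x} h)" if "continuous_on {0..1} h" for h :: "real \<Rightarrow> complex"
    using that by (intro indefinite_integral_continuous_1 integrable_continuous_real)
  have cd0: "continuous_on {0..1} d0"
    unfolding d0_def by (intro continuous_intros ci cv0)
  then obtain M where M: "\<And>x. x \<in> {0..1} \<Longrightarrow> norm (d0 x) \<le> M"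
    using compact_imp_bounded[OF compact_continuous_image[OF cd0 compact_Icc]]
    unfolding bounded_iff by (auto simp del: atLeastAtMost_iff)
  then have M0: "M \<ge> 0" using norm_ge_zero[of "d0 0"] order_trans by (metis atLeastAtMost_iff order_refl zero_le_one)
  define step where "step d x = integral {0..x} (\<lambda>s. integral {0..s} (\<lambda>t. Q t * d t))" for d :: "real \<Rightarrow> complex" and x
  define d where "d n = (step ^^ n) d0" for n
  \<comment> \<open>\<open>e n\<close> is the derivative of \<open>d (n + 1)\<close>\<close>
  define e where "e n s = integral {0..s} (\<lambda>t. Q t * d n t)" for n s
  have d_0: "d 0 = d0" and d_Suc: "d (Suc n) x = integral {0..x} (e n)" for n x
    by (simp_all add: d_def step_def e_def[abs_def])
  have Qint: "(\<lambda>t. Q t * h t) integrable_on {0..x}" if "continuous_on {0..1} h" "x \<in> {0..1}" for h x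
    using absolutely_integrable_mult_continuous(1)[OF Q that(1)] that(2)
    by (auto simp: absolutely_integrable_on_def intro: integrable_subinterval_real)
  have ce: "continuous_on {0..1} (e n)" if "continuous_on {0..1} (d n)" for n
    unfolding e_def using Qint[OF that, of 1] by (intro indefinite_integral_continuous_1) auto
  have ebound: "norm (e n s) \<le> M * p (Suc n) s"
    if "continuous_on {0..1} (d n)" "\<forall>x\<in>{0..1}. norm (d n x) \<le> M * p n x" "s \<in> {0..1}" for n s
  proof -
    have H: "((\<lambda>t. M * (g t * p n t)) has_integral M * p (Suc n) s) {0..s}"
      by (intro has_integral_mult_right pint that)
    have "norm (e n s) \<le> integral {0..s} (\<lambda>t. M * (g t * p n t))"
      unfolding e_def
    proof (rule integral_norm_bound_integral[OF Qint[OF that(1,3)]])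
      show "(\<lambda>t. M * (g t * p n t)) integrable_on {0..s}" using H by blast
      fix t assume "t \<in> {0..s}"
      then show "norm (Q t * d n t) \<le> M * (g t * p n t)"
        using that mult_left_mono[of "norm (d n t)" "M * p n t" "g t"] by (simp add: norm_mult g_def algebra_simps)
    qed
    then show ?thesis unfolding integral_unique[OF H] .
  qed
  have main: "continuous_on {0..1} (d n) \<and> (\<forall>x\<in>{0..1}. norm (d n x) \<le> M * p n x)" for n
  proof (induction n)
    case 0
    then show ?case using cd0 M by (auto simp: d_0 p_def)
  next
    case (Suc n)
    note cen = ce[OF conjunct1[OF Suc]]
    have "continuous_on {0..1} (\<lambda>x. integral {0..x} (e n))" by (rule ci[OF cen])
    moreover have "norm (integral {0..x} (e n)) \<le> M * p (Suc n) x" if x: "x \<in> {0..1}" for x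
    proof -
      have "norm (integral {0..x} (e n)) \<le> integral {0..x} (\<lambda>s. M * p (Suc n) x)"
      proof (rule integral_norm_bound_integral)
        show "e n integrable_on {0..x}"
          using x by (intro integrable_continuous_real continuous_on_subset[OF cen]) auto
        fix s assume s: "s \<in> {0..x}"
        have "norm (e n s) \<le> M * p (Suc n) s"
          using Suc s x by (intro ebound) auto
        also have "\<dots> \<le> M * p (Suc n) x"
          using s x M0 by (intro mult_left_mono pmono) auto
        finally show "norm (e n s) \<le> M * p (Suc n) x" .
      qed (simp add: integrable_const_ivl)
      also have "\<dots> = x * (M * p (Suc n) x)" using x by simp
      also have "\<dots> \<le> M * p (Suc n) x"
        using x M0 G0[OF x] by (intro mult_left_le_one_le) (auto simp: p_def)
      finally show ?thesis .
    qed
    ultimately show ?case by (simp add: d_Suc[abs_def])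
  qed
  have cd: "continuous_on {0..1} (d n)" for n using main by blast
  define m where "m n = M * p n 1" for n
  have sm: "summable m"
    using summable_exp[of "integral {0..1} g"] unfolding m_def p_def
    by (intro summable_mult) (simp add: field_simps)
  have dm: "norm (d n x) \<le> m n" if x: "x \<in> {0..1}" for n x
    using main[of n] x pmono[of x 1 n] mult_left_mono[OF _ M0, of "p n x" "p n 1"] unfolding m_def
    by (meson atLeastAtMost_iff order.trans order_refl)
  have em: "norm (e n x) \<le> m (Suc n)" if x: "x \<in> {0..1}" for n x
    using ebound[of n x] main[of n] x pmono[of x 1 "Suc n"] mult_left_mono[OF _ M0, of "p (Suc n) x" "p (Suc n) 1"] unfolding m_def
    by (meson atLeastAtMost_iff order.trans order_refl)
  define u where "u x = (\<Sum>n. d n x)" for x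
  define v where "v x = v0 x + integral {0..x} (\<lambda>t. Q t * u t)" for x
  have cu: "continuous_on {0..1} u"
    unfolding u_def
  proof (rule uniform_limit_theorem)
    show "uniform_limit {0..1} (\<lambda>n x. \<Sum>i<n. d i x) (\<lambda>x. \<Sum>n. d n x) sequentially"
      by (rule Weierstrass_m_test[OF dm sm])
    show "\<forall>\<^sub>F n in sequentially. continuous_on {0..1} (\<lambda>x. \<Sum>i<n. d i x)"
      by (intro always_eventually allI continuous_on_sum cd)
  qed simp
  have es: "(\<lambda>n. e n s) sums integral {0..s} (\<lambda>t. Q t * u t)" if "s \<in> {0..1}" for s
    unfolding e_def u_def by (rule sums_integral_mult_series[OF Q cd dm sm that])
  have "(\<lambda>n. integral {0..x} (\<lambda>t. 1 * e n t)) sums integral {0..x} (\<lambda>t. 1 * (\<Sum>n. e n t))" if "x \<in> {0..1}" for x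
    by (rule sums_integral_mult_series[OF _ ce[OF cd] em _ that])
      (use sm in \<open>auto simp: summable_Suc_iff intro: absolutely_integrable_on_const\<close>)
  moreover have "integral {0..x} (\<lambda>t. 1 * (\<Sum>n. e n t)) = integral {0..x} (\<lambda>s. integral {0..s} (\<lambda>t. Q t * u t))"
    if "x \<in> {0..1}" for x
    by (rule Henstock_Kurzweil_Integration.integral_cong) (use that es sums_unique in fastforce)
  ultimately have "(\<lambda>n. d (Suc n) x) sums integral {0..x} (\<lambda>s. integral {0..s} (\<lambda>t. Q t * u t))" if "x \<in> {0..1}" for x
    using that by (simp add: d_Suc)
  then have "(\<lambda>n. d n x) sums (integral {0..x} (\<lambda>s. integral {0..s} (\<lambda>t. Q t * u t)) + d 0 x)" if "x \<in> {0..1}" for x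
    using that by (subst (asm) sums_Suc_iff) auto
  then have u_eq: "u x = integral {0..x} (\<lambda>s. integral {0..s} (\<lambda>t. Q t * u t)) + d0 x" if "x \<in> {0..1}" for x
    using that sums_unique unfolding u_def d_0 by fastforce
  have cQu: "continuous_on {0..1} (\<lambda>s. integral {0..s} (\<lambda>t. Q t * u t))"
    using Qint[OF cu, of 1] by (intro indefinite_integral_continuous_1) auto
  have u0: "u 0 = \<alpha>" using u_eq[of 0] by (simp add: d0_def)
  have v0': "v 0 = \<beta>" by (simp add: v_def v0_def)
  have "AC_with_derivative u v"
    unfolding AC_with_derivative_iff
  proof (intro conjI ballI)
    show "v absolutely_integrable_on {0..1}"
      unfolding v_def by (intro absolutely_integrable_continuous_real continuous_intros cv0 cQu)
    fix x :: real assume x: "x \<in> {0..1}"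
    have i: "v0 integrable_on {0..x}" "(\<lambda>s. integral {0..s} (\<lambda>t. Q t * u t)) integrable_on {0..x}"
      using x by (auto intro!: integrable_continuous_real intro: continuous_on_subset[OF cv0] continuous_on_subset[OF cQu])
    show "u x = u 0 + integral {0..x} v"
      using u_eq[OF x] u0 i unfolding v_def d0_def
      by (simp add: Henstock_Kurzweil_Integration.integral_add)
  qed
  moreover have "AC_with_derivative v (\<lambda>x. Q x * u x - f x)"
    unfolding AC_with_derivative_iff
  proof (intro conjI ballI)
    show "(\<lambda>x. Q x * u x - f x) absolutely_integrable_on {0..1}"
      by (intro set_integral_diff absolutely_integrable_mult_continuous(1)[OF Q cu] f)
    fix x :: real assume x: "x \<in> {0..1}"
    have "f integrable_on {0..x}"
      using f x by (auto simp: absolutely_integrable_on_def intro: integrable_subinterval_real)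
    then show "v x = v 0 + integral {0..x} (\<lambda>x. Q x * u x - f x)"
      using Qint[OF cu x] unfolding v0' unfolding v_def v0_def
      by (simp add: Henstock_Kurzweil_Integration.integral_diff)
  qed
  ultimately show ?thesis using that[of u v] u0 v0' by (simp add: solves_def)
qed

text \<open>Gronwall's inequality for \<open>norm u + norm v\<close>, which is at most a constant plus the
  primitive of \<open>(1 + norm Q) * (norm u + norm v)\<close>.\<close>

lemma solves_bound:
  assumes Q: "Q absolutely_integrable_on {0..1}" and f: "f absolutely_integrable_on {0..1}"
    and s: "solves Q f u v" and x: "x \<in> {0..1}"
  shows "norm (u x) + norm (v x) \<le>
    (norm (u 0) + norm (v 0) + integral {0..1} (\<lambda>t. norm (f t))) * exp (1 + integral {0..1} (\<lambda>t. norm (Q t)))"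
proof -
  have uv: "AC_with_derivative u v" "AC_with_derivative v (\<lambda>x. Q x * u x - f x)"
    using s by (auto simp: solves_def)
  note cu = AC_continuous[OF uv(1)] and cv = AC_continuous[OF uv(2)]
  define w where "w t = norm (u t) + norm (v t)" for t
  define g where "g t = 1 + norm (Q t)" for t
  define c where "c = norm (u 0) + norm (v 0) + integral {0..1} (\<lambda>t. norm (f t))"
  have cw: "continuous_on {0..1} w" unfolding w_def by (intro continuous_intros cu cv)
  have nQ: "(\<lambda>t. norm (Q t)) absolutely_integrable_on {0..1}"
    using absolutely_integrable_norm[OF Q] by (simp add: o_def)
  have nf: "(\<lambda>t. norm (f t)) integrable_on {0..x}" if "x \<in> {0..1}" for x
    using f that by (auto simp: absolutely_integrable_on_def intro: integrable_subinterval_real)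
  have g: "g absolutely_integrable_on {0..1}"
    unfolding g_def by (intro set_integral_add nQ) (auto intro: absolutely_integrable_on_const)
  have gw: "(\<lambda>t. g t * w t) integrable_on {0..x}" if "x \<in> {0..1}" for x
    using absolutely_integrable_mult_continuous(1)[OF g cw] that
    by (auto simp: absolutely_integrable_on_def intro: integrable_subinterval_real)
  have le: "w x \<le> c + integral {0..x} (\<lambda>t. g t * w t)" if x: "x \<in> {0..1}" for x
  proof -
    have v: "(v has_integral (u x - u 0)) {0..x}" and dv: "((\<lambda>x. Q x * u x - f x) has_integral (v x - v 0)) {0..x}"
      using x by (auto intro: AC_has_integral uv)
    have nv: "(\<lambda>t. norm (v t)) integrable_on {0..x}"
      using x by (intro integrable_continuous_real continuous_intros continuous_on_subset[OF cv]) auto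
    have nQu: "(\<lambda>t. norm (Q t) * norm (u t)) integrable_on {0..x}"
      using absolutely_integrable_mult_continuous(1)[OF nQ continuous_on_norm[OF cu]] x
      by (auto simp: absolutely_integrable_on_def intro: integrable_subinterval_real)
    have "norm (u x - u 0) \<le> integral {0..x} (\<lambda>t. norm (v t))"
      using integral_norm_bound_integral[OF has_integral_integrable[OF v] nv] integral_unique[OF v] by simp
    moreover have "norm (v x - v 0) \<le> integral {0..x} (\<lambda>t. norm (Q t) * norm (u t) + norm (f t))"
      using integral_norm_bound_integral[OF has_integral_integrable[OF dv] integrable_add[OF nQu nf[OF x]]] integral_unique[OF dv]
      by (metis (no_types, lifting) norm_mult norm_triangle_ineq4)
    moreover have "\<dots> = integral {0..x} (\<lambda>t. norm (Q t) * norm (u t)) + integral {0..x} (\<lambda>t. norm (f t))"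
      by (rule Henstock_Kurzweil_Integration.integral_add[OF nQu nf[OF x]])
    moreover have "integral {0..x} (\<lambda>t. norm (f t)) \<le> integral {0..1} (\<lambda>t. norm (f t))"
      using x by (intro integral_subset_le nf) auto
    moreover have "integral {0..x} (\<lambda>t. norm (v t)) + integral {0..x} (\<lambda>t. norm (Q t) * norm (u t))
        \<le> integral {0..x} (\<lambda>t. g t * w t)"
      unfolding Henstock_Kurzweil_Integration.integral_add[OF nv nQu, symmetric]
      by (rule integral_le[OF integrable_add[OF nv nQu] gw[OF x]]) (simp add: g_def w_def algebra_simps)
    ultimately show ?thesis
      using norm_triangle_sub[of "u x" "u 0"] norm_triangle_sub[of "v x" "v 0"] unfolding c_def w_def by linarith
  qed
  have "w x \<le> c * exp (integral {0..x} g)"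
    by (rule gronwall[OF g _ cw le x]) (auto simp: g_def)
  also have "\<dots> \<le> c * exp (1 + integral {0..1} (\<lambda>t. norm (Q t)))"
  proof (rule mult_left_mono)
    have "integral {0..1} (\<lambda>t. norm (f t)) \<ge> 0" by (rule integral_nonneg) (use nf[of 1] in auto)
    then show "0 \<le> c" unfolding c_def by simp
    have gi: "g integrable_on {0..1}" using g by (simp add: absolutely_integrable_on_def)
    have "integral {0..x} g \<le> integral {0..1} g"
      using x by (intro integral_subset_le gi integrable_subinterval_real[OF gi]) (auto simp: g_def)
    also have "\<dots> = 1 + integral {0..1} (\<lambda>t. norm (Q t))"
      unfolding g_def using nQ
      by (subst Henstock_Kurzweil_Integration.integral_add) (auto simp: absolutely_integrable_on_def)
    finally show "exp (integral {0..x} g) \<le> exp (1 + integral {0..1} (\<lambda>t. norm (Q t)))" by simp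
  qed
  finally show ?thesis by (simp add: w_def c_def)
qed

lemma solves_linear:
  assumes "solves Q f u v" "solves Q f' u' v'"
  shows "solves Q (\<lambda>x. f x + c * f' x) (\<lambda>x. u x + c * u' x) (\<lambda>x. v x + c * v' x)"
proof -
  have "AC_with_derivative (\<lambda>x. u x + c * u' x) (\<lambda>x. v x + c * v' x)"
    using assms by (intro AC_add AC_cmult) (auto simp: solves_def)
  moreover have "AC_with_derivative (\<lambda>x. v x + c * v' x) (\<lambda>x. Q x * u x - f x + c * (Q x * u' x - f' x))"
    using assms by (intro AC_add AC_cmult) (auto simp: solves_def)
  ultimately show ?thesis
    by (simp add: solves_def algebra_simps)
qed

lemma solves_unique:
  assumes Q: "Q absolutely_integrable_on {0..1}"
    and "solves Q f u v" "solves Q f u' v'" "u 0 = u' 0" "v 0 = v' 0" "x \<in> {0..1}"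
  shows "u x = u' x" "v x = v' x"
proof -
  have "solves Q (\<lambda>x. 0) (\<lambda>x. u x - u' x) (\<lambda>x. v x - v' x)"
    using solves_linear[OF assms(2,3), of "-1"] by simp
  from solves_bound[OF Q _ this assms(6)] assms(4,5)
  have "norm (u x - u' x) + norm (v x - v' x) \<le> 0" by simp
  then show "u x = u' x" "v x = v' x" by (smt (verit) norm_ge_zero right_minus_eq zero_less_norm_iff)+
qed

text \<open>Lagrange's identity. It is the source of the reality and the simplicity of the eigenvalues, of the integral
  formula for the cross Wronskian, and of the constancy of Wronskians of two solutions of the same equation.\<close>

lemma wronskian_has_integral:
  assumes "solves Q\<^sub>1 f\<^sub>1 u\<^sub>1 v\<^sub>1" "solves Q\<^sub>2 f\<^sub>2 u\<^sub>2 v\<^sub>2" "x \<in> {0..1}"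
  shows "((\<lambda>t. (Q\<^sub>2 t - Q\<^sub>1 t) * u\<^sub>1 t * u\<^sub>2 t - u\<^sub>1 t * f\<^sub>2 t + f\<^sub>1 t * u\<^sub>2 t) has_integral
      (u\<^sub>1 x * v\<^sub>2 x - v\<^sub>1 x * u\<^sub>2 x) - (u\<^sub>1 0 * v\<^sub>2 0 - v\<^sub>1 0 * u\<^sub>2 0)) {0..x}"
proof -
  have "AC_with_derivative (\<lambda>x. u\<^sub>1 x * v\<^sub>2 x - v\<^sub>1 x * u\<^sub>2 x)
    (\<lambda>x. (v\<^sub>1 x * v\<^sub>2 x + u\<^sub>1 x * (Q\<^sub>2 x * u\<^sub>2 x - f\<^sub>2 x)) - ((Q\<^sub>1 x * u\<^sub>1 x - f\<^sub>1 x) * u\<^sub>2 x + v\<^sub>1 x * v\<^sub>2 x))"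
    using assms by (intro AC_diff AC_mult) (auto simp: solves_def)
  then have "AC_with_derivative (\<lambda>x. u\<^sub>1 x * v\<^sub>2 x - v\<^sub>1 x * u\<^sub>2 x)
    (\<lambda>t. (Q\<^sub>2 t - Q\<^sub>1 t) * u\<^sub>1 t * u\<^sub>2 t - u\<^sub>1 t * f\<^sub>2 t + f\<^sub>1 t * u\<^sub>2 t)"
    by (rule AC_cong) (auto simp: algebra_simps)
  from AC_has_integral[OF this, of 0 x] show ?thesis using assms(3) by simp
qed

section \<open>Solutions as functions of the spectral parameter\<close>

abbreviation energy_potential :: "(real \<Rightarrow> real) \<Rightarrow> complex \<Rightarrow> real \<Rightarrow> complex" where
  "energy_potential q z \<equiv> \<lambda>x. complex_of_real (q x) - z"

lemma energy_potential_integrable: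
  assumes "q absolutely_integrable_on {0..1}"
  shows "energy_potential q z absolutely_integrable_on {0..1}"
proof -
  have "(\<lambda>x. complex_of_real (q x)) absolutely_integrable_on {0..1}"
    using absolutely_integrable_linear[OF assms bounded_linear_of_real] by (simp add: o_def)
  then show ?thesis by (intro set_integral_diff) (auto intro: absolutely_integrable_on_const)
qed

lemma energy_potential_norm_integral_le:
  assumes "q absolutely_integrable_on {0..1}"
  shows "integral {0..1} (\<lambda>x. norm (energy_potential q z x)) \<le> integral {0..1} (\<lambda>x. \<bar>q x\<bar>) + norm z"
proof -
  have q: "(\<lambda>x. \<bar>q x\<bar>) integrable_on {0..1}"
    using assms by (simp add: absolutely_integrable_on_def)
  have e: "(\<lambda>x. norm (energy_potential q z x)) integrable_on {0..1}"
    using energy_potential_integrable[OF assms] by (simp add: absolutely_integrable_on_def)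
  have "integral {0..1} (\<lambda>x. norm (energy_potential q z x)) \<le> integral {0..1} (\<lambda>x. \<bar>q x\<bar> + norm z)"
  proof (rule integral_le[OF e integrable_add[OF q]])
    show "norm (energy_potential q z x) \<le> \<bar>q x\<bar> + norm z" for x
      using norm_triangle_ineq4[of "complex_of_real (q x)" z] by simp
  qed (simp add: integrable_const_ivl)
  also have "\<dots> = integral {0..1} (\<lambda>x. \<bar>q x\<bar>) + norm z"
    using q by (subst Henstock_Kurzweil_Integration.integral_add) (auto simp: integrable_const_ivl)
  finally show ?thesis .
qed

text \<open>Only the values on the unit interval are determined by the initial value problem.\<close>

definition sol_pair :: "(real \<Rightarrow> real) \<Rightarrow> complex \<Rightarrow> complex \<Rightarrow> complex \<Rightarrow> (real \<Rightarrow> complex) \<times> (real \<Rightarrow> complex)" where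
  "sol_pair q \<alpha> \<beta> z = (SOME p. solves (energy_potential q z) (\<lambda>_. 0) (fst p) (snd p) \<and> fst p 0 = \<alpha> \<and> snd p 0 = \<beta>)"

definition sol where "sol q \<alpha> \<beta> z = fst (sol_pair q \<alpha> \<beta> z)"
definition dsol where "dsol q \<alpha> \<beta> z = snd (sol_pair q \<alpha> \<beta> z)"

lemma norm_sin_cos_mult_of_real_le: 
  assumes "s \<ge> 0"
  shows "norm (sin (k * complex_of_real s)) \<le> exp (\<bar>Im k\<bar> * s)" "norm (cos (k * complex_of_real s)) \<le> exp (\<bar>Im k\<bar> * s)"
  using cmod_sin_le_exp[of 1 "k * complex_of_real s"] cmod_cos_le_exp[of 1 "k * complex_of_real s"] assms
  by (auto simp: abs_mult)

context
  fixes q :: "real \<Rightarrow> real"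
  assumes q: "q absolutely_integrable_on {0..1}"
begin

lemma sol_solves: "solves (energy_potential q z) (\<lambda>_. 0) (sol q \<alpha> \<beta> z) (dsol q \<alpha> \<beta> z)"
  and sol_at_0: "sol q \<alpha> \<beta> z 0 = \<alpha>" and dsol_at_0: "dsol q \<alpha> \<beta> z 0 = \<beta>"
proof -
  obtain u v where "solves (energy_potential q z) (\<lambda>_. 0) u v" "u 0 = \<alpha>" "v 0 = \<beta>"
    by (rule solves_exists[OF energy_potential_integrable[OF q]]) auto
  then have "\<exists>p. solves (energy_potential q z) (\<lambda>_. 0) (fst p) (snd p) \<and> fst p 0 = \<alpha> \<and> snd p 0 = \<beta>"
    by auto
  from someI_ex[OF this]
  show "solves (energy_potential q z) (\<lambda>_. 0) (sol q \<alpha> \<beta> z) (dsol q \<alpha> \<beta> z)"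
    "sol q \<alpha> \<beta> z 0 = \<alpha>" "dsol q \<alpha> \<beta> z 0 = \<beta>"
    by (auto simp: sol_def dsol_def sol_pair_def)
qed

lemma sol_eqI:
  assumes "solves (energy_potential q z) (\<lambda>_. 0) u v" "x \<in> {0..1}"
  shows "u x = sol q (u 0) (v 0) z x" "v x = dsol q (u 0) (v 0) z x"
  using solves_unique[OF energy_potential_integrable[OF q] assms(1) sol_solves, of "u 0" "v 0" x] assms(2)
  by (auto simp: sol_at_0 dsol_at_0)

lemma sol_continuous: "continuous_on {0..1} (sol q \<alpha> \<beta> z)"
  using sol_solves[of z \<alpha> \<beta>] AC_continuous by (auto simp: solves_def)

lemma solves_bound_energy:
  assumes "solves (energy_potential q z) f u v" "f absolutely_integrable_on {0..1}" "x \<in> {0..1}" "norm z \<le> R"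
  shows "norm (u x) + norm (v x) \<le> (norm (u 0) + norm (v 0) + integral {0..1} (\<lambda>t. norm (f t)))
      * exp (1 + integral {0..1} (\<lambda>x. \<bar>q x\<bar>) + R)"
proof -
  have "integral {0..1} (\<lambda>t. norm (f t)) \<ge> 0"
    using assms(2) by (intro integral_nonneg) (auto simp: absolutely_integrable_on_def)
  then have "norm (u 0) + norm (v 0) + integral {0..1} (\<lambda>t. norm (f t)) \<ge> 0" by simp
  then show ?thesis
    using solves_bound[OF energy_potential_integrable[OF q] assms(2,1,3)] energy_potential_norm_integral_le[OF q, of z] assms(4)
    by (smt (verit) exp_le_cancel_iff mult_left_mono)
qed

text \<open>The derivative with respect to the energy is the solution \<open>\<psi>\<close> of the formally differentiated
  equation. The error of the difference quotient solves that equation with zero initial data and with the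
  increment of \<open>sol\<close> as its inhomogeneity. The increment is
  \<open>O(norm (y - z))\<close> by the a priori bound, and hence so is the error.\<close>

lemma sol_has_field_derivative:
  obtains \<psi> \<psi>' where "solves (energy_potential q z) (sol q \<alpha> \<beta> z) \<psi> \<psi>'" "\<psi> 0 = 0" "\<psi>' 0 = 0"
    "\<And>x. x \<in> {0..1} \<Longrightarrow> ((\<lambda>z. sol q \<alpha> \<beta> z x) has_field_derivative \<psi> x) (at z)"
    "\<And>x. x \<in> {0..1} \<Longrightarrow> ((\<lambda>z. dsol q \<alpha> \<beta> z x) has_field_derivative \<psi>' x) (at z)"
proof -
  let ?u = "\<lambda>z. sol q \<alpha> \<beta> z" and ?v = "\<lambda>z. dsol q \<alpha> \<beta> z"
  have ui: "?u y absolutely_integrable_on {0..1}" for y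
    by (intro absolutely_integrable_continuous_real sol_continuous)
  obtain \<psi> \<psi>' where psi: "solves (energy_potential q z) (?u z) \<psi> \<psi>'" "\<psi> 0 = 0" "\<psi>' 0 = 0"
    by (rule solves_exists[OF energy_potential_integrable[OF q] ui]) auto
  define R where "R = norm z + 1"
  define K where "K = exp (1 + integral {0..1} (\<lambda>x. \<bar>q x\<bar>) + R)"
  define B where "B = (norm \<alpha> + norm \<beta>) * K"
  have K0: "K > 0" by (simp add: K_def)
  have int_le: "integral {0..1} (\<lambda>t. norm (f t)) \<le> c"
    if "f absolutely_integrable_on {0..1}" "\<And>t. t \<in> {0..1} \<Longrightarrow> norm (f t) \<le> c" for f :: "real \<Rightarrow> complex" and c
  proof -
    have "integral {0..1} (\<lambda>t. norm (f t)) \<le> integral {0..1::real} (\<lambda>t. c)"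
      using that by (intro integral_le) (auto simp: absolutely_integrable_on_def integrable_const_ivl)
    then show ?thesis by simp
  qed
  have est: "norm ((?u y x - ?u z x) / (y - z) - \<psi> x) + norm ((?v y x - ?v z x) / (y - z) - \<psi>' x) \<le> norm (y - z) * (B * K * K)"
    if y: "y \<noteq> z" "norm (y - z) \<le> 1" and x: "x \<in> {0..1}" for y x
  proof -
    define h where "h = y - z"
    have h: "h \<noteq> 0" "y = z + h" using y by (auto simp: h_def)
    have yR: "norm y \<le> R" "norm z \<le> R" unfolding R_def h(2)
      using norm_triangle_ineq[of z h] y by (auto simp: h_def)
    have b1: "norm (?u y t) \<le> B" if "t \<in> {0..1}" for t
    proof -
      have "norm (?u y t) + norm (?v y t) \<le> B"
        using solves_bound_energy[OF sol_solves absolutely_integrable_zero that yR(1), of \<alpha> \<beta>]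
        unfolding B_def K_def sol_at_0 dsol_at_0 by simp
      then show ?thesis using norm_ge_zero[of "?v y t"] by linarith
    qed
    have s1: "solves (energy_potential q z) (\<lambda>x. h * ?u y x) (\<lambda>x. ?u y x - ?u z x) (\<lambda>x. ?v y x - ?v z x)"
    proof -
      have "solves (energy_potential q z) (\<lambda>x. h * ?u y x) (?u y) (?v y)"
        using sol_solves[of y \<alpha> \<beta>] unfolding solves_def h(2) by (simp add: algebra_simps)
      from solves_linear[OF this sol_solves[of z \<alpha> \<beta>], of "-1"] show ?thesis by simp
    qed
    have hui: "(\<lambda>x. h * ?u y x) absolutely_integrable_on {0..1}"
      by (intro absolutely_integrable_continuous_real continuous_intros sol_continuous)
    have b2: "norm (?u y t - ?u z t) \<le> norm h * B * K" if t: "t \<in> {0..1}" for t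
    proof -
      have "norm (?u y t - ?u z t) \<le> integral {0..1} (\<lambda>t. norm (h * ?u y t)) * K"
      proof -
        have "norm (?u y t - ?u z t) + norm (?v y t - ?v z t) \<le> integral {0..1} (\<lambda>t. norm (h * ?u y t)) * K"
          using solves_bound_energy[OF s1 hui t yR(2)] unfolding K_def sol_at_0 dsol_at_0 by simp
        then show ?thesis using norm_ge_zero[of "?v y t - ?v z t"] by linarith
      qed
      also have "\<dots> \<le> norm h * B * K"
        using K0 b1 by (intro mult_right_mono int_le hui) (auto simp: norm_mult mult_left_mono)
      finally show ?thesis .
    qed
    let ?w = "\<lambda>x. inverse h * (?u y x - ?u z x) - \<psi> x" and ?w' = "\<lambda>x. inverse h * (?v y x - ?v z x) - \<psi>' x"
    have s2: "solves (energy_potential q z) (\<lambda>x. ?u y x - ?u z x) ?w ?w'"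
    proof -
      have "solves (energy_potential q z) (\<lambda>_. 0) (\<lambda>_. 0) (\<lambda>_. 0)"
        unfolding solves_def by (auto intro!: AC_of_vector_derivative)
      from solves_linear[OF this s1, of "inverse h"]
      have "solves (energy_potential q z) (?u y) (\<lambda>x. inverse h * (?u y x - ?u z x)) (\<lambda>x. inverse h * (?v y x - ?v z x))"
        using h by (simp add: field_simps)
      from solves_linear[OF this psi(1), of "-1"] show ?thesis by simp
    qed
    have di: "(\<lambda>x. ?u y x - ?u z x) absolutely_integrable_on {0..1}"
      by (intro absolutely_integrable_continuous_real continuous_intros sol_continuous)
    have "norm (?w x) + norm (?w' x) \<le> integral {0..1} (\<lambda>t. norm (?u y t - ?u z t)) * K"
      using solves_bound_energy[OF s2 di x yR(2)] psi(2,3) by (simp add: sol_at_0 dsol_at_0 K_def)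
    also have "\<dots> \<le> (norm h * B * K) * K"
      using K0 b2 by (intro mult_right_mono int_le di) auto
    finally show ?thesis by (simp add: h_def divide_inverse mult.commute mult.left_commute)
  qed
  have lim: "((\<lambda>y. (f y - f z) / (y - z)) \<longlongrightarrow> l) (at z)"
    if "\<And>y. y \<noteq> z \<Longrightarrow> norm (y - z) \<le> 1 \<Longrightarrow> norm ((f y - f z) / (y - z) - l) \<le> norm (y - z) * (B * K * K)" for f l
  proof -
    have "((\<lambda>y. (f y - f z) / (y - z) - l) \<longlongrightarrow> 0) (at z)"
    proof (rule Lim_null_comparison)
      show "\<forall>\<^sub>F y in at z. norm ((f y - f z) / (y - z) - l) \<le> norm (y - z) * (B * K * K)"
        unfolding eventually_at by (rule exI[of _ 1]) (use that in \<open>auto simp: dist_norm\<close>)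
      have "((\<lambda>y. norm (y - z) * (B * K * K)) \<longlongrightarrow> norm (z - z) * (B * K * K)) (at z)"
        by (intro tendsto_intros)
      then show "((\<lambda>y. norm (y - z) * (B * K * K)) \<longlongrightarrow> 0) (at z)" by simp
    qed
    then show ?thesis using Lim_null by blast
  qed
  show ?thesis
  proof (rule that[OF psi])
    fix x :: real assume x: "x \<in> {0..1}"
    show "((\<lambda>z. sol q \<alpha> \<beta> z x) has_field_derivative \<psi> x) (at z)"
      unfolding has_field_derivative_iff
      by (rule lim) (use est[OF _ _ x] norm_ge_zero in \<open>smt (verit)\<close>)
    show "((\<lambda>z. dsol q \<alpha> \<beta> z x) has_field_derivative \<psi>' x) (at z)"
      unfolding has_field_derivative_iff
      by (rule lim) (use est[OF _ _ x] norm_ge_zero in \<open>smt (verit)\<close>)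
  qed
qed

lemma sol_holomorphic:
  assumes "x \<in> {0..1}"
  shows "(\<lambda>z. sol q \<alpha> \<beta> z x) holomorphic_on A" "(\<lambda>z. dsol q \<alpha> \<beta> z x) holomorphic_on A"
proof -
  have "(\<lambda>z. sol q \<alpha> \<beta> z x) field_differentiable (at z)" "(\<lambda>z. dsol q \<alpha> \<beta> z x) field_differentiable (at z)" for z
    by (rule sol_has_field_derivative[of z \<alpha> \<beta>], use assms field_differentiable_def in blast)+
  then show "(\<lambda>z. sol q \<alpha> \<beta> z x) holomorphic_on A" "(\<lambda>z. dsol q \<alpha> \<beta> z x) holomorphic_on A"
    by (auto simp: holomorphic_on_def intro: field_differentiable_at_within)
qed

lemma sol_cnj:
  assumes "x \<in> {0..1}"
  shows "sol q (cnj \<alpha>) (cnj \<beta>) (cnj z) x = cnj (sol q \<alpha> \<beta> z x)"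
    and "dsol q (cnj \<alpha>) (cnj \<beta>) (cnj z) x = cnj (dsol q \<alpha> \<beta> z x)"
proof -
  have "solves (energy_potential q (cnj z)) (\<lambda>_. 0) (\<lambda>x. cnj (sol q \<alpha> \<beta> z x)) (\<lambda>x. cnj (dsol q \<alpha> \<beta> z x))"
    using sol_solves[of z \<alpha> \<beta>] AC_cnj[of "sol q \<alpha> \<beta> z"] AC_cnj[of "dsol q \<alpha> \<beta> z"]
    unfolding solves_def by fastforce
  from sol_eqI[OF this assms] show "sol q (cnj \<alpha>) (cnj \<beta>) (cnj z) x = cnj (sol q \<alpha> \<beta> z x)"
    "dsol q (cnj \<alpha>) (cnj \<beta>) (cnj z) x = cnj (dsol q \<alpha> \<beta> z x)"
    by (auto simp: sol_at_0 dsol_at_0)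
qed

text \<open>Variation of constants with \<open>q u\<close> regarded as inhomogeneity: these are the increments over
  \<open>{0..x}\<close> of
  \<open>u t * cos (k * (x - t)) + v t * sin (k * (x - t)) / k\<close>
  and of its derivative with respect to \<open>x\<close>.\<close>

lemma solves_representation:
  assumes s: "solves (energy_potential q (k\<^sup>2)) (\<lambda>_. 0) u v" and k: "k \<noteq> 0" and x: "x \<in> {0..1}"
  shows "((\<lambda>t. sin (k * of_real (x - t)) / k * (of_real (q t) * u t)) has_integral
            u x - (u 0 * cos (k * of_real x) + v 0 * (sin (k * of_real x) / k))) {0..x}"
    and "((\<lambda>t. cos (k * of_real (x - t)) * (of_real (q t) * u t)) has_integral
            v x - (v 0 * cos (k * of_real x) - k * u 0 * sin (k * of_real x))) {0..x}"
proof -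
  have ac: "AC_with_derivative u v" "AC_with_derivative v (\<lambda>t. energy_potential q (k\<^sup>2) t * u t)"
    using s by (auto simp: solves_def)
  have c: "AC_with_derivative (\<lambda>t. cos (k * of_real (x - t))) (\<lambda>t. k * sin (k * of_real (x - t)))"
  proof (rule AC_of_vector_derivative)
    show "((\<lambda>t. cos (k * of_real (x - t))) has_vector_derivative k * sin (k * of_real (x - t))) (at t within {0..1})" for t
      unfolding of_real_diff
      by (rule has_vector_derivative_real_field[of "\<lambda>w. cos (k * (of_real x - w))"]) (auto intro!: derivative_eq_intros)
  qed (intro continuous_intros)
  have s: "AC_with_derivative (\<lambda>t. sin (k * of_real (x - t))) (\<lambda>t. - k * cos (k * of_real (x - t)))"
  proof (rule AC_of_vector_derivative)
    show "((\<lambda>t. sin (k * of_real (x - t))) has_vector_derivative - k * cos (k * of_real (x - t))) (at t within {0..1})" for t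
      unfolding of_real_diff
      by (rule has_vector_derivative_real_field[of "\<lambda>w. sin (k * (of_real x - w))"]) (auto intro!: derivative_eq_intros)
  qed (intro continuous_intros)
  have "AC_with_derivative
      (\<lambda>t. u t * cos (k * of_real (x - t)) + inverse k * (v t * sin (k * of_real (x - t))))
      (\<lambda>t. (v t * cos (k * of_real (x - t)) + u t * (k * sin (k * of_real (x - t)))) +
           inverse k * ((energy_potential q (k\<^sup>2) t * u t) * sin (k * of_real (x - t)) + v t * (- k * cos (k * of_real (x - t)))))"
    by (intro AC_add AC_cmult AC_mult ac c s)
  then have "AC_with_derivative
      (\<lambda>t. u t * cos (k * of_real (x - t)) + inverse k * (v t * sin (k * of_real (x - t))))
      (\<lambda>t. sin (k * of_real (x - t)) / k * (of_real (q t) * u t))"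
    by (rule AC_cong) (use k in \<open>auto simp: field_simps power2_eq_square\<close>)
  from AC_has_integral[OF this, of 0 x] x k
  show "((\<lambda>t. sin (k * of_real (x - t)) / k * (of_real (q t) * u t)) has_integral
            u x - (u 0 * cos (k * of_real x) + v 0 * (sin (k * of_real x) / k))) {0..x}"
    by (simp add: field_simps)
  have "AC_with_derivative
      (\<lambda>t. v t * cos (k * of_real (x - t)) - k * (u t * sin (k * of_real (x - t))))
      (\<lambda>t. ((energy_potential q (k\<^sup>2) t * u t) * cos (k * of_real (x - t)) + v t * (k * sin (k * of_real (x - t)))) -
           k * (v t * sin (k * of_real (x - t)) + u t * (- k * cos (k * of_real (x - t)))))"
    by (intro AC_diff AC_cmult AC_mult ac c s)
  then have "AC_with_derivative
      (\<lambda>t. v t * cos (k * of_real (x - t)) - k * (u t * sin (k * of_real (x - t))))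
      (\<lambda>t. cos (k * of_real (x - t)) * (of_real (q t) * u t))"
    by (rule AC_cong) (auto simp: algebra_simps power2_eq_square)
  from AC_has_integral[OF this, of 0 x] x k
  show "((\<lambda>t. cos (k * of_real (x - t)) * (of_real (q t) * u t)) has_integral
            v x - (v 0 * cos (k * of_real x) - k * u 0 * sin (k * of_real x))) {0..x}"
    by (simp add: algebra_simps)
qed

text \<open>Gronwall's inequality for \<open>exp (- \<bar>Im k\<bar> * x) * norm (u x)\<close>.\<close>

lemma solves_growth:
  assumes s: "solves (energy_potential q (k\<^sup>2)) (\<lambda>_. 0) u v" and k: "norm k \<ge> 1" and x: "x \<in> {0..1}"
  shows "norm (u x) \<le> (norm (u 0) + norm (v 0) / norm k) * exp (integral {0..1} (\<lambda>t. \<bar>q t\<bar>)) * exp (\<bar>Im k\<bar> * x)"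
proof -
  have k0: "k \<noteq> 0" using k by auto
  define \<eta> where "\<eta> = \<bar>Im k\<bar>"
  define c where "c = norm (u 0) + norm (v 0) / norm k"
  have c0: "c \<ge> 0" by (simp add: c_def)
  define U where "U t = exp (- \<eta> * t) * norm (u t)" for t
  have cu: "continuous_on {0..1} u" using s AC_continuous by (auto simp: solves_def)
  have cU: "continuous_on {0..1} U" unfolding U_def by (intro continuous_intros cu)
  have aq: "(\<lambda>t. \<bar>q t\<bar>) absolutely_integrable_on {0..1}"
    using absolutely_integrable_norm[OF q] by (simp add: o_def)
  have qi: "(\<lambda>t. \<bar>q t\<bar>) integrable_on {0..x}" if "x \<in> {0..1}" for x
    using aq that by (auto simp: absolutely_integrable_on_def intro: integrable_subinterval_real)
  have le: "U x \<le> c + integral {0..x} (\<lambda>t. \<bar>q t\<bar> * U t)" if x: "x \<in> {0..1}" for x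
  proof -
    note H = solves_representation(1)[OF s k0 x]
    have Ui: "(\<lambda>t. \<bar>q t\<bar> * U t) integrable_on {0..x}"
      using absolutely_integrable_mult_continuous(1)[OF aq cU] x
      by (auto simp: absolutely_integrable_on_def intro: integrable_subinterval_real)
    have "norm (u x - (u 0 * cos (k * of_real x) + v 0 * (sin (k * of_real x) / k)))
        \<le> integral {0..x} (\<lambda>t. exp (\<eta> * x) * (\<bar>q t\<bar> * U t))"
      unfolding integral_unique[OF H, symmetric]
    proof (rule integral_norm_bound_integral)
      show "(\<lambda>t. exp (\<eta> * x) * (\<bar>q t\<bar> * U t)) integrable_on {0..x}"
        using integrable_cmul[OF Ui, of "exp (\<eta> * x)"] by simp
      fix t assume t: "t \<in> {0..x}"
      have "norm (sin (k * of_real (x - t)) / k) \<le> exp (\<eta> * (x - t)) / 1"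
        unfolding norm_divide \<eta>_def using t k by (intro frac_le norm_sin_cos_mult_of_real_le) auto
      then have "norm (sin (k * of_real (x - t)) / k * (of_real (q t) * u t)) \<le> exp (\<eta> * (x - t)) * (\<bar>q t\<bar> * norm (u t))"
        unfolding norm_mult norm_of_real by (intro mult_right_mono) auto
      also have "\<dots> = exp (\<eta> * x) * (\<bar>q t\<bar> * U t)"
        by (simp add: U_def right_diff_distrib exp_diff exp_minus field_simps)
      finally show "norm (sin (k * of_real (x - t)) / k * (of_real (q t) * u t)) \<le> exp (\<eta> * x) * (\<bar>q t\<bar> * U t)" .
    qed (use H in blast)
    moreover have "norm (u 0 * cos (k * of_real x) + v 0 * (sin (k * of_real x) / k)) \<le> c * exp (\<eta> * x)"
    proof -
      have "norm (u 0 * cos (k * of_real x)) \<le> norm (u 0) * exp (\<eta> * x)"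
        unfolding norm_mult \<eta>_def using x by (intro mult_left_mono norm_sin_cos_mult_of_real_le) auto
      moreover have "norm (v 0 * (sin (k * of_real x) / k)) \<le> norm (v 0) * (exp (\<eta> * x) / norm k)"
        unfolding norm_mult norm_divide \<eta>_def using x by (intro mult_left_mono divide_right_mono norm_sin_cos_mult_of_real_le) auto
      ultimately show ?thesis
        using norm_triangle_ineq[of "u 0 * cos (k * of_real x)" "v 0 * (sin (k * of_real x) / k)"]
        by (simp add: c_def distrib_right)
    qed
    ultimately have "norm (u x) \<le> c * exp (\<eta> * x) + exp (\<eta> * x) * integral {0..x} (\<lambda>t. \<bar>q t\<bar> * U t)"
      using norm_triangle_sub[of "u x" "u 0 * cos (k * of_real x) + v 0 * (sin (k * of_real x) / k)"] by simp
    then have "exp (- \<eta> * x) * norm (u x) \<le> exp (- \<eta> * x) * (c * exp (\<eta> * x) + exp (\<eta> * x) * integral {0..x} (\<lambda>t. \<bar>q t\<bar> * U t))"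
      by (intro mult_left_mono) auto
    moreover have "exp (- \<eta> * x) * exp (\<eta> * x) = 1" by (simp add: exp_minus)
    ultimately show ?thesis
      unfolding U_def[of x] by (simp only: distrib_left mult.assoc[symmetric] mult.commute[of c] mult.left_neutral)
  qed
  have "U x \<le> c * exp (integral {0..x} (\<lambda>t. \<bar>q t\<bar>))"
    by (rule gronwall[OF aq _ cU le x]) auto
  also have "\<dots> \<le> c * exp (integral {0..1} (\<lambda>t. \<bar>q t\<bar>))"
    using x c0 by (intro mult_left_mono) (auto intro!: integral_subset_le qi)
  finally have le': "U x \<le> c * exp (integral {0..1} (\<lambda>t. \<bar>q t\<bar>))" .
  have "norm (u x) = exp (\<eta> * x) * U x" by (simp add: U_def exp_minus)
  also have "\<dots> \<le> exp (\<eta> * x) * (c * exp (integral {0..1} (\<lambda>t. \<bar>q t\<bar>)))"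
    by (rule mult_left_mono[OF le']) simp
  finally show ?thesis by (simp add: c_def \<eta>_def mult_ac)
qed

lemma solves_asymptotics:
  assumes s: "solves (energy_potential q (k\<^sup>2)) (\<lambda>_. 0) u v" and k: "norm k \<ge> 1"
  defines "I \<equiv> integral {0..1} (\<lambda>t. \<bar>q t\<bar>)"
  defines "C \<equiv> (norm (u 0) + norm (v 0) / norm k) * exp I * I * exp \<bar>Im k\<bar>"
  shows "norm (u 1 - (u 0 * cos k + v 0 * (sin k / k))) \<le> C / norm k"
    and "norm (v 1 - (v 0 * cos k - k * u 0 * sin k)) \<le> C"
proof -
  have k0: "k \<noteq> 0" using k by auto
  define c where "c = (norm (u 0) + norm (v 0) / norm k) * exp I"
  have c0: "c \<ge> 0" by (simp add: c_def)
  have qi: "(\<lambda>t. \<bar>q t\<bar>) integrable_on {0..1}"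
    using q by (simp add: absolutely_integrable_on_def)
  have bd: "norm (w * (of_real (q t) * u t)) \<le> (m * c * exp \<bar>Im k\<bar>) * \<bar>q t\<bar>"
    if "t \<in> {0..1}" "norm w \<le> m * exp (\<bar>Im k\<bar> * (1 - t))" "m \<ge> 0" for w t m
  proof -
    have "norm w * (\<bar>q t\<bar> * norm (u t)) \<le> (m * exp (\<bar>Im k\<bar> * (1 - t))) * (\<bar>q t\<bar> * (c * exp (\<bar>Im k\<bar> * t)))"
      using solves_growth[OF s k that(1)] that c0 unfolding c_def I_def
      by (intro mult_mono mult_left_mono) auto
    also have "\<dots> = (m * c * exp \<bar>Im k\<bar>) * \<bar>q t\<bar>"
      by (simp add: right_diff_distrib exp_diff)
    finally show ?thesis by (simp add: norm_mult)
  qed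
  have iq: "(\<lambda>t. r * \<bar>q t\<bar>) integrable_on {0..1}" for r
    using integrable_cmul[OF qi, of r] by simp
  have one: "(1::real) \<in> {0..1}" by simp
  note H1 = solves_representation(1)[OF s k0 one] and H2 = solves_representation(2)[OF s k0 one]
  have "norm (u 1 - (u 0 * cos (k * of_real 1) + v 0 * (sin (k * of_real 1) / k))) \<le> integral {0..1} (\<lambda>t. (inverse (norm k) * c * exp \<bar>Im k\<bar>) * \<bar>q t\<bar>)"
    unfolding integral_unique[OF H1, symmetric]
  proof (rule integral_norm_bound_integral[OF _ iq])
    fix t :: real assume t: "t \<in> {0..1}"
    show "norm (sin (k * of_real (1 - t)) / k * (of_real (q t) * u t)) \<le> (inverse (norm k) * c * exp \<bar>Im k\<bar>) * \<bar>q t\<bar>"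
      using t norm_sin_cos_mult_of_real_le(1)[of "1 - t" k] by (intro bd) (auto simp: norm_divide field_simps k0)
  qed (use H1 in auto)
  then show "norm (u 1 - (u 0 * cos k + v 0 * (sin k / k))) \<le> C / norm k"
    unfolding integral_mult_right C_def c_def I_def by (simp add: divide_inverse mult_ac)
  have "norm (v 1 - (v 0 * cos (k * of_real 1) - k * u 0 * sin (k * of_real 1))) \<le> integral {0..1} (\<lambda>t. (1 * c * exp \<bar>Im k\<bar>) * \<bar>q t\<bar>)"
    unfolding integral_unique[OF H2, symmetric]
  proof (rule integral_norm_bound_integral[OF _ iq])
    fix t :: real assume t: "t \<in> {0..1}"
    show "norm (cos (k * of_real (1 - t)) * (of_real (q t) * u t)) \<le> (1 * c * exp \<bar>Im k\<bar>) * \<bar>q t\<bar>"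
      using t norm_sin_cos_mult_of_real_le(2)[of "1 - t" k] by (intro bd) auto
  qed (use H2 in auto)
  then show "norm (v 1 - (v 0 * cos k - k * u 0 * sin k)) \<le> C"
    unfolding integral_mult_right C_def c_def I_def by (simp add: mult_ac)
qed

end

section \<open>The spectrum as a zero set\<close>

lemma solves_zero: "solves Q (\<lambda>_. 0) (\<lambda>_. 0) (\<lambda>_. 0)"
  unfolding solves_def by (auto intro!: AC_of_vector_derivative)

lemma solves_cmult:
  assumes "solves Q f u v"
  shows "solves Q (\<lambda>x. c * f x) (\<lambda>x. c * u x) (\<lambda>x. c * v x)"
  using solves_linear[OF solves_zero assms, of c] by simp

lemma solves_diff:
  assumes "solves Q f u v" "solves Q f' u' v'"
  shows "solves Q (\<lambda>x. f x - f' x) (\<lambda>x. u x - u' x) (\<lambda>x. v x - v' x)"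
  using solves_linear[OF assms, of "-1"] by simp

text \<open>The left-hand side of the boundary condition at \<open>1\<close>, for the solution that satisfies the boundary
  condition at \<open>0\<close>. Its zeros are the eigenvalues.\<close>

definition char_fn :: "(real \<Rightarrow> real) \<Rightarrow> real \<Rightarrow> real \<Rightarrow> complex \<Rightarrow> complex" where
  "char_fn q h H z = dsol q 1 (- of_real h) z 1 + of_real H * sol q 1 (- of_real h) z 1"

lemma Lp_on_2_iff:
  fixes f :: "real \<Rightarrow> complex"
  shows "Lp_on 2 X f \<longleftrightarrow> f \<in> borel_measurable (lebesgue_on X) \<and> integrable (lebesgue_on X) (\<lambda>x. (norm (f x))\<^sup>2)"
  by (simp add: Lp_on_def)

lemma continuous_imp_Lp_on_2:
  fixes f :: "real \<Rightarrow> complex"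
  assumes "continuous_on {0..1} f"
  shows "Lp_on 2 {0..1} f"
  unfolding Lp_on_2_iff
proof
  show "f \<in> borel_measurable (lebesgue_on {0..1})"
    using assms by (rule continuous_imp_measurable_on_sets_lebesgue) auto
  have "(\<lambda>x. (norm (f x))\<^sup>2) absolutely_integrable_on {0..1}"
    by (intro absolutely_integrable_continuous_real continuous_intros assms)
  then show "integrable (lebesgue_on {0..1}) (\<lambda>x. (norm (f x))\<^sup>2)"
    by (rule absolutely_integrable_imp_integrable) auto
qed

lemma Lp_on_2_add:
  fixes f g :: "real \<Rightarrow> complex"
  assumes "Lp_on 2 X f" "Lp_on 2 X g"
  shows "Lp_on 2 X (\<lambda>x. f x + g x)"
  unfolding Lp_on_2_iff
proof
  have m: "f \<in> borel_measurable (lebesgue_on X)" "g \<in> borel_measurable (lebesgue_on X)"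
    using assms by (auto simp: Lp_on_2_iff)
  then show m': "(\<lambda>x. f x + g x) \<in> borel_measurable (lebesgue_on X)" by simp
  show "integrable (lebesgue_on X) (\<lambda>x. (norm (f x + g x))\<^sup>2)"
  proof (rule Bochner_Integration.integrable_bound)
    show "integrable (lebesgue_on X) (\<lambda>x. 2 * (norm (f x))\<^sup>2 + 2 * (norm (g x))\<^sup>2)"
      using assms by (auto simp: Lp_on_2_iff)
    show "(\<lambda>x. (norm (f x + g x))\<^sup>2) \<in> borel_measurable (lebesgue_on X)"
      using m' by measurable
    have "(norm (f x + g x))\<^sup>2 \<le> 2 * (norm (f x))\<^sup>2 + 2 * (norm (g x))\<^sup>2" for x
    proof -
      have "(norm (f x + g x))\<^sup>2 \<le> (norm (f x) + norm (g x))\<^sup>2"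
        by (intro power_mono norm_triangle_ineq) auto
      also have "\<dots> \<le> 2 * (norm (f x))\<^sup>2 + 2 * (norm (g x))\<^sup>2"
        using sum_squares_ge_zero[of "norm (f x) - norm (g x)" 0] by (simp add: power2_eq_square algebra_simps)
      finally show ?thesis .
    qed
    then show "AE x in lebesgue_on X. norm ((norm (f x + g x))\<^sup>2) \<le> norm (2 * (norm (f x))\<^sup>2 + 2 * (norm (g x))\<^sup>2)"
      by (intro AE_I2) auto
  qed
qed

text \<open>The second part is the Cauchy-Schwarz inequality; it follows from integrating
  \<open>(norm (f x) - m)\<^sup>2 \<ge> 0\<close>, where \<open>m\<close> is the mean of
  \<open>norm f\<close>.\<close>

lemma Lp_on_2_imp_absolutely_integrable:
  fixes f :: "real \<Rightarrow> complex"
  assumes "Lp_on 2 {0..1} f"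
  shows "f absolutely_integrable_on {0..1}" "integral {0..1} (\<lambda>x. norm (f x)) \<le> L2_norm f"
proof -
  have fm: "f \<in> borel_measurable (lebesgue_on {0..1})" and f2: "integrable (lebesgue_on {0..1}) (\<lambda>x. (norm (f x))\<^sup>2)"
    using assms by (auto simp: Lp_on_2_iff)
  have i2: "(\<lambda>x. (norm (f x))\<^sup>2) integrable_on {0..1}"
    using f2 by (rule integrable_on_lebesgue_on) auto
  have L2: "L2_norm f = sqrt (integral {0..1} (\<lambda>x. (norm (f x))\<^sup>2))"
    unfolding L2_norm_def by (subst lebesgue_integral_eq_integral[OF f2]) auto
  show ai: "f absolutely_integrable_on {0..1}"
  proof (rule measurable_bounded_by_integrable_imp_absolutely_integrable[OF fm])
    show "(\<lambda>x. 1 + (norm (f x))\<^sup>2) integrable_on {0..1}"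
      by (intro integrable_add i2) (simp add: integrable_const_ivl)
    show "norm (f x) \<le> 1 + (norm (f x))\<^sup>2" for x
      using zero_le_power2[of "norm (f x) - 1/2"] by (simp add: power2_eq_square algebra_simps)
  qed auto
  have i1: "(\<lambda>x. norm (f x)) integrable_on {0..1}" using ai by (simp add: absolutely_integrable_on_def)
  define m where "m = integral {0..1} (\<lambda>x. norm (f x))"
  have "((\<lambda>x. (norm (f x))\<^sup>2 - 2 * m * norm (f x) + m\<^sup>2) has_integral
      (integral {0..1} (\<lambda>x. (norm (f x))\<^sup>2) - 2 * m * m + m\<^sup>2)) {0..1}"
    unfolding m_def
    by (intro has_integral_add has_integral_diff has_integral_mult_right integrable_integral i1 i2)
      (use has_integral_const_real[of "(integral {0..1} (\<lambda>x. norm (f x)))\<^sup>2" 0 "1::real"] in simp)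
  then have "0 \<le> integral {0..1} (\<lambda>x. (norm (f x))\<^sup>2) - 2 * m * m + m\<^sup>2"
  proof (rule has_integral_nonneg)
    show "0 \<le> (norm (f x))\<^sup>2 - 2 * m * norm (f x) + m\<^sup>2" for x
      using zero_le_power2[of "norm (f x) - m"] by (simp add: power2_eq_square algebra_simps)
  qed
  then have "m\<^sup>2 \<le> integral {0..1} (\<lambda>x. (norm (f x))\<^sup>2)" by (simp add: power2_eq_square)
  then show "integral {0..1} (\<lambda>x. norm (f x)) \<le> L2_norm f"
    unfolding L2 m_def[symmetric] by (rule real_le_rsqrt)
qed

lemma L2_norm_le_sup:
  assumes c: "continuous_on {0..1} u" and B: "\<And>x. x \<in> {0..1} \<Longrightarrow> norm (u x) \<le> B"
  shows "L2_norm u \<le> B"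
proof -
  have B0: "B \<ge> 0" using order_trans[OF norm_ge_zero B[of 0]] by simp
  have i: "integrable (lebesgue_on {0..1}) (\<lambda>x. (norm (u x))\<^sup>2)"
    using continuous_imp_Lp_on_2[OF c] by (simp add: Lp_on_2_iff)
  have "(LINT x|lebesgue_on {0..1}. (norm (u x))\<^sup>2) = integral {0..1} (\<lambda>x. (norm (u x))\<^sup>2)"
    by (rule lebesgue_integral_eq_integral[OF i]) auto
  also have "\<dots> \<le> integral {0..1::real} (\<lambda>x. B\<^sup>2)"
    by (intro integral_le integrable_on_lebesgue_on[OF i] power_mono B) (auto simp: integrable_const_ivl)
  also have "\<dots> = B\<^sup>2" by simp
  finally show ?thesis unfolding L2_norm_def using B0 by (simp add: real_le_lsqrt)
qed

context
  fixes q :: "real \<Rightarrow> real"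
  assumes q: "q absolutely_integrable_on {0..1}"
begin

lemma sol_scale:
  assumes "x \<in> {0..1}"
  shows "sol q (c * \<alpha>) (c * \<beta>) z x = c * sol q \<alpha> \<beta> z x" "dsol q (c * \<alpha>) (c * \<beta>) z x = c * dsol q \<alpha> \<beta> z x"
  using sol_eqI[OF q _ assms, of z "\<lambda>x. c * sol q \<alpha> \<beta> z x" "\<lambda>x. c * dsol q \<alpha> \<beta> z x"]
    solves_cmult[OF sol_solves[OF q, of z \<alpha> \<beta>], of c] by (simp_all add: sol_at_0[OF q] dsol_at_0[OF q])

lemma schroedinger_of_solves:
  assumes s: "solves (energy_potential q z) f u v" and f: "Lp_on 2 {0..1} f"
    and "v 0 + of_real h * u 0 = 0" "v 1 + of_real H * u 1 = 0"
  shows "schroedinger q h H u (\<lambda>x. f x + z * u x)"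
proof -
  have ac: "AC_with_derivative u v" "AC_with_derivative v (\<lambda>x. energy_potential q z x * u x - f x)"
    using s by (auto simp: solves_def)
  have "Lp_on 2 {0..1} (\<lambda>x. f x + z * u x)"
    by (intro Lp_on_2_add f continuous_imp_Lp_on_2 continuous_intros AC_continuous[OF ac(1)])
  moreover have "AE x in lebesgue_on {0..1}. f x + z * u x
      = - (energy_potential q z x * u x - f x) + of_real (q x) * u x"
    by (intro AE_I2) (simp add: algebra_simps)
  ultimately show ?thesis
    unfolding schroedinger_def using ac assms(3,4) by blast
qed

lemma solves_of_schroedinger:
  assumes "schroedinger q h H u (\<lambda>x. f x + z * u x)"
  obtains v where "solves (energy_potential q z) f u v" "v 0 + of_real h * u 0 = 0" "v 1 + of_real H * u 1 = 0"
proof -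
  obtain v w where ac: "AC_with_derivative u v" "AC_with_derivative v w"
    and ae: "AE x in lebesgue_on {0..1}. f x + z * u x = - w x + of_real (q x) * u x"
    and bc: "v 0 + of_real h * u 0 = 0" "v 1 + of_real H * u 1 = 0"
    using assms unfolding schroedinger_def by blast
  have "AE x in lebesgue_on {0..1}. energy_potential q z x * u x - f x = w x"
    using ae by (rule AE_mp) (intro AE_I2 impI, simp add: algebra_simps add_eq_0_iff)
  then have "solves (energy_potential q z) f u v"
    using ac(1) AC_cong_AE[OF ac(2)] by (simp add: solves_def)
  then show ?thesis using that bc by blast
qed

text \<open>To the solution with zero initial data one adds the multiple of \<open>\<phi>\<close> that repairs the
  boundary condition at \<open>1\<close>; such a multiple exists because \<open>char_fn\<close> does not
  vanish. All quantities are bounded by the integral of \<open>norm f\<close>, hence by the norm of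
  \<open>f\<close>.\<close>

lemma char_fn_nonzero_imp_resolvent:
  assumes nz: "char_fn q h H z \<noteq> 0"
  shows "z \<in> resolvent_set q h H"
proof -
  let ?\<phi> = "sol q 1 (- of_real h) z" and ?\<phi>' = "dsol q 1 (- of_real h) z"
  define K where "K = exp (1 + integral {0..1} (\<lambda>t. norm (energy_potential q z t)))"
  have K0: "K > 0" by (simp add: K_def)
  obtain B where B: "\<And>x. x \<in> {0..1} \<Longrightarrow> norm (?\<phi> x) \<le> B"
  proof -
    have "bounded (?\<phi> ` {0..1})"
      by (intro compact_imp_bounded compact_continuous_image sol_continuous[OF q] compact_Icc)
    then show ?thesis using that unfolding bounded_iff by (auto simp del: atLeastAtMost_iff)
  qed
  define M where "M = K + (1 + \<bar>H\<bar>) * K / norm (char_fn q h H z) * B"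
  show ?thesis
    unfolding resolvent_set_def mem_Collect_eq
  proof (intro exI[of _ M] allI impI)
    fix f :: "real \<Rightarrow> complex" assume f: "Lp_on 2 {0..1} f"
    note fi = Lp_on_2_imp_absolutely_integrable[OF f]
    obtain u v where uv: "solves (energy_potential q z) f u v" "u 0 = 0" "v 0 = 0"
      by (rule solves_exists[OF energy_potential_integrable[OF q] fi(1)]) auto
    define c where "c = - (v 1 + of_real H * u 1) / char_fn q h H z"
    let ?U = "\<lambda>x. u x + c * ?\<phi> x" and ?V = "\<lambda>x. v x + c * ?\<phi>' x"
    have sU: "solves (energy_potential q z) f ?U ?V"
      using solves_linear[OF uv(1) sol_solves[OF q], of c] by simp
    have bc0: "?V 0 + of_real h * ?U 0 = 0"
      using uv by (simp add: sol_at_0[OF q] dsol_at_0[OF q])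
    have "?V 1 + of_real H * ?U 1 = (v 1 + of_real H * u 1) + c * char_fn q h H z"
      by (simp add: char_fn_def algebra_simps)
    then have bc1: "?V 1 + of_real H * ?U 1 = 0" using nz by (simp add: c_def)
    have "schroedinger q h H ?U (\<lambda>x. f x + z * ?U x)"
      by (rule schroedinger_of_solves[OF sU f bc0 bc1])
    moreover have "L2_norm ?U \<le> M * L2_norm f"
    proof -
      define I where "I = integral {0..1} (\<lambda>x. norm (f x))"
      have I0: "I \<ge> 0" unfolding I_def
        by (rule integral_nonneg) (use fi(1) in \<open>auto simp: absolutely_integrable_on_def\<close>)
      have b: "norm (u x) + norm (v x) \<le> I * K" if "x \<in> {0..1}" for x
        using solves_bound[OF energy_potential_integrable[OF q] fi(1) uv(1) that] uv(2,3) by (simp add: I_def K_def)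
      have "norm (v 1 + of_real H * u 1) \<le> norm (v 1) + \<bar>H\<bar> * norm (u 1)"
        by (metis norm_mult norm_of_real norm_triangle_ineq)
      also have "\<dots> \<le> (1 + \<bar>H\<bar>) * (norm (u 1) + norm (v 1))" by (simp add: algebra_simps)
      also have "\<dots> \<le> (1 + \<bar>H\<bar>) * (I * K)"
        using b[of 1] by (intro mult_left_mono) auto
      finally have c: "norm c \<le> (1 + \<bar>H\<bar>) * (I * K) / norm (char_fn q h H z)"
        unfolding c_def norm_divide norm_minus_cancel by (rule divide_right_mono) simp
      have "norm (?U x) \<le> M * I" if x: "x \<in> {0..1}" for x
      proof -
        have "norm (?U x) \<le> norm (u x) + norm c * norm (?\<phi> x)"
          by (metis norm_mult norm_triangle_ineq)
        also have "norm (u x) \<le> I * K" using b[OF x] norm_ge_zero[of "v x"] by linarith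
        also have "norm c * norm (?\<phi> x) \<le> ((1 + \<bar>H\<bar>) * (I * K) / norm (char_fn q h H z)) * B"
          using c B[OF x] I0 K0 by (intro mult_mono) auto
        also have "I * K + ((1 + \<bar>H\<bar>) * (I * K) / norm (char_fn q h H z)) * B = M * I"
          by (simp add: M_def algebra_simps)
        finally show ?thesis by simp
      qed
      then have "L2_norm ?U \<le> M * I"
        using sU AC_continuous by (intro L2_norm_le_sup) (auto simp: solves_def)
      also have "\<dots> \<le> M * L2_norm f"
      proof (rule mult_left_mono)
        show "I \<le> L2_norm f" using fi(2) by (simp add: I_def)
        show "0 \<le> M" using K0 order_trans[OF norm_ge_zero B[of 0]] unfolding M_def
          by (intro add_nonneg_nonneg mult_nonneg_nonneg divide_nonneg_nonneg) auto
      qed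
      finally show ?thesis .
    qed
    moreover have "\<forall>x\<in>{0..1}. u' x = ?U x" if u': "schroedinger q h H u' (\<lambda>x. f x + z * u' x)" for u'
    proof -
      obtain v' where v': "solves (energy_potential q z) f u' v'" "v' 0 + of_real h * u' 0 = 0" "v' 1 + of_real H * u' 1 = 0"
        using solves_of_schroedinger[OF u'] by blast
      let ?D = "\<lambda>x. u' x - ?U x" and ?D' = "\<lambda>x. v' x - ?V x"
      have sD: "solves (energy_potential q z) (\<lambda>_. 0) ?D ?D'"
        using solves_diff[OF v'(1) sU] by simp
      have D0: "?D' 0 = ?D 0 * (- of_real h)"
        using v'(2) bc0 by (simp add: algebra_simps add_eq_0_iff)
      have D: "?D x = ?D 0 * ?\<phi> x" "?D' x = ?D 0 * ?\<phi>' x" if "x \<in> {0..1}" for x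
        using sol_eqI[OF q sD that] sol_scale[OF that, of "?D 0" 1 "- of_real h" z] unfolding D0 by simp_all
      have "?D' 1 + of_real H * ?D 1 = (v' 1 + of_real H * u' 1) - (?V 1 + of_real H * ?U 1)"
        by (simp add: algebra_simps)
      then have "?D' 1 + of_real H * ?D 1 = 0" unfolding v'(3) bc1 by simp
      moreover have "?D 0 * char_fn q h H z = ?D' 1 + of_real H * ?D 1"
      proof -
        have one: "(1::real) \<in> {0..1}" by simp
        have "?D 0 * char_fn q h H z = ?D 0 * ?\<phi>' 1 + of_real H * (?D 0 * ?\<phi> 1)"
          by (simp only: char_fn_def distrib_left mult.left_commute)
        then show ?thesis unfolding D(1)[OF one, symmetric] D(2)[OF one, symmetric] .
      qed
      ultimately have "?D 0 * char_fn q h H z = 0" by (rule trans[rotated])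
      then have "?D 0 = 0" using nz by simp
      then have zero: "?D 0 * ?\<phi> x = 0" for x by (simp only: mult_zero_left)
      show ?thesis
      proof
        fix x :: real assume "x \<in> {0..1}"
        then have "?D x = 0" using trans[OF D(1) zero] by blast
        then show "u' x = ?U x" by simp
      qed
    qed
    ultimately show "\<exists>u. schroedinger q h H u (\<lambda>x. f x + z * u x) \<and> L2_norm u \<le> M * L2_norm f \<and>
        (\<forall>u'. schroedinger q h H u' (\<lambda>x. f x + z * u' x) \<longrightarrow> (\<forall>x\<in>{0..1}. u' x = u x))"
      by blast
  qed
qed

text \<open>The eigenfunction and the zero function solve the same problem, so uniqueness fails.\<close>

lemma char_fn_zero_imp_spectrum:
  assumes z: "char_fn q h H z = 0"
  shows "z \<in> spectrum q h H"
proof -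
  have L0: "Lp_on 2 {0..1} (\<lambda>_. 0 :: complex)" by (rule continuous_imp_Lp_on_2) simp
  have "schroedinger q h H (sol q 1 (- of_real h) z) (\<lambda>x. 0 + z * sol q 1 (- of_real h) z x)"
    using z by (intro schroedinger_of_solves[OF sol_solves[OF q] L0]) (auto simp: sol_at_0[OF q] dsol_at_0[OF q] char_fn_def)
  moreover have "schroedinger q h H (\<lambda>_. 0) (\<lambda>x. 0 + z * 0)"
    using schroedinger_of_solves[OF solves_zero L0, of h H] by simp
  ultimately have "z \<notin> resolvent_set q h H"
    unfolding resolvent_set_def mem_Collect_eq
  proof (intro notI, elim exE)
    fix M assume 1: "schroedinger q h H (sol q 1 (- of_real h) z) (\<lambda>x. 0 + z * sol q 1 (- of_real h) z x)"
      and 2: "schroedinger q h H (\<lambda>_. 0) (\<lambda>x. 0 + z * 0)"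
      and "\<forall>f. Lp_on 2 {0..1} f \<longrightarrow> (\<exists>u. schroedinger q h H u (\<lambda>x. f x + z * u x) \<and> L2_norm u \<le> M * L2_norm f \<and>
        (\<forall>u'. schroedinger q h H u' (\<lambda>x. f x + z * u' x) \<longrightarrow> (\<forall>x\<in>{0..1}. u' x = u x)))"
    with L0 obtain u where u: "\<And>u'. schroedinger q h H u' (\<lambda>x. 0 + z * u' x) \<Longrightarrow> (\<forall>x\<in>{0..1}. u' x = u x)"
      by blast
    have "sol q 1 (- of_real h) z 0 = u 0" using u[OF 1] by simp
    moreover have "0 = u 0" using u[OF 2] by simp
    ultimately show False by (simp add: sol_at_0[OF q])
  qed
  then show ?thesis by (simp add: spectrum_def)
qed

lemma spectrum_eq_zeros: "spectrum q h H = {z. char_fn q h H z = 0}"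
  using char_fn_nonzero_imp_resolvent char_fn_zero_imp_spectrum by (auto simp: spectrum_def)

end

section \<open>Location of the eigenvalues\<close>

text \<open>The squared moduli of sine and cosine at a point \<open>x + i y\<close> both have the form
  \<open>(cosh y)\<^sup>2 - w\<^sup>2\<close>. On the circles considered below, \<open>w\<close>
  vanishes at the two real points \<open>\<bar>x\<bar> = R\<close>, which gives the second bound on
  \<open>w\<close>. Away from the real axis \<open>cosh y\<close> dominates; close to it
  \<open>R - \<bar>x\<bar>\<close> is at most \<open>1/3\<close>.\<close>

lemma cosh_sq_minus_ge:
  fixes x y R w :: real
  assumes R: "R \<ge> 3" and xy: "x\<^sup>2 + y\<^sup>2 = R\<^sup>2"
    and w: "w\<^sup>2 \<le> 1" "w\<^sup>2 \<le> (R - \<bar>x\<bar>)\<^sup>2"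
  shows "exp \<bar>y\<bar> / 4 \<le> sqrt ((cosh y)\<^sup>2 - w\<^sup>2)"
proof -
  have e: "exp \<bar>y\<bar> \<le> 2 * cosh y"
    by (cases "y \<ge> 0") (auto simp: cosh_def)
  have "(exp \<bar>y\<bar> / 4)\<^sup>2 \<le> (cosh y)\<^sup>2 / 4"
    using power_mono[OF e, of 2] by (simp add: power_divide power_mult_distrib)
  also have "\<dots> \<le> (cosh y)\<^sup>2 - w\<^sup>2"
  proof (cases "\<bar>y\<bar> \<le> 1")
    case True
    have xR: "\<bar>x\<bar> \<le> R" using xy R by (metis abs_le_square_iff abs_of_nonneg le_add_same_cancel1 zero_le_power2 order_trans zero_le_numeral)
    have "(R - \<bar>x\<bar>) * 3 \<le> (R - \<bar>x\<bar>) * (R + \<bar>x\<bar>)" using R xR by (intro mult_left_mono) auto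
    also have "\<dots> = y\<^sup>2" using xy by (simp add: algebra_simps power2_eq_square)
    also have "\<dots> \<le> 1" using True by (simp add: abs_square_le_1)
    finally have "R - \<bar>x\<bar> \<le> 1/3" by simp
    then have "(R - \<bar>x\<bar>)\<^sup>2 \<le> (1/3)\<^sup>2" using xR by (intro power_mono) auto
    then have "w\<^sup>2 \<le> 1/9" using w by (simp add: power2_eq_square)
    moreover have "(cosh y)\<^sup>2 \<ge> 1" using cosh_real_ge_1[of y] by (simp add: one_le_power)
    ultimately show ?thesis by linarith
  next
    case False
    have "exp \<bar>y\<bar> \<ge> 1 + \<bar>y\<bar> + \<bar>y\<bar>\<^sup>2 / 2" by (rule exp_lower_Taylor_quadratic) simp
    moreover have "exp (-\<bar>y\<bar>) \<ge> 1 - \<bar>y\<bar>" using exp_ge_add_one_self[of "-\<bar>y\<bar>"] by simp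
    moreover have "cosh y = (exp \<bar>y\<bar> + exp (-\<bar>y\<bar>)) / 2" by (cases "y \<ge> 0") (auto simp: cosh_def)
    moreover have "\<bar>y\<bar>\<^sup>2 \<ge> 1" using False power_mono[of 1 "\<bar>y\<bar>" 2] by simp
    ultimately have "cosh y \<ge> 5/4" by argo
    then have "(cosh y)\<^sup>2 \<ge> (5/4)\<^sup>2" by (intro power_mono) auto
    then show ?thesis using w by (simp add: power2_eq_square)
  qed
  finally show ?thesis by (rule real_le_rsqrt)
qed

lemma cosh_squared_exp: "(cosh y)\<^sup>2 = (exp (2 * y) + inverse (exp (2 * y)) + 2) / (4::real)"
  by (simp add: cosh_def power2_eq_square algebra_simps exp_minus exp_add[symmetric] mult_exp_exp field_simps)

lemma norm_sin_eq: "norm (sin k) = sqrt ((cosh (Im k))\<^sup>2 - (cos (Re k))\<^sup>2)"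
proof -
  have "(norm (sin k))\<^sup>2 = (cosh (Im k))\<^sup>2 - (cos (Re k))\<^sup>2"
    unfolding norm_sin_squared cosh_squared_exp cos_double_cos by (simp add: field_simps)
  then show ?thesis by (metis norm_ge_zero real_sqrt_unique)
qed

lemma norm_cos_eq: "norm (cos k) = sqrt ((cosh (Im k))\<^sup>2 - (sin (Re k))\<^sup>2)"
proof -
  have "(norm (cos k))\<^sup>2 = (cosh (Im k))\<^sup>2 - (sin (Re k))\<^sup>2"
    unfolding norm_cos_squared cosh_def sin_squared_eq by (simp add: exp_minus power2_eq_square field_simps)
  then show ?thesis by (metis norm_ge_zero real_sqrt_unique)
qed

text \<open>The circle meets the real axis halfway between two zeros of the sine.\<close>

lemma norm_sin_lower_bound:
  assumes k: "norm k = (real m + 1/2) * pi" and m: "m \<ge> 1"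
  shows "exp \<bar>Im k\<bar> / 4 \<le> norm (sin k)"
  unfolding norm_sin_eq
proof (rule cosh_sq_minus_ge)
  have "(real m + 1/2) * pi \<ge> 1 * pi" using m by (intro mult_right_mono) auto
  then show "norm k \<ge> 3" using k pi_gt3 by linarith
  show "(Re k)\<^sup>2 + (Im k)\<^sup>2 = (norm k)\<^sup>2" by (simp add: cmod_power2)
  show "(cos (Re k))\<^sup>2 \<le> 1" by (simp add: abs_square_le_1)
  let ?d = "norm k - \<bar>Re k\<bar>"
  have "cos (Re k) = cos \<bar>Re k\<bar>" by simp
  also have "\<bar>Re k\<bar> = (real m * pi + pi/2) - ?d" using k by (simp add: algebra_simps)
  also have "cos \<dots> = cos (real m * pi) * cos (pi/2 - ?d) - sin (real m * pi) * sin (pi/2 - ?d)"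
    by (metis add_diff_eq cos_add)
  also have "\<dots> = cos (real m * pi) * sin ?d" by (simp add: cos_diff)
  finally have "(cos (Re k))\<^sup>2 = (sin ?d)\<^sup>2" by (simp add: power_mult_distrib cos_npi power_even_eq[symmetric])
  moreover have "\<bar>sin ?d\<bar> \<le> \<bar>?d\<bar>" by (rule abs_sin_x_le_abs_x)
  ultimately show "(cos (Re k))\<^sup>2 \<le> ?d\<^sup>2" using abs_le_square_iff by metis
qed

text \<open>The circle meets the real axis where the cosine is \<open>1\<close> or \<open>-1\<close>.\<close>

lemma norm_cos_lower_bound:
  assumes k: "norm k = real m * pi" and m: "m \<ge> 1"
  shows "exp \<bar>Im k\<bar> / 4 \<le> norm (cos k)"
  unfolding norm_cos_eq
proof (rule cosh_sq_minus_ge)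
  have "real m * pi \<ge> 1 * pi" using m by (intro mult_right_mono) auto
  then show "norm k \<ge> 3" using k pi_gt3 by linarith
  show "(Re k)\<^sup>2 + (Im k)\<^sup>2 = (norm k)\<^sup>2" by (simp add: cmod_power2)
  show "(sin (Re k))\<^sup>2 \<le> 1" by (simp add: abs_square_le_1)
  let ?d = "norm k - \<bar>Re k\<bar>"
  have "(sin (Re k))\<^sup>2 = (sin \<bar>Re k\<bar>)\<^sup>2" by (cases "Re k \<ge> 0") auto
  also have "\<bar>Re k\<bar> = real m * pi - ?d" using k by (simp add: algebra_simps)
  also have "(sin (real m * pi - ?d))\<^sup>2 = (sin ?d)\<^sup>2" by (simp add: sin_diff power_mult_distrib cos_npi power_even_eq[symmetric])
  finally have "(sin (Re k))\<^sup>2 = (sin ?d)\<^sup>2" .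
  moreover have "\<bar>sin ?d\<bar> \<le> \<bar>?d\<bar>" by (rule abs_sin_x_le_abs_x)
  ultimately show "(sin (Re k))\<^sup>2 \<le> ?d\<^sup>2" using abs_le_square_iff by metis
qed

context
  fixes q :: "real \<Rightarrow> real"
  assumes q: "q absolutely_integrable_on {0..1}"
begin

lemma char_fn_holomorphic: "char_fn q h H holomorphic_on A"
  unfolding char_fn_def[abs_def] by (intro holomorphic_intros sol_holomorphic[OF q]) auto

text \<open>Lagrange's identity for \<open>\<phi>\<close> and its complex conjugate, which solves the equation with the
  conjugate energy.\<close>

lemma lagrange_identity:
  fixes h :: real and z :: complex
  assumes x: "x \<in> {0..1}"
  defines "\<phi> \<equiv> sol q 1 (- of_real h) z" and "\<phi>' \<equiv> dsol q 1 (- of_real h) z"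
  shows "2 * \<i> * of_real (Im z * integral {0..x} (\<lambda>t. (norm (\<phi> t))\<^sup>2)) = \<phi> x * cnj (\<phi>' x) - \<phi>' x * cnj (\<phi> x)"
proof -
  have s: "solves (energy_potential q z) (\<lambda>_. 0) \<phi> \<phi>'" unfolding \<phi>_def \<phi>'_def by (rule sol_solves[OF q])
  have s': "solves (energy_potential q (cnj z)) (\<lambda>_. 0) (\<lambda>x. cnj (\<phi> x)) (\<lambda>x. cnj (\<phi>' x))"
    using s AC_cnj[of \<phi> \<phi>'] AC_cnj[of \<phi>'] unfolding solves_def by fastforce
  have c: "continuous_on {0..x} (\<lambda>t. (norm (\<phi> t))\<^sup>2)"
    unfolding \<phi>_def using x by (intro continuous_intros continuous_on_subset[OF sol_continuous[OF q]]) auto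
  have "((\<lambda>t. (norm (\<phi> t))\<^sup>2) has_integral integral {0..x} (\<lambda>t. (norm (\<phi> t))\<^sup>2)) {0..x}"
    by (intro integrable_integral integrable_continuous_real c)
  from has_integral_mult_right[OF has_integral_of_real[OF this], of "2 * \<i> * of_real (Im z)"]
  have A: "((\<lambda>t. 2 * \<i> * of_real (Im z) * of_real ((norm (\<phi> t))\<^sup>2)) has_integral
      2 * \<i> * of_real (Im z * integral {0..x} (\<lambda>t. (norm (\<phi> t))\<^sup>2))) {0..x}"
    by (simp add: mult.assoc)
  have zz: "z - cnj z = 2 * \<i> * of_real (Im z)" by (simp add: complex_eq_iff)
  have "((\<lambda>t. (z - cnj z) * \<phi> t * cnj (\<phi> t)) has_integral \<phi> x * cnj (\<phi>' x) - \<phi>' x * cnj (\<phi> x)) {0..x}"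
    using wronskian_has_integral[OF s s' x]
    by (simp add: \<phi>_def \<phi>'_def sol_at_0[OF q] dsol_at_0[OF q])
  then have B: "((\<lambda>t. 2 * \<i> * of_real (Im z) * of_real ((norm (\<phi> t))\<^sup>2)) has_integral
       \<phi> x * cnj (\<phi>' x) - \<phi>' x * cnj (\<phi> x)) {0..x}"
    unfolding zz by (simp add: mult.assoc complex_norm_square del: of_real_power)
  show ?thesis using has_integral_unique[OF A B] .
qed

lemma sol_sq_integral_pos:
  assumes x: "0 < x" "x \<le> 1"
  shows "integral {0..x} (\<lambda>t. (norm (sol q 1 \<beta> z t))\<^sup>2) > 0"
proof -
  have c: "continuous_on {0..x} (\<lambda>t. (norm (sol q 1 \<beta> z t))\<^sup>2)"
    using x by (intro continuous_intros continuous_on_subset[OF sol_continuous[OF q]]) auto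
  have "integral {0..x} (\<lambda>t. (norm (sol q 1 \<beta> z t))\<^sup>2) \<noteq> 0"
  proof
    assume "integral {0..x} (\<lambda>t. (norm (sol q 1 \<beta> z t))\<^sup>2) = 0"
    then have "(norm (sol q 1 \<beta> z 0))\<^sup>2 = 0"
      using integral_eq_0_iff[OF c] x by auto
    then show False by (simp add: sol_at_0[OF q])
  qed
  moreover have "integral {0..x} (\<lambda>t. (norm (sol q 1 \<beta> z t))\<^sup>2) \<ge> 0"
    by (rule integral_nonneg) (auto intro!: integrable_continuous_real c)
  ultimately show ?thesis by linarith
qed

text \<open>A zero at \<open>x > 0\<close> would be a Dirichlet condition there and make the energy real.\<close>

lemma sol_nonreal_nonzero:
  assumes "Im z \<noteq> 0" "x \<in> {0..1}"
  shows "sol q 1 (- of_real h) z x \<noteq> 0"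
proof (cases "x = 0")
  case True
  then show ?thesis by (simp add: sol_at_0[OF q])
next
  case False
  then show ?thesis
    using lagrange_identity[OF assms(2), of z h] sol_sq_integral_pos[of x "- of_real h" z] assms by auto
qed

lemma char_fn_zero_real:
  assumes "char_fn q h H z = 0"
  shows "Im z = 0"
proof -
  have "dsol q 1 (- of_real h) z 1 = - of_real H * sol q 1 (- of_real h) z 1"
    using assms by (simp add: char_fn_def add_eq_0_iff)
  then show ?thesis
    using lagrange_identity[of 1 z h] sol_sq_integral_pos[of 1 "- of_real h" z] by simp
qed

text \<open>Let \<open>\<psi>\<close> be the derivative of \<open>\<phi>\<close> with respect to the energy. At an
  eigenvalue, the Wronskian of \<open>\<phi>\<close> and \<open>\<psi>\<close> at \<open>1\<close> is
  \<open>\<phi> 1\<close> times the derivative of \<open>char_fn\<close>; by Lagrange's identity it is also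
  minus the integral of \<open>\<phi>\<^sup>2\<close>, which is not zero because the energy, and hence
  \<open>\<phi>\<close>, is real.\<close>

lemma char_fn_zero_simple:
  assumes "char_fn q h H z = 0"
  shows "deriv (char_fn q h H) z \<noteq> 0"
proof
  assume d0: "deriv (char_fn q h H) z = 0"
  let ?\<phi> = "sol q 1 (- of_real h) z" and ?\<phi>' = "dsol q 1 (- of_real h) z"
  obtain \<psi> \<psi>' where psi: "solves (energy_potential q z) ?\<phi> \<psi> \<psi>'" "\<psi> 0 = 0" "\<psi>' 0 = 0"
    "\<And>x. x \<in> {0..1} \<Longrightarrow> ((\<lambda>z. sol q 1 (- of_real h) z x) has_field_derivative \<psi> x) (at z)"
    "\<And>x. x \<in> {0..1} \<Longrightarrow> ((\<lambda>z. dsol q 1 (- of_real h) z x) has_field_derivative \<psi>' x) (at z)"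
    using sol_has_field_derivative[OF q, of z 1 "- of_real h"] by blast
  have "(char_fn q h H has_field_derivative \<psi>' 1 + of_real H * \<psi> 1) (at z)"
    unfolding char_fn_def[abs_def] by (intro DERIV_add DERIV_cmult psi) auto
  then have D: "\<psi>' 1 + of_real H * \<psi> 1 = 0" using d0 DERIV_imp_deriv by fastforce
  have "cnj z = z" using char_fn_zero_real[OF assms] by (simp add: complex_eq_iff)
  then have real: "cnj (?\<phi> x) = ?\<phi> x" if "x \<in> {0..1}" for x
    using sol_cnj(1)[OF q that, of 1 "- of_real h" z] by simp
  have "((\<lambda>t. - (?\<phi> t * ?\<phi> t)) has_integral ?\<phi> 1 * \<psi>' 1 - ?\<phi>' 1 * \<psi> 1) {0..1}"
    using wronskian_has_integral[OF sol_solves[OF q, of z 1 "- of_real h"] psi(1), of 1] psi(2,3) by simp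
  moreover have "?\<phi>' 1 = - of_real H * ?\<phi> 1"
    using assms by (simp add: char_fn_def add_eq_0_iff)
  ultimately have "((\<lambda>t. - (?\<phi> t * ?\<phi> t)) has_integral ?\<phi> 1 * (\<psi>' 1 + of_real H * \<psi> 1)) {0..1}"
    by (simp add: algebra_simps)
  then have "((\<lambda>t. - (?\<phi> t * ?\<phi> t)) has_integral 0) {0..1}" unfolding D by simp
  then have "((\<lambda>t. - of_real ((norm (?\<phi> t))\<^sup>2)) has_integral (0::complex)) {0..1}"
    by (rule has_integral_eq[rotated]) (use real in \<open>simp add: complex_norm_square del: of_real_power\<close>)
  from has_integral_linear[OF this bounded_linear_Re]
  have "((\<lambda>t. - ((norm (?\<phi> t))\<^sup>2)) has_integral 0) {0..1}" by (simp add: o_def)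
  from has_integral_neg[OF this] have "integral {0..1} (\<lambda>t. (norm (?\<phi> t))\<^sup>2) = 0"
    by (simp add: has_integral_iff)
  then show False using sol_sq_integral_pos[of 1 "- of_real h" z] by simp
qed

lemma char_fn_zorder:
  assumes "char_fn q h H z = 0"
  shows "zorder (char_fn q h H) z = 1"
  by (rule zorder_zero_eqI[OF char_fn_holomorphic[of h H UNIV]]) (use assms char_fn_zero_simple[OF assms] in auto)

lemma char_fn_asymptotics:
  obtains C where "C > 0" "\<And>k. norm k \<ge> 1 \<Longrightarrow> norm (char_fn q h H (k\<^sup>2) + k * sin k) \<le> C * exp \<bar>Im k\<bar>"
proof -
  define I where "I = integral {0..1} (\<lambda>t. \<bar>q t\<bar>)"
  have I0: "I \<ge> 0" unfolding I_def by (rule integral_nonneg) (use q in \<open>auto simp: absolutely_integrable_on_def\<close>)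
  define c where "c = (1 + \<bar>h\<bar>) * exp I"
  have c0: "c \<ge> 0" by (simp add: c_def)
  define C where "C = \<bar>h\<bar> + c * I + \<bar>H\<bar> * c + 1"
  show ?thesis
  proof (rule that[of C])
    show "C > 0" using c0 I0 unfolding C_def by (auto intro!: add_nonneg_pos add_nonneg_nonneg)
    fix k :: complex assume k: "norm k \<ge> 1"
    let ?u = "sol q 1 (- of_real h) (k\<^sup>2)" and ?v = "dsol q 1 (- of_real h) (k\<^sup>2)"
    let ?E = "exp \<bar>Im k\<bar>"
    have su: "solves (energy_potential q (k\<^sup>2)) (\<lambda>_. 0) ?u ?v" by (rule sol_solves[OF q])
    have hk: "\<bar>h\<bar> / norm k \<le> \<bar>h\<bar>" using k by (simp add: divide_le_eq mult_le_cancel_left1)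
    have cc: "(1 + \<bar>h\<bar> / norm k) * exp I \<le> c" using hk unfolding c_def by (intro mult_right_mono) auto
    have "norm (?v 1 - (- of_real h * cos k - k * sin k)) \<le> (1 + \<bar>h\<bar> / norm k) * exp I * I * ?E"
      using solves_asymptotics(2)[OF q su k]
      by (simp add: sol_at_0[OF q] dsol_at_0[OF q] I_def)
    also have "\<dots> \<le> c * I * ?E" using cc I0 by (intro mult_right_mono) auto
    finally have 1: "norm (?v 1 - (- of_real h * cos k - k * sin k)) \<le> c * I * ?E" .
    have "norm (?u 1) \<le> (1 + \<bar>h\<bar> / norm k) * exp I * ?E"
      using solves_growth[OF q su k, of 1]
      by (simp add: sol_at_0[OF q] dsol_at_0[OF q] I_def)
    also have "\<dots> \<le> c * ?E" using cc by (intro mult_right_mono) auto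
    finally have 2: "norm (of_real H * ?u 1) \<le> \<bar>H\<bar> * c * ?E"
      by (simp add: norm_mult mult.assoc mult_left_mono)
    have 3: "norm (of_real h * cos k) \<le> \<bar>h\<bar> * ?E"
      using norm_sin_cos_mult_of_real_le(2)[of 1 k] by (simp add: norm_mult mult_left_mono)
    have eq: "char_fn q h H (k\<^sup>2) + k * sin k = (?v 1 - (- of_real h * cos k - k * sin k)) + of_real H * ?u 1 - of_real h * cos k"
      by (simp add: char_fn_def)
    have "norm (char_fn q h H (k\<^sup>2) + k * sin k) \<le> c * I * ?E + \<bar>H\<bar> * c * ?E + \<bar>h\<bar> * ?E"
      unfolding eq using 1 2 3 norm_triangle_ineq4[of "(?v 1 - (- of_real h * cos k - k * sin k)) + of_real H * ?u 1" "of_real h * cos k"]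
        norm_triangle_ineq[of "?v 1 - (- of_real h * cos k - k * sin k)" "of_real H * ?u 1"] by linarith
    also have "\<dots> \<le> C * ?E" by (simp add: C_def algebra_simps)
    finally show "norm (char_fn q h H (k\<^sup>2) + k * sin k) \<le> C * ?E" .
  qed
qed

text \<open>For \<open>z = - y\<^sup>2\<close> the leading term has modulus \<open>y * sinh y\<close>
  and outgrows the error \<open>C * exp y\<close>.\<close>

lemma char_fn_zeros_bounded_below:
  obtains B where "\<And>z. char_fn q h H z = 0 \<Longrightarrow> Re z \<ge> - B"
proof -
  obtain C where C: "C > 0" "\<And>k. norm k \<ge> 1 \<Longrightarrow> norm (char_fn q h H (k\<^sup>2) + k * sin k) \<le> C * exp \<bar>Im k\<bar>"
    by (rule char_fn_asymptotics) blast
  show ?thesis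
  proof (rule that[of "(4 * C + 1)\<^sup>2"])
    fix z assume z: "char_fn q h H z = 0"
    show "Re z \<ge> - (4 * C + 1)\<^sup>2"
    proof (rule ccontr)
      assume "\<not> Re z \<ge> - (4 * C + 1)\<^sup>2"
      then have less: "(4 * C + 1)\<^sup>2 < - Re z" by simp
      define y where "y = sqrt (- Re z)"
      have "4 * C + 1 < y" unfolding y_def using less C by (intro real_less_rsqrt)
      then have y: "y > 1" "y > 4 * C" using C by auto
      have "- Re z \<ge> 0" using less zero_le_power2[of "4 * C + 1"] by linarith
      then have zk: "z = (\<i> * of_real y)\<^sup>2"
        using char_fn_zero_real[OF z] by (simp add: power_mult_distrib y_def complex_eq_iff flip: of_real_power)
      have "y * norm (sin (\<i> * of_real y)) \<le> C * exp y"
        using C(2)[of "\<i> * of_real y"] z zk y by (simp add: norm_mult)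
      moreover have "norm (sin (\<i> * of_real y)) \<ge> exp y / 4"
      proof -
        have "exp \<bar>y\<bar> / 4 \<le> sqrt ((cosh y)\<^sup>2 - 1)"
        proof -
          have "exp y \<ge> 2" using exp_ge_add_one_self[of y] y by linarith
          then have e4: "exp (-y) \<le> exp y / 4"
            using mult_mono[of 2 "exp y" 2 "exp y"] by (simp add: exp_minus field_simps)
          have "m \<le> e / 4 \<Longrightarrow> 0 < e \<Longrightarrow> e / 4 \<le> (e - m) / 2" for e m :: real by (simp add: field_simps)
          from this[OF e4 exp_gt_zero] have "exp y / 4 \<le> sinh y" unfolding sinh_field_def .
          moreover have "(cosh y)\<^sup>2 - 1 = (sinh y)\<^sup>2" using hyperbolic_pythagoras[of y] by simp
          ultimately show ?thesis using y by simp
        qed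
        then show ?thesis unfolding norm_sin_eq using y by simp
      qed
      ultimately have "y * (exp y / 4) \<le> C * exp y"
        using mult_left_mono[of "exp y / 4" "norm (sin (\<i> * of_real y))" y] y by linarith
      then have "y / 4 * exp y \<le> C * exp y" by simp
      then have "y / 4 \<le> C" by (rule mult_right_le_imp_le) simp
      then show False using y by simp
    qed
  qed
qed

lemma char_fn_not_constant: "\<not> char_fn q h H constant_on UNIV"
proof
  assume c: "char_fn q h H constant_on UNIV"
  obtain B where B: "\<And>z. char_fn q h H z = 0 \<Longrightarrow> Re z \<ge> - B" by (rule char_fn_zeros_bounded_below) blast
  obtain w where w: "\<And>z. char_fn q h H z = w" using c unfolding constant_on_def by auto
  obtain C where C: "C > 0" "\<And>k. norm k \<ge> 1 \<Longrightarrow> norm (char_fn q h H (k\<^sup>2) + k * sin k) \<le> C * exp \<bar>Im k\<bar>"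
    by (rule char_fn_asymptotics) blast
  obtain m :: nat where m: "real m > C + norm w" using reals_Archimedean2 by blast
  define k where "k = (real m + 1/2) * pi"
  have "real m \<ge> 1" using m C(1) norm_ge_zero[of w] by (metis add_pos_nonneg gr0I less_trans of_nat_0 less_irrefl of_nat_1 of_nat_le_iff Suc_leI One_nat_def)
  then have km: "k \<ge> real m" "k \<ge> 1" unfolding k_def using pi_gt3 mult_mono[of "real m" "real m + 1/2" 1 pi] by auto
  have "\<bar>sin k\<bar> = 1"
  proof -
    have "k = real m * pi + pi/2" by (simp add: k_def algebra_simps)
    then have "sin k = cos (real m * pi)" by (simp add: sin_add)
    then show ?thesis by (simp add: cos_npi)
  qed
  then have "norm (complex_of_real k * sin (of_real k)) = k"
    using km by (simp add: norm_mult sin_of_real)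
  moreover have "norm (w + complex_of_real k * sin (of_real k)) \<le> C"
    using C(2)[of "of_real k"] km w by simp
  ultimately have "k \<le> C + norm w"
    using norm_triangle_ineq4[of "w + complex_of_real k * sin (of_real k)" w] by simp
  then show False using m km by simp
qed

lemma char_fn_zeros_finite: "finite {z. char_fn q h H z = 0 \<and> norm z \<le> R}"
proof -
  have "finite {z \<in> cball 0 R. char_fn q h H z = 0}"
    by (rule holomorphic_compact_finite_zeros[OF char_fn_holomorphic[of h H UNIV]]) (auto simp: char_fn_not_constant)
  then show ?thesis by (rule rev_finite_subset) auto
qed

end

section \<open>Counting eigenvalues\<close>

text \<open>The free operator with Neumann conditions is the comparison operator for Rouche's theorem.\<close>

lemma char_fn_free: "char_fn (\<lambda>_. 0) 0 0 (k\<^sup>2) = - k * sin k"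
proof -
  have q0: "(\<lambda>_. 0 :: real) absolutely_integrable_on {0..1}" by simp
  show ?thesis
  proof (cases "k = 0")
    case False
    have one: "(1::real) \<in> {0..1}" by simp
    have "((\<lambda>t. 0) has_integral (dsol (\<lambda>_. 0) 1 (- of_real 0) (k\<^sup>2) 1 - (- k * sin k))) {0..1::real}"
      using solves_representation(2)[OF q0 sol_solves[OF q0, of "k\<^sup>2" 1 "- of_real 0"] False one]
      by (simp add: sol_at_0[OF q0] dsol_at_0[OF q0])
    then have "dsol (\<lambda>_. 0) 1 (- of_real 0) (k\<^sup>2) 1 - (- k * sin k) = 0"
      by (rule has_integral_unique) (rule has_integral_0)
    then show ?thesis by (simp add: char_fn_def add_eq_0_iff)
  next
    case True
    have "solves (energy_potential (\<lambda>_. 0) 0) (\<lambda>_. 0) (\<lambda>_. 1) (\<lambda>_. 0)"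
      unfolding solves_def by (auto intro!: AC_of_vector_derivative)
    from sol_eqI(2)[OF q0 this, of 1] show ?thesis using True by (simp add: char_fn_def)
  qed
qed

lemma char_fn_free_zeros:
  "{z. char_fn (\<lambda>_. 0) 0 0 z = 0 \<and> norm z < ((real m + 1/2) * pi)\<^sup>2} = (\<lambda>n. of_real ((real n * pi)\<^sup>2)) ` {0..m}"
proof (intro equalityI subsetI)
  fix z assume "z \<in> {z. char_fn (\<lambda>_. 0) 0 0 z = 0 \<and> norm z < ((real m + 1/2) * pi)\<^sup>2}"
  then have z: "char_fn (\<lambda>_. 0) 0 0 ((csqrt z)\<^sup>2) = 0" "norm z < ((real m + 1/2) * pi)\<^sup>2" by auto
  then have "csqrt z * sin (csqrt z) = 0" unfolding char_fn_free by simp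
  then have "sin (csqrt z) = 0" by auto
  then obtain n :: int where n: "csqrt z = of_real (of_int n * pi)" using Complex_Transcendental.sin_eq_0 by auto
  then have zn: "z = of_real ((real (nat \<bar>n\<bar>) * pi)\<^sup>2)"
  proof -
    have "z = (csqrt z)\<^sup>2" by simp
    also have "\<dots> = of_real ((of_int n * pi)\<^sup>2)" unfolding n by simp
    also have "(of_int n * pi)\<^sup>2 = (real (nat \<bar>n\<bar>) * pi)\<^sup>2" by (simp add: power_mult_distrib)
    finally show ?thesis .
  qed
  then have "(real (nat \<bar>n\<bar>) * pi)\<^sup>2 < ((real m + 1/2) * pi)\<^sup>2" using z(2) by (simp del: of_real_power)
  then have "real (nat \<bar>n\<bar>) * pi < (real m + 1/2) * pi" by (rule power_less_imp_less_base) simp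
  then have "nat \<bar>n\<bar> \<le> m" by simp
  then show "z \<in> (\<lambda>n. of_real ((real n * pi)\<^sup>2)) ` {0..m}" using zn by (intro image_eqI[of _ _ "nat \<bar>n\<bar>"]) auto
next
  fix z assume "z \<in> (\<lambda>n. complex_of_real ((real n * pi)\<^sup>2)) ` {0..m}"
  then obtain n where n: "n \<le> m" "z = of_real ((real n * pi)\<^sup>2)" by auto
  have "char_fn (\<lambda>_. 0) 0 0 ((of_real (real n * pi))\<^sup>2) = 0"
    unfolding char_fn_free sin_of_real by simp
  moreover have "(real n * pi)\<^sup>2 < ((real m + 1/2) * pi)\<^sup>2"
    using n by (intro power_strict_mono) auto
  moreover have "z = (of_real (real n * pi))\<^sup>2" "norm z = (real n * pi)\<^sup>2"
    unfolding n(2) norm_of_real by simp_all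
  ultimately show "z \<in> {z. char_fn (\<lambda>_. 0) 0 0 z = 0 \<and> norm z < ((real m + 1/2) * pi)\<^sup>2}"
    by (simp only: mem_Collect_eq)
qed

lemma card_char_fn_free_zeros:
  "card {z. char_fn (\<lambda>_. 0) 0 0 z = 0 \<and> norm z < ((real m + 1/2) * pi)\<^sup>2} = m + 1"
proof -
  have "inj_on (\<lambda>n. complex_of_real ((real n * pi)\<^sup>2)) {0..m}"
    by (rule inj_onI) (simp add: power2_eq_iff_nonneg del: of_real_power)
  then show ?thesis unfolding char_fn_free_zeros by (simp add: card_image)
qed

text \<open>Since all zeros are simple, the argument principle counts each of them once.\<close>

lemma winding_number_zero_count:
  assumes q: "q absolutely_integrable_on {0..1}" and \<rho>: "\<rho> > 0"
    and nz: "\<And>z. norm z = \<rho> \<Longrightarrow> char_fn q h H z \<noteq> 0"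
  shows "(\<Sum>p\<in>{p\<in>ball 0 (\<rho> + 1). char_fn q h H p = 0}. winding_number (circlepath 0 \<rho>) p * zorder (char_fn q h H) p)
    = of_nat (card {z. char_fn q h H z = 0 \<and> norm z < \<rho>})"
proof -
  let ?Z = "{p\<in>ball 0 (\<rho> + 1). char_fn q h H p = 0}" and ?Z' = "{z. char_fn q h H z = 0 \<and> norm z < \<rho>}"
  have fin: "finite ?Z"
    by (rule finite_subset[OF _ char_fn_zeros_finite[OF q, of h H "\<rho> + 1"]]) auto
  have in1: "winding_number (circlepath 0 \<rho>) p * zorder (char_fn q h H) p = 1" if "p \<in> ?Z'" for p
    using that char_fn_zorder[OF q, of h H p] winding_number_circlepath[of p 0 \<rho>] by auto
  have out: "winding_number (circlepath 0 \<rho>) p * zorder (char_fn q h H) p = 0" if "p \<in> ?Z - ?Z'" for p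
  proof -
    have "norm p > \<rho>" using that nz[of p] by fastforce
    then have "winding_number (circlepath 0 \<rho>) p = 0"
      using \<rho> by (intro winding_number_zero_outside[of _ "cball 0 \<rho>"]) auto
    then show ?thesis by simp
  qed
  have "(\<Sum>p\<in>?Z. winding_number (circlepath 0 \<rho>) p * zorder (char_fn q h H) p)
      = (\<Sum>p\<in>?Z'. winding_number (circlepath 0 \<rho>) p * zorder (char_fn q h H) p)"
    by (rule sum.mono_neutral_right[OF fin]) (use out in auto)
  also have "\<dots> = (\<Sum>p\<in>?Z'. 1)" by (rule sum.cong[OF refl in1])
  finally show ?thesis by simp
qed

context
  fixes q :: "real \<Rightarrow> real"
  assumes q: "q absolutely_integrable_on {0..1}"
begin

text \<open>Rouche's theorem on the circle of radius \<open>((m + 1/2) * pi)\<^sup>2\<close>: the free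
  characteristic function has modulus at least
  \<open>norm k * exp \<bar>Im k\<bar> / 4\<close> there, and the difference is at most
  \<open>C * exp \<bar>Im k\<bar>\<close>.\<close>

lemma card_char_fn_zeros:
  obtains m\<^sub>0 where "\<And>m. m \<ge> m\<^sub>0 \<Longrightarrow> card {z. char_fn q h H z = 0 \<and> norm z < ((real m + 1/2) * pi)\<^sup>2} = m + 1"
proof -
  obtain C where C: "C > 0" "\<And>k. norm k \<ge> 1 \<Longrightarrow> norm (char_fn q h H (k\<^sup>2) + k * sin k) \<le> C * exp \<bar>Im k\<bar>"
    by (rule char_fn_asymptotics[OF q]) blast
  obtain N :: nat where N: "real N > 4 * C" using reals_Archimedean2 by blast
  show ?thesis
  proof (rule that[of "N + 1"])
    fix m assume m: "m \<ge> N + 1"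
    define R where "R = (real m + 1/2) * pi"
    have "R \<ge> (real N + 1) * 1" unfolding R_def using m pi_gt3 by (intro mult_mono) auto
    then have R: "R > 4 * C" "R > 1" using N C(1) by auto
    let ?f = "char_fn (\<lambda>_. 0) 0 0"
    let ?g = "\<lambda>z. char_fn q h H z - ?f z"
    let ?s = "ball (0::complex) (R\<^sup>2 + 1)"
    have less: "norm (?g z) < norm (?f z)" if z: "norm z = R\<^sup>2" for z
    proof -
      have k: "norm (csqrt z) = R" using z R by (simp add: norm_csqrt)
      have "norm (?g z) = norm (char_fn q h H ((csqrt z)\<^sup>2) + csqrt z * sin (csqrt z))"
        using char_fn_free[of "csqrt z"] by simp
      also have "\<dots> \<le> C * exp \<bar>Im (csqrt z)\<bar>" by (rule C(2)) (unfold k, use R in simp)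
      also have "\<dots> < R * (exp \<bar>Im (csqrt z)\<bar> / 4)" using R by simp
      also have "\<dots> \<le> R * norm (sin (csqrt z))"
        using norm_sin_lower_bound[of "csqrt z" m] k R m by (intro mult_left_mono) (auto simp: R_def)
      also have "\<dots> = norm (?f ((csqrt z)\<^sup>2))" unfolding char_fn_free norm_mult norm_minus_cancel k ..
      finally show ?thesis by simp
    qed
    have q0: "(\<lambda>_. 0 :: real) absolutely_integrable_on {0..1}" by simp
    have "(\<Sum>p\<in>{p\<in>?s. ?f p + ?g p = 0}. winding_number (circlepath 0 (R\<^sup>2)) p * zorder (\<lambda>p. ?f p + ?g p) p)
        = (\<Sum>p\<in>{p\<in>?s. ?f p = 0}. winding_number (circlepath 0 (R\<^sup>2)) p * zorder ?f p)"
    proof (rule Rouche_theorem)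
      show "finite {p \<in> ?s. ?f p + ?g p = 0}"
        by (rule finite_subset[OF _ char_fn_zeros_finite[OF q, of h H "R\<^sup>2 + 1"]]) auto
      show "finite {p \<in> ?s. ?f p = 0}"
        by (rule finite_subset[OF _ char_fn_zeros_finite[OF q0, of 0 0 "R\<^sup>2 + 1"]]) auto
      show "?f holomorphic_on ?s" by (rule char_fn_holomorphic[OF q0])
      show "?g holomorphic_on ?s" by (intro holomorphic_on_diff char_fn_holomorphic[OF q0] char_fn_holomorphic[OF q])
      show "\<forall>z\<in>path_image (circlepath 0 (R\<^sup>2)). norm (?g z) < norm (?f z)"
        using less R by (auto simp: dist_norm)
      show "\<forall>z. z \<notin> ?s \<longrightarrow> winding_number (circlepath 0 (R\<^sup>2)) z = 0"
      proof (intro allI impI)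
        fix z assume "z \<notin> ?s"
        then show "winding_number (circlepath 0 (R\<^sup>2)) z = 0"
          by (intro winding_number_zero_outside[of _ "cball 0 (R\<^sup>2)"]) auto
      qed
    qed (auto simp: dist_norm)
    then have eq: "(\<Sum>p\<in>{p\<in>?s. char_fn q h H p = 0}. winding_number (circlepath 0 (R\<^sup>2)) p * zorder (char_fn q h H) p)
        = (\<Sum>p\<in>{p\<in>?s. ?f p = 0}. winding_number (circlepath 0 (R\<^sup>2)) p * zorder ?f p)"
      by simp
    have n1: "char_fn q h H z \<noteq> 0" and n2: "?f z \<noteq> 0" if "norm z = R\<^sup>2" for z
      using less[OF that] by auto
    have pos: "R\<^sup>2 > 0" using R by simp
    have "of_nat (card {z. char_fn q h H z = 0 \<and> norm z < R\<^sup>2}) = (of_nat (card {z. ?f z = 0 \<and> norm z < R\<^sup>2}) :: complex)"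
      by (rule trans[OF winding_number_zero_count[OF q pos n1, symmetric] trans[OF eq winding_number_zero_count[OF q0 pos n2]]])
    then show "card {z. char_fn q h H z = 0 \<and> norm z < ((real m + 1/2) * pi)\<^sup>2} = m + 1"
      using card_char_fn_free_zeros[of m] unfolding R_def of_nat_eq_iff by simp
  qed
qed

text \<open>From the Taylor bound
  \<open>\<bar>sin d - d\<bar> \<le> \<bar>d\<bar> ^ 3 / 6\<close>.\<close>

lemma abs_sin_ge_half:
  assumes "\<bar>d\<bar> \<le> pi / 2"
  shows "\<bar>d\<bar> / 2 \<le> \<bar>sin (d::real)\<bar>"
proof -
  have "\<bar>sin d - (\<Sum>m<3. sin_coeff m * d ^ m)\<bar> \<le> inverse (fact 3) * \<bar>d\<bar> ^ 3"
    by (rule Maclaurin_sin_bound)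
  moreover have "(\<Sum>m<3. sin_coeff m * d ^ m) = d"
    by (simp add: eval_nat_numeral sin_coeff_def)
  ultimately have "\<bar>sin d - d\<bar> \<le> \<bar>d\<bar> ^ 3 / 6" by (simp add: fact_numeral field_simps)
  also have "\<dots> = \<bar>d\<bar> * (\<bar>d\<bar>\<^sup>2 / 6)" by (simp add: eval_nat_numeral)
  also have "\<dots> \<le> \<bar>d\<bar> * (1 / 2)"
  proof (rule mult_left_mono)
    have "pi < 3.2" using pi_approx by simp
    then have "\<bar>d\<bar> \<le> 1.6" using assms by linarith
    then have "\<bar>d\<bar>\<^sup>2 \<le> 1.6\<^sup>2" by (intro power_mono) auto
    also have "\<dots> \<le> (3::real)" by (simp add: power2_eq_square)
    finally show "\<bar>d\<bar>\<^sup>2 / 6 \<le> 1 / 2" by simp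
  qed simp
  finally show ?thesis by linarith
qed

text \<open>For an eigenvalue \<open>t = k\<^sup>2\<close> the asymptotics give
  \<open>\<bar>sin k\<bar> \<le> C / k\<close>, so \<open>k\<close> is within
  \<open>2 * C / k\<close> of a multiple \<open>j * pi\<close>. The disc of radius
  \<open>((j - 1/2) * pi)\<^sup>2\<close> contains exactly \<open>j\<close> eigenvalues, and
  \<open>t\<close> lies outside it, so there are at least \<open>j + 1\<close> eigenvalues of modulus at
  most \<open>t\<close>. For general \<open>t\<close> the summand \<open>1\<close> would have to be dropped.\<close>

lemma counting_spectrum_lower:
  obtains C T where "T > 0" "C > 0"
    "\<And>t. t \<ge> T \<Longrightarrow> char_fn q h H (of_real t) = 0 \<Longrightarrow>
      sqrt t / pi + 1 - C / sqrt t \<le> real (counting (spectrum q h H) t)"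
proof -
  obtain C where C: "C > 0" "\<And>k. norm k \<ge> 1 \<Longrightarrow> norm (char_fn q h H (k\<^sup>2) + k * sin k) \<le> C * exp \<bar>Im k\<bar>"
    by (rule char_fn_asymptotics[OF q]) blast
  obtain m\<^sub>0 where m0: "\<And>m. m \<ge> m\<^sub>0 \<Longrightarrow> card {z. char_fn q h H z = 0 \<and> norm z < ((real m + 1/2) * pi)\<^sup>2} = m + 1"
    by (rule card_char_fn_zeros) blast
  define K where "K = (real m\<^sub>0 + 2) * pi + 2 * C"
  have K1: "K \<ge> 1" unfolding K_def using C(1) pi_gt3 mult_mono[of 1 "real m\<^sub>0 + 2" 1 pi] by simp
  show ?thesis
  proof (rule that[of "K\<^sup>2" "2 * C / pi"])
    show "K\<^sup>2 > 0" "2 * C / pi > 0" using K1 C(1) by auto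
    fix t assume t: "t \<ge> K\<^sup>2" and z: "char_fn q h H (of_real t) = 0"
    define k where "k = sqrt t"
    have kK: "k \<ge> K" unfolding k_def using t by (rule real_le_rsqrt)
    have k1: "k \<ge> 1" using kK K1 by simp
    have "t \<ge> 0" using t zero_le_power2[of K] by linarith
    then have tk: "t = k\<^sup>2" by (simp add: k_def)
    have "norm (complex_of_real k * sin (of_real k)) \<le> C"
      using C(2)[of "of_real k"] z k1 unfolding tk by simp
    then have ks: "k * \<bar>sin k\<bar> \<le> C" using k1 by (simp add: norm_mult sin_of_real)
    define j where "j = round (k / pi)"
    define d where "d = k - of_int j * pi"
    have "\<bar>of_int j - k / pi\<bar> \<le> 1/2" unfolding j_def by (rule of_int_round_abs_le)
    then have "\<bar>(of_int j - k / pi) * pi\<bar> \<le> 1/2 * pi" unfolding abs_mult by (intro mult_mono) auto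
    then have dpi: "\<bar>d\<bar> \<le> pi / 2" by (simp add: d_def algebra_simps abs_minus_commute)
    have "sin k = sin (d + pi * of_int j)" by (simp add: d_def mult.commute)
    then have "\<bar>sin k\<bar> = \<bar>sin d\<bar>"
      by (simp add: sin_add)
    then have "\<bar>d\<bar> / 2 \<le> \<bar>sin k\<bar>" using abs_sin_ge_half[OF dpi] by simp
    then have "k * (\<bar>d\<bar> / 2) \<le> C" using ks k1 by (meson mult_left_mono order_trans zero_le_one)
    then have d: "\<bar>d\<bar> \<le> 2 * C / k" using k1 by (simp add: field_simps)
    also have "\<dots> \<le> 1" using kK k1 C(1) unfolding K_def by (simp add: divide_le_eq) (smt (verit) pi_gt_zero mult_nonneg_nonneg of_nat_0_le_iff)
    finally have d1: "\<bar>d\<bar> \<le> 1" .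
    have "of_int j * pi \<ge> (real m\<^sub>0 + 2) * pi - 1" using kK d1 C(1) unfolding K_def d_def by linarith
    then have "(of_int j - (real m\<^sub>0 + 1)) * pi > 0" using pi_gt3 by (simp add: algebra_simps)
    then have jm: "of_int j > real m\<^sub>0 + 1" by (simp add: zero_less_mult_iff)
    define m where "m = nat j - 1"
    have m: "m \<ge> m\<^sub>0" "of_int j = real m + 1" using jm by (auto simp: m_def)
    let ?Z = "{z. char_fn q h H z = 0 \<and> norm z < ((real m + 1/2) * pi)\<^sup>2}"
    let ?S = "{z \<in> spectrum q h H. norm z \<le> t}"
    have finS: "finite ?S" unfolding spectrum_eq_zeros[OF q] using char_fn_zeros_finite[OF q, of h H t] by simp
    have "(real m + 1/2) * pi < k" using d1 pi_gt3 m(2) unfolding d_def by (simp add: algebra_simps)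
    then have less: "((real m + 1/2) * pi)\<^sup>2 < t" unfolding tk by (intro power_strict_mono) auto
    have t0: "t > 0" using tk k1 by simp
    have "insert (of_real t) ?Z \<subseteq> ?S" using less z t0 unfolding spectrum_eq_zeros[OF q] by auto
    then have "card (insert (of_real t) ?Z) \<le> card ?S" by (rule card_mono[OF finS])
    moreover have "of_real t \<notin> ?Z" using less t0 by auto
    moreover have "finite ?Z" by (rule finite_subset[OF _ char_fn_zeros_finite[OF q, of h H "((real m + 1/2) * pi)\<^sup>2"]]) auto
    ultimately have "m + 2 \<le> card ?S" using m0[OF m(1)] by simp
    then have "real (counting (spectrum q h H) t) \<ge> of_int j + 1" using m(2) by (simp add: counting_def)
    moreover have "k / pi = of_int j + d / pi" by (simp add: d_def diff_divide_distrib)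
    moreover have "d / pi \<le> (2 * C / k) / pi" using d by (intro divide_right_mono) auto
    moreover have "(2 * C / pi) / k = (2 * C / k) / pi" by simp
    ultimately show "sqrt t / pi + 1 - (2 * C / pi) / sqrt t \<le> real (counting (spectrum q h H) t)"
      unfolding k_def[symmetric] by linarith
  qed
qed

end

section \<open>Entire functions with too many zeros\<close>

text \<open>A shift by \<open>pi / n\<close> permutes the points modulo \<open>pi\<close>, a period of the summand.\<close>

lemma sum_abs_sin_shift:
  fixes x :: real and n :: nat
  assumes n: "n > 0"
  shows "(\<Sum>j<n. \<bar>sin (x + of_int i * (pi / n) + pi * j / n)\<bar>) = (\<Sum>j<n. \<bar>sin (x + pi * j / n)\<bar>)"
proof -
  define S where "S x = (\<Sum>j<n. \<bar>sin (x + pi * j / n)\<bar>)" for x :: real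
  have step: "S (x + pi / n) = S x" for x
  proof -
    have "S (x + pi / n) = (\<Sum>j<n. \<bar>sin (x + pi * Suc j / n)\<bar>)"
      unfolding S_def by (intro sum.cong refl) (simp add: add_divide_distrib algebra_simps)
    also have "\<dots> + \<bar>sin x\<bar> = (\<Sum>j<Suc n. \<bar>sin (x + pi * j / n)\<bar>)"
      unfolding sum.lessThan_Suc_shift by simp
    also have "\<dots> = S x + \<bar>sin (x + pi)\<bar>" unfolding S_def using n by simp
    finally show ?thesis by simp
  qed
  have up: "S (x + real m * (pi / n)) = S x" for x m
  proof (induction m)
    case (Suc m)
    have "x + real (Suc m) * (pi / n) = (x + real m * (pi / n)) + pi / n" by (simp add: algebra_simps add_divide_distrib)
    then show ?case using step Suc by metis
  qed simp
  have "S (x + of_int i * (pi / n)) = S x"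
  proof (cases "i \<ge> 0")
    case True
    then show ?thesis using up[of x "nat i"] by simp
  next
    case False
    then show ?thesis using up[of "x + of_int i * (pi / n)" "nat (- i)"] by (simp add: algebra_simps)
  qed
  then show ?thesis unfolding S_def by simp
qed

text \<open>After a shift all points lie in \<open>{0..pi}\<close>, where the sine is nonnegative, and multiplication by
  \<open>2 * sin (pi / (2 * n))\<close> makes the sum telescope.\<close>

lemma sum_abs_sin_le:
  fixes x :: real and n :: nat
  assumes n: "n > 0"
  shows "(\<Sum>j<n. \<bar>sin (x + pi * j / n)\<bar>) \<le> 1 / sin (pi / (2 * real n))"
proof -
  \<comment> \<open>reduces \<open>x\<close> modulo \<open>pi / n\<close>\<close>
  define i where "i = \<lfloor>x / (pi / n)\<rfloor>"
  define y where "y = x - of_int i * (pi / n)"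
  have pn: "pi / n > 0" using n by simp
  have "of_int i \<le> x / (pi / n)" "x / (pi / n) < of_int i + 1" unfolding i_def by linarith+
  then have y: "0 \<le> y" "y < pi / n" unfolding y_def using pn by (simp_all only: le_divide_eq divide_less_eq) (auto simp: algebra_simps add_divide_distrib)
  define \<delta> where "\<delta> = pi / (2 * real n)"
  have d: "pi / n = 2 * \<delta>" by (simp add: \<delta>_def)
  have d0: "sin \<delta> > 0"
  proof (rule sin_gt_zero)
    show "\<delta> > 0" using n by (simp add: \<delta>_def)
    have "pi / (2 * real n) \<le> pi / 2" using n by (intro divide_left_mono) auto
    then show "\<delta> < pi" using pi_gt_zero unfolding \<delta>_def by linarith
  qed
  have pos: "sin (y + pi * j / n) \<ge> 0" if "j < n" for j :: nat
  proof (rule sin_ge_zero)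
    show "0 \<le> y + pi * j / n" using y by simp
    have "y + pi * j / n \<le> pi / n + pi * j / n" using y by simp
    also have "\<dots> = pi * (real (Suc j) / n)" by (simp add: add_divide_distrib distrib_left algebra_simps)
    also have "\<dots> \<le> pi * 1" using that n by (intro mult_left_mono) auto
    finally show "y + pi * j / n \<le> pi" by simp
  qed
  have tel: "2 * sin \<delta> * (\<Sum>j<m. sin (y + pi * j / n)) = cos (y - \<delta>) - cos (y - \<delta> + pi * m / n)" for m :: nat
  proof (induction m)
    case (Suc m)
    have e: "pi * real m / n = 2 * real m * \<delta>" "pi * real (Suc m) / n = 2 * real m * \<delta> + 2 * \<delta>"
      by (simp_all add: \<delta>_def add_divide_distrib distrib_left)
    have "2 * sin \<delta> * sin (y + pi * m / n) = cos (y - \<delta> + pi * m / n) - cos (y - \<delta> + pi * Suc m / n)"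
      using cos_diff[of "y + 2 * real m * \<delta>" \<delta>] cos_add[of "y + 2 * real m * \<delta>" \<delta>]
      unfolding e by (simp add: algebra_simps)
    then show ?case using Suc by (simp add: distrib_left)
  qed simp
  have "(\<Sum>j<n. \<bar>sin (x + pi * j / n)\<bar>) = (\<Sum>j<n. \<bar>sin (y + of_int i * (pi / n) + pi * j / n)\<bar>)"
    by (simp add: y_def)
  also have "\<dots> = (\<Sum>j<n. \<bar>sin (y + pi * j / n)\<bar>)" by (rule sum_abs_sin_shift[OF n])
  also have "\<dots> = (\<Sum>j<n. sin (y + pi * j / n))" using pos by (intro sum.cong) auto
  finally have S: "(\<Sum>j<n. \<bar>sin (x + pi * j / n)\<bar>) = (\<Sum>j<n. sin (y + pi * j / n))" .
  have "2 * sin \<delta> * (\<Sum>j<n. sin (y + pi * j / n)) \<le> 2"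
    unfolding tel using n cos_le_one[of "y - \<delta>"] by simp
  then show ?thesis unfolding S \<delta>_def[symmetric] using d0 by (simp add: field_simps)
qed

text \<open>An inequality of Jensen type: \<open>2 / pi\<close> is the mean of
  \<open>\<bar>sin (\<theta> / 2)\<bar>\<close>, so the logarithm of \<open>norm (g 0)\<close>
  is at most the mean of the logarithm of the majorant. Instead of integrating
  \<open>ln (norm g)\<close>, which is singular at the zeros of \<open>g\<close>, one applies the
  maximum principle to the product of \<open>n\<close> rotated copies of \<open>g\<close> and lets
  \<open>n\<close> tend to infinity.\<close>

lemma norm_at_0_le_of_circle_bound:
  fixes g :: "complex \<Rightarrow> complex"
  assumes g: "g holomorphic_on ball 0 r" and \<rho>: "0 < \<rho>" "\<rho> < r" and \<beta>: "\<beta> \<ge> 0"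
    and bd: "\<And>\<theta>. norm (g (of_real \<rho> * cis \<theta>)) \<le> exp (\<alpha> + \<beta> * \<bar>sin (\<theta> / 2)\<bar>)"
  shows "norm (g 0) \<le> exp (\<alpha> + 2 * \<beta> / pi)"
proof -
  have fin: "norm (g 0) \<le> exp (\<alpha> + \<beta> * (1 / (real n * sin (pi / (2 * real n)))))" if n: "n > 0" for n :: nat
  proof -
    define h where "h w = (\<Prod>j<n. g (cis (2 * pi * j / n) * w))" for w
    have rot: "(\<lambda>w. g (cis (2 * pi * j / n) * w)) holomorphic_on ball 0 r" for j :: nat
    proof -
      have "(g \<circ> (\<lambda>w. cis (2 * pi * j / n) * w)) holomorphic_on ball 0 r"
        by (rule holomorphic_on_compose_gen[OF _ g]) (auto intro!: holomorphic_intros simp: norm_mult)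
      then show ?thesis by (simp add: o_def)
    qed
    have hol: "h holomorphic_on ball 0 r"
      unfolding h_def by (rule holomorphic_on_prod) (rule rot)
    have "norm (h 0) \<le> exp (real n * \<alpha> + \<beta> * (1 / sin (pi / (2 * real n))))"
    proof (rule maximum_modulus_frontier[where f = h and S = "cball 0 \<rho>"])
      show "h holomorphic_on interior (cball 0 \<rho>)"
        using \<rho> by (intro holomorphic_on_subset[OF hol]) auto
      show "continuous_on (closure (cball 0 \<rho>)) h"
        using \<rho> by (intro continuous_on_subset[OF holomorphic_on_imp_continuous_on[OF hol]]) auto
      fix w :: complex assume "w \<in> frontier (cball 0 \<rho>)"
      then have nw: "norm w = \<rho>" using \<rho> by (simp add: frontier_cball)
      obtain \<theta> where w: "w = of_real \<rho> * cis \<theta>"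
        using rcis_cmod_Arg[of w] nw by (metis rcis_def)
      have "norm (h w) = (\<Prod>j<n. norm (g (of_real \<rho> * cis (\<theta> + 2 * pi * j / n))))"
        unfolding h_def w prod_norm[symmetric]
        by (intro prod.cong refl arg_cong[where f = norm] arg_cong[where f = g]) (simp add: cis_mult[symmetric] mult_ac)
      also have "\<dots> \<le> (\<Prod>j<n. exp (\<alpha> + \<beta> * \<bar>sin (\<theta> / 2 + pi * j / n)\<bar>))"
      proof (intro prod_mono conjI norm_ge_zero)
        fix j
        have e: "(\<theta> + 2 * pi * real j / n) / 2 = \<theta> / 2 + pi * real j / n" by (simp add: add_divide_distrib)
        show "norm (g (of_real \<rho> * cis (\<theta> + 2 * pi * j / n))) \<le> exp (\<alpha> + \<beta> * \<bar>sin (\<theta> / 2 + pi * j / n)\<bar>)"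
          using bd[of "\<theta> + 2 * pi * j / n"] unfolding e .
      qed
      also have "\<dots> = exp (\<Sum>j<n. \<alpha> + \<beta> * \<bar>sin (\<theta> / 2 + pi * j / n)\<bar>)" by (simp add: exp_sum)
      also have "(\<Sum>j<n. \<alpha> + \<beta> * \<bar>sin (\<theta> / 2 + pi * j / n)\<bar>) = real n * \<alpha> + \<beta> * (\<Sum>j<n. \<bar>sin (\<theta> / 2 + pi * j / n)\<bar>)"
        by (simp add: sum.distrib sum_distrib_left)
      also have "exp \<dots> \<le> exp (real n * \<alpha> + \<beta> * (1 / sin (pi / (2 * real n))))"
        using sum_abs_sin_le[OF n, of "\<theta> / 2"] \<beta> by (simp only: exp_le_cancel_iff) (intro add_left_mono mult_left_mono)
      finally show "norm (h w) \<le> exp (real n * \<alpha> + \<beta> * (1 / sin (pi / (2 * real n))))" .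
    qed (use \<rho> in auto)
    also have "real n * \<alpha> + \<beta> * (1 / sin (pi / (2 * real n))) = real n * (\<alpha> + \<beta> * (1 / (real n * sin (pi / (2 * real n)))))"
      using n by (simp add: field_simps)
    also have "exp \<dots> = exp (\<alpha> + \<beta> * (1 / (real n * sin (pi / (2 * real n))))) ^ n"
      by (simp only: exp_of_nat_mult)
    finally have "norm (g 0) ^ n \<le> exp (\<alpha> + \<beta> * (1 / (real n * sin (pi / (2 * real n))))) ^ n"
      by (simp add: h_def norm_power)
    then show ?thesis using n by (subst (asm) power_mono_iff) auto
  qed
  have "((\<lambda>x::real. sin x / x) \<longlongrightarrow> 1) (at 0)"
    using DERIV_sin[of "0::real"] by (simp add: has_field_derivative_iff)
  moreover have "filterlim (\<lambda>n. pi / (2 * real (Suc n))) (at 0) sequentially"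
  proof -
    have "(\<lambda>n. (pi / 2) * inverse (real (Suc n))) \<longlonglongrightarrow> (pi / 2) * 0"
      by (intro tendsto_intros LIMSEQ_inverse_real_of_nat)
    moreover have "(pi / 2) * inverse (real (Suc n)) = pi / (2 * real (Suc n))" for n
      by (simp only: divide_inverse inverse_mult_distrib mult.assoc)
    ultimately have "(\<lambda>n. pi / (2 * real (Suc n))) \<longlonglongrightarrow> 0" by (simp only: mult_zero_right)
    moreover have "pi / (2 * real (Suc n)) \<noteq> 0" for n by simp
    ultimately show ?thesis by (simp only: filterlim_at) simp
  qed
  ultimately have "(\<lambda>n. sin (pi / (2 * real (Suc n))) / (pi / (2 * real (Suc n)))) \<longlonglongrightarrow> 1"
    by (rule filterlim_compose)
  then have A: "(\<lambda>n. exp (\<alpha> + \<beta> * ((2 / pi) / (sin (pi / (2 * real (Suc n))) / (pi / (2 * real (Suc n))))))) \<longlonglongrightarrow> exp (\<alpha> + \<beta> * ((2 / pi) / 1))"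
    by (intro tendsto_intros) auto
  have e: "(2 / pi) / (sin (pi / (2 * real (Suc n))) / (pi / (2 * real (Suc n)))) = 1 / (real (Suc n) * sin (pi / (2 * real (Suc n))))" for n
    by (simp add: divide_simps)
  have e': "\<beta> * ((2 / pi) / 1) = 2 * \<beta> / pi" by simp
  have "(\<lambda>n. exp (\<alpha> + \<beta> * (1 / (real (Suc n) * sin (pi / (2 * real (Suc n))))))) \<longlonglongrightarrow> exp (\<alpha> + 2 * \<beta> / pi)"
    using A unfolding e e' .
  then show ?thesis by (rule LIMSEQ_le_const) (intro exI[of _ 0] allI impI fin zero_less_Suc)
qed

lemma entire_divide_zeros:
  assumes "finite T" "F holomorphic_on UNIV" "\<And>s. s \<in> T \<Longrightarrow> F s = 0"
  shows "\<exists>G. G holomorphic_on UNIV \<and> (\<forall>z. F z = (\<Prod>s\<in>T. z - s) * G z)"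
  using assms
proof (induction T rule: finite_induct)
  case empty
  then show ?case by (intro exI[of _ F]) auto
next
  case (insert a T)
  then obtain G where G: "G holomorphic_on UNIV" "\<And>z. F z = (\<Prod>s\<in>T. z - s) * G z" by auto
  have "(\<Prod>s\<in>T. a - s) \<noteq> 0" using insert.hyps by auto
  then have Ga: "G a = 0" using G(2)[of a] insert.prems(2)[of a] by auto
  define G' where "G' z = (if z = a then deriv G a else (G z - G a) / (z - a))" for z
  have "G' holomorphic_on UNIV" unfolding G'_def by (rule pole_lemma_open[OF G(1)]) simp
  moreover have "F z = (\<Prod>s\<in>insert a T. z - s) * G' z" for z
    using insert.hyps Ga G(2) by (cases "z = a") (auto simp: G'_def)
  ultimately show ?case by blast
qed

text \<open>Division by Blaschke factors, which have modulus \<open>1\<close> on the circle of radius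
  \<open>\<rho>\<close>, removes the zeros in \<open>T\<close> without changing the modulus there. The factor
  of \<open>s\<close> has modulus \<open>norm s / \<rho>\<close> at the origin.\<close>

lemma blaschke_quotient:
  assumes "finite T" "F holomorphic_on UNIV" "\<And>s. s \<in> T \<Longrightarrow> F s = 0" "0 \<notin> T" and \<rho>: "\<rho> > 0"
  obtains g where "g holomorphic_on UNIV" "\<And>z. norm z = \<rho> \<Longrightarrow> norm (g z) = norm (F z)"
    "norm (g 0) = norm (F 0) * (\<Prod>s\<in>T. \<rho> / norm s)"
proof -
  obtain G where G: "G holomorphic_on UNIV" "\<And>z. F z = (\<Prod>s\<in>T. z - s) * G z"
    using entire_divide_zeros[OF assms(1-3)] by blast
  define g where "g z = (\<Prod>s\<in>T. (of_real (\<rho>\<^sup>2) - cnj s * z) / of_real \<rho>) * G z" for z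
  show ?thesis
  proof (rule that[of g])
    show "g holomorphic_on UNIV"
      unfolding g_def using \<rho> by (intro holomorphic_intros G) auto
    show "norm (g z) = norm (F z)" if z: "norm z = \<rho>" for z
    proof -
      have "norm ((of_real (\<rho>\<^sup>2) - cnj s * z) / of_real \<rho>) = norm (z - s)" for s
      proof -
        have "complex_of_real (\<rho>\<^sup>2) = z * cnj z" using complex_norm_square[of z] z by simp
        then have "of_real (\<rho>\<^sup>2) - cnj s * z = z * cnj (z - s)" by (simp add: algebra_simps)
        then have "norm (of_real (\<rho>\<^sup>2) - cnj s * z) = \<rho> * norm (z - s)"
          by (metis norm_mult complex_mod_cnj z)
        then show ?thesis using \<rho> by (simp only: norm_divide norm_of_real) simp
      qed
      then show ?thesis unfolding g_def G(2) norm_mult prod_norm[symmetric] by simp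
    qed
    have "norm (g 0) = (\<Prod>s\<in>T. \<rho>) * norm (G 0)"
      unfolding g_def norm_mult prod_norm[symmetric] using \<rho>
      by (simp add: norm_divide power2_eq_square norm_power)
    moreover have "norm (F 0) * (\<Prod>s\<in>T. \<rho> / norm s) = (\<Prod>s\<in>T. norm s) * norm (G 0) * (\<Prod>s\<in>T. \<rho> / norm s)"
      unfolding G(2)[of 0] norm_mult prod_norm[symmetric] by simp
    moreover have "(\<Prod>s\<in>T. norm s) * (\<Prod>s\<in>T. \<rho> / norm s) = (\<Prod>s\<in>T. \<rho>)"
      unfolding prod.distrib[symmetric] using assms(4) by (intro prod.cong) auto
    ultimately show "norm (g 0) = norm (F 0) * (\<Prod>s\<in>T. \<rho> / norm s)"
      by (metis mult.assoc mult.commute)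
  qed
qed

lemma norm_one_minus_cis: "norm (1 - cis \<theta>) = 2 * \<bar>sin (\<theta> / 2)\<bar>"
proof -
  have "(norm (1 - cis \<theta>))\<^sup>2 = (1 - cos \<theta>)\<^sup>2 + (sin \<theta>)\<^sup>2" by (simp add: cmod_power2)
  also have "\<dots> = 2 - 2 * cos (2 * (\<theta> / 2))" using sin_cos_squared_add2[of \<theta>] by (simp add: power2_eq_square algebra_simps)
  also have "\<dots> = (2 * \<bar>sin (\<theta> / 2)\<bar>)\<^sup>2" unfolding cos_double_sin by (simp add: power_mult_distrib)
  finally show ?thesis by (rule power2_eq_imp_eq) auto
qed

text \<open>The power in the bound is not the modulus of a holomorphic function, but on the circle
  \<open>max 1 (R * \<bar>sin (\<theta> / 2)\<bar>)\<close> is at least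
  \<open>R / 3\<close> times \<open>norm (r - cis \<theta>)\<close> with
  \<open>r = 1 + 1 / R\<close>. Multiplying by the holomorphic function
  \<open>(r - w / R\<^sup>2) powr \<gamma>\<close>, whose modulus at the origin is at least
  \<open>1\<close>, therefore turns the power into the factor
  \<open>(3 / R) powr \<gamma>\<close>.\<close>

lemma jensen_bound:
  assumes F: "F holomorphic_on UNIV" and T: "finite T" "\<And>s. s \<in> T \<Longrightarrow> F s = 0" "0 \<notin> T"
    and R: "R > 0" and \<gamma>: "\<gamma> \<ge> 0" and \<beta>: "\<beta> \<ge> 0"
    and bd: "\<And>\<theta>. norm (F (of_real (R\<^sup>2) * cis \<theta>)) * max 1 (R * \<bar>sin (\<theta> / 2)\<bar>) powr \<gamma>
        \<le> exp (\<alpha> + \<beta> * \<bar>sin (\<theta> / 2)\<bar>)"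
  shows "norm (F 0) * (\<Prod>s\<in>T. R\<^sup>2 / norm s) \<le> exp (\<alpha> + \<gamma> * ln (3 / R) + 2 * \<beta> / pi)"
proof -
  have R2: "R\<^sup>2 > 0" using R by simp
  obtain g where g: "g holomorphic_on UNIV" "\<And>z. norm z = R\<^sup>2 \<Longrightarrow> norm (g z) = norm (F z)"
    "norm (g 0) = norm (F 0) * (\<Prod>s\<in>T. R\<^sup>2 / norm s)"
    using blaschke_quotient[OF T(1) F T(2,3) R2] by blast
  define r where "r = 1 + 1 / R"
  have r1: "r > 1" using R by (simp add: r_def)
  define f where "f w = of_real r - w / of_real (R\<^sup>2)" for w :: complex
  define G where "G w = g w * exp (of_real \<gamma> * Ln (f w))" for w
  have Ref: "Re (f w) > 0" if "w \<in> ball 0 (r * R\<^sup>2)" for w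
  proof -
    have "norm (w / of_real (R\<^sup>2)) < r" using that R2 by (simp add: norm_divide norm_power divide_less_eq)
    then have "Re (w / of_real (R\<^sup>2)) < r" using complex_Re_le_cmod order.strict_trans1 by blast
    then show ?thesis by (simp add: f_def)
  qed
  have norm_pow: "norm (exp (of_real \<gamma> * Ln w)) = norm w powr \<gamma>" if "w \<noteq> 0" for w
    using that by (simp add: powr_def)
  have "norm (G 0) \<le> exp ((\<alpha> + \<gamma> * ln (3 / R)) + 2 * \<beta> / pi)"
  proof (rule norm_at_0_le_of_circle_bound[OF _ R2 _ \<beta>])
    show "G holomorphic_on ball 0 (r * R\<^sup>2)"
      unfolding G_def
    proof (intro holomorphic_intros holomorphic_on_subset[OF g(1)])
      show "f holomorphic_on ball 0 (r * R\<^sup>2)" unfolding f_def using R by (intro holomorphic_intros) auto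
      show "f w \<notin> \<real>\<^sub>\<le>\<^sub>0" if "w \<in> ball 0 (r * R\<^sup>2)" for w
        using Ref[OF that] by (auto simp: complex_nonpos_Reals_iff)
    qed auto
    show "R\<^sup>2 < r * R\<^sup>2" using r1 R2 by simp
    fix \<theta> :: real
    let ?w = "of_real (R\<^sup>2) * cis \<theta>" and ?m = "max 1 (R * \<bar>sin (\<theta> / 2)\<bar>)"
    have m: "?m > 0" by simp
    have fw: "f ?w = of_real r - cis \<theta>" using R by (simp add: f_def)
    have nw: "norm ?w = R\<^sup>2" by (simp add: norm_mult norm_power)
    have "?w \<in> ball 0 (r * R\<^sup>2)" using nw r1 R2 by simp
    then have f0: "f ?w \<noteq> 0" using Ref by force
    have "norm (f ?w) \<le> norm (of_real (r - 1) :: complex) + norm (1 - cis \<theta>)"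
      unfolding fw using norm_triangle_ineq[of "of_real (r - 1) :: complex" "1 - cis \<theta>"] by simp
    also have "\<dots> = 1 / R + 2 * \<bar>sin (\<theta> / 2)\<bar>"
      using R by (simp add: norm_one_minus_cis r_def norm_divide)
    also have "\<dots> = (1 + 2 * (R * \<bar>sin (\<theta> / 2)\<bar>)) / R" using R by (simp add: field_simps)
    also have "\<dots> \<le> (3 * ?m) / R" using R by (intro divide_right_mono) auto
    finally have "norm (f ?w) powr \<gamma> \<le> (?m * (3 / R)) powr \<gamma>" using \<gamma> by (intro powr_mono2) (auto simp: mult_ac)
    also have "\<dots> = ?m powr \<gamma> * (3 / R) powr \<gamma>" by (rule powr_mult)
    also have "(3 / R) powr \<gamma> = exp (\<gamma> * ln (3 / R))" using R by (simp add: powr_def)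
    finally have fb: "norm (f ?w) powr \<gamma> \<le> ?m powr \<gamma> * exp (\<gamma> * ln (3 / R))" .
    have "norm (G ?w) = norm (F ?w) * norm (f ?w) powr \<gamma>"
      unfolding G_def norm_mult norm_pow[OF f0] g(2)[OF nw] ..
    also have "\<dots> \<le> norm (F ?w) * (?m powr \<gamma> * exp (\<gamma> * ln (3 / R)))"
      using fb by (intro mult_left_mono) auto
    also have "\<dots> \<le> exp (\<alpha> + \<beta> * \<bar>sin (\<theta> / 2)\<bar>) * exp (\<gamma> * ln (3 / R))"
      using mult_right_mono[OF bd[of \<theta>], of "exp (\<gamma> * ln (3 / R))"] by (simp add: mult.assoc)
    also have "\<dots> = exp ((\<alpha> + \<gamma> * ln (3 / R)) + \<beta> * \<bar>sin (\<theta> / 2)\<bar>)"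
      by (simp add: exp_add mult_ac)
    finally show "norm (G ?w) \<le> exp ((\<alpha> + \<gamma> * ln (3 / R)) + \<beta> * \<bar>sin (\<theta> / 2)\<bar>)" .
  qed
  moreover have "norm (g 0) \<le> norm (G 0)"
  proof -
    have "norm (G 0) = norm (g 0) * r powr \<gamma>"
      unfolding G_def norm_mult using norm_pow[of "f 0"] r1 by (simp add: f_def)
    moreover have "r powr \<gamma> \<ge> 1" using r1 \<gamma> by (simp add: ge_one_powr_ge_zero)
    ultimately show ?thesis by (simp add: mult_le_cancel_left1)
  qed
  ultimately show ?thesis unfolding g(3) by linarith
qed

lemma ln_add_one_lower:
  fixes t :: real
  assumes "t \<ge> 0"
  shows "2 * t / (2 + t) \<le> ln (1 + t)"
proof -
  define f where "f t = ln (1 + t) - 2 * t / (2 + t)" for t :: real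
  have "f 0 \<le> f t"
  proof (rule DERIV_nonneg_imp_nondecreasing[OF assms])
    fix x :: real assume x: "0 \<le> x" "x \<le> t"
    have "(f has_real_derivative (1 / (1 + x) - (2 * (2 + x) - 2 * x * 1) / ((2 + x) * (2 + x)))) (at x)"
      unfolding f_def using x by (auto intro!: derivative_eq_intros)
    moreover have "1 / (1 + x) - (2 * (2 + x) - 2 * x * 1) / ((2 + x) * (2 + x)) = x\<^sup>2 / ((1 + x) * (2 + x)\<^sup>2)"
      using x by (simp add: divide_simps) (simp add: power2_eq_square algebra_simps)
    moreover have "x\<^sup>2 / ((1 + x) * (2 + x)\<^sup>2) \<ge> 0" using x by auto
    ultimately show "\<exists>y. (f has_real_derivative y) (at x) \<and> 0 \<le> y" by metis
  qed
  then show ?thesis by (simp add: f_def)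
qed

text \<open>With \<open>A x = (x - 1/2) * ln x - x\<close>, the leading part of Stirling's
  formula for \<open>ln (Gamma x)\<close>, the claim is
  \<open>ln x \<le> A (x + 1) - A x\<close>; summation then gives Stirling's upper
  bound by telescoping.\<close>

lemma ln_le_stirling_increment:
  fixes x :: real
  assumes x: "x > 0"
  shows "ln x \<le> ((x + 1/2) * ln (x + 1) - (x + 1)) - ((x - 1/2) * ln x - x)"
proof -
  have "1 = (x + 1/2) * (2 * (1 / x) / (2 + 1 / x))" using x by (simp add: divide_simps)
  also have "\<dots> \<le> (x + 1/2) * ln (1 + 1 / x)"
    using x ln_add_one_lower[of "1 / x"] by (intro mult_left_mono) auto
  also have "ln (1 + 1 / x) = ln (x + 1) - ln x"
    using x ln_div[of "x + 1" x] by (simp add: add_divide_distrib add.commute)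
  finally show ?thesis by (simp add: algebra_simps)
qed

lemma sum_ln_le_stirling:
  fixes \<tau> :: real
  assumes \<tau>: "0 < \<tau>" "\<tau> \<le> 1/2"
  shows "(\<Sum>j=1..n. ln (real j - \<tau>)) \<le> (real n + 1/2 - \<tau>) * ln (real n + 1 - \<tau>) - (real n + 1 - \<tau>)
      - ((1/2 - \<tau>) * ln (1 - \<tau>) - (1 - \<tau>))"
proof (induction n)
  case (Suc n)
  have "(\<Sum>j=1..Suc n. ln (real j - \<tau>)) = (\<Sum>j=1..n. ln (real j - \<tau>)) + ln (real n + 1 - \<tau>)"
    by (simp add: algebra_simps)
  also have "\<dots> \<le> (real n + 1/2 - \<tau>) * ln (real n + 1 - \<tau>) - (real n + 1 - \<tau>)
      - ((1/2 - \<tau>) * ln (1 - \<tau>) - (1 - \<tau>))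
      + (((real n + 1 - \<tau> + 1/2) * ln (real n + 1 - \<tau> + 1) - (real n + 1 - \<tau> + 1)) - ((real n + 1 - \<tau> - 1/2) * ln (real n + 1 - \<tau>) - (real n + 1 - \<tau>)))"
    using \<tau> by (intro add_mono Suc ln_le_stirling_increment) auto
  finally show ?case by (simp add: algebra_simps)
qed (use \<tau> in \<open>simp add: algebra_simps\<close>)

lemma sum_ln_le:
  fixes \<tau> :: real
  assumes \<tau>: "0 < \<tau>" "\<tau> \<le> 1/2"
  obtains C where "\<And>n. n \<ge> 1 \<Longrightarrow> (\<Sum>j=1..n. ln (real j - \<tau>)) \<le> (real n + 1/2 - \<tau>) * ln (real n) - real n + C"
proof
  fix n :: nat assume n: "n \<ge> 1"
  have "real n + 1 - \<tau> = real n * (1 + (1 - \<tau>) / real n)" using n by (simp add: field_simps)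
  then have "ln (real n + 1 - \<tau>) = ln (real n) + ln (1 + (1 - \<tau>) / real n)"
    using n \<tau> by (simp only:) (intro ln_mult_pos add_pos_nonneg, auto)
  also have "\<dots> \<le> ln (real n) + (1 - \<tau>) / real n"
    using n \<tau> by (intro add_left_mono ln_add_one_self_le_self) auto
  also have "\<dots> \<le> ln (real n) + 1 / real n" using \<tau> by (intro add_left_mono divide_right_mono) auto
  finally have "(real n + 1/2 - \<tau>) * ln (real n + 1 - \<tau>) \<le> (real n + 1/2 - \<tau>) * (ln (real n) + 1 / real n)"
    using n \<tau> by (intro mult_left_mono) auto
  also have "\<dots> = (real n + 1/2 - \<tau>) * ln (real n) + (real n + 1/2 - \<tau>) / real n" by (simp add: distrib_left)
  also have "(real n + 1/2 - \<tau>) / real n \<le> 2" using n \<tau> by (simp add: divide_le_eq)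
  finally show "(\<Sum>j=1..n. ln (real j - \<tau>)) \<le> (real n + 1/2 - \<tau>) * ln (real n) - real n
     + (2 - (1 - \<tau>) - ((1/2 - \<tau>) * ln (1 - \<tau>) - (1 - \<tau>)))"
    using sum_ln_le_stirling[OF \<tau>, of n] by linarith
qed

text \<open>Suppose that \<open>F 0\<close> is not zero, and put \<open>b = pi / (2 * a)\<close>,
  \<open>\<gamma> = 1 - 2 * \<tau>\<close>, \<open>n = card T\<close> and
  \<open>R = b * n\<close>. Jensen's inequality on the circle of radius \<open>R\<^sup>2\<close>
  bounds the sum of \<open>ln (R\<^sup>2 / norm s)\<close> over \<open>T\<close> from above by
  \<open>4 * a * R / pi - \<gamma> * ln R + O(1) = 2 * n - \<gamma> * ln n + O(1)\<close>.
  The hypothesis on \<open>T\<close> and Stirling's formula bound it from below by exactly the same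
  expression. The contradiction comes from the limit of \<open>D\<close>: on the part of the circle away from
  the positive real axis the majorant gains a factor \<open>exp (- L)\<close> with \<open>L\<close>
  arbitrarily large.\<close>

theorem entire_zero_of_dense_zeros:
  fixes F :: "complex \<Rightarrow> complex" and D :: "real \<Rightarrow> real"
  assumes F: "F holomorphic_on UNIV" and a: "a > 0" and \<tau>: "0 < \<tau>" "\<tau> \<le> 1/2"
    and growth: "\<And>k. norm k \<ge> 1 \<Longrightarrow> norm (F (k\<^sup>2)) \<le> D \<bar>Im k\<bar> * exp (2 * a * \<bar>Im k\<bar>)"
    and Dbd: "\<And>y. y \<ge> 0 \<Longrightarrow> D y * max 1 y powr (1 - 2 * \<tau>) \<le> B"
    and Dlim: "((\<lambda>y. D y * max 1 y powr (1 - 2 * \<tau>)) \<longlongrightarrow> 0) at_top"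
    and zeros: "\<And>N. \<exists>T. finite T \<and> card T \<ge> N \<and> 0 \<notin> T \<and> (\<forall>s\<in>T. F s = 0) \<and>
       (\<Sum>s\<in>T. ln (norm s)) \<le> 2 * real (card T) * ln (pi / (2 * a)) + 2 * (\<Sum>j=1..card T. ln (real j - \<tau>)) + C"
  shows "F 0 = 0"
proof (rule ccontr)
  assume F0: "F 0 \<noteq> 0"
  define \<gamma> where "\<gamma> = 1 - 2 * \<tau>"
  have g0: "\<gamma> \<ge> 0" using \<tau> by (simp add: \<gamma>_def)
  define b where "b = pi / (2 * a)"
  have b: "b > 0" using a by (simp add: b_def)
  define A where "A = ln (max 1 B)"
  have A: "A \<ge> 0" "exp A = max 1 B" by (auto simp: A_def)
  obtain C1 where C1: "\<And>n. n \<ge> 1 \<Longrightarrow> (\<Sum>j=1..n. ln (real j - \<tau>)) \<le> (real n + 1/2 - \<tau>) * ln (real n) - real n + C1"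
    using sum_ln_le[OF \<tau>] by blast
  define K where "K = A + \<gamma> * ln 3 - \<gamma> * ln b + C + 2 * C1 - ln (norm (F 0))"
  have pi4: "4 / pi - 1 > 0" using pi_less_4 by simp
  \<comment> \<open>the final estimate reads \<open>L * (4 / pi - 1) \<le> K\<close>, with all other constants collected in \<open>K\<close>\<close>
  define L where "L = (\<bar>K\<bar> + 1) / (4 / pi - 1)"
  have L0: "L > 0" unfolding L_def using pi4 by (intro divide_pos_pos) auto
  have "\<forall>\<^sub>F y in at_top. D y * max 1 y powr \<gamma> < exp (- L)"
    using Dlim by (intro order_tendstoD) (auto simp: \<gamma>_def)
  then obtain Y where Y: "\<And>y. y \<ge> Y \<Longrightarrow> D y * max 1 y powr \<gamma> < exp (- L)"
    unfolding eventually_at_top_linorder by blast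
  obtain N :: nat where N: "real N > (2 * \<bar>Y\<bar> + 1 + L / a) / b" using reals_Archimedean2 by blast
  obtain T where T: "finite T" "card T \<ge> N + 1" "0 \<notin> T" "\<And>s. s \<in> T \<Longrightarrow> F s = 0"
    and Tln: "(\<Sum>s\<in>T. ln (norm s)) \<le> 2 * real (card T) * ln (pi / (2 * a)) + 2 * (\<Sum>j=1..card T. ln (real j - \<tau>)) + C"
    using zeros[of "N + 1"] by blast
  define n where "n = card T"
  have n1: "n \<ge> 1" using T(2) by (simp add: n_def)
  define R where "R = b * n"
  have "real n > (2 * \<bar>Y\<bar> + 1 + L / a) / b" using N T(2) unfolding n_def by linarith
  then have "R > 2 * \<bar>Y\<bar> + 1 + L / a" using b by (simp add: R_def divide_less_eq mult.commute)
  moreover have "L / a > 0" using L0 a by simp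
  ultimately have R: "R \<ge> 1" "R / 2 \<ge> Y" "R > L / a" by linarith+
  have \<beta>: "2 * a * R - 2 * L \<ge> 0" using R(3) a by (simp add: divide_less_eq mult.commute)
  have "norm (F 0) * (\<Prod>s\<in>T. R\<^sup>2 / norm s) \<le> exp ((A + L) + \<gamma> * ln (3 / R) + 2 * (2 * a * R - 2 * L) / pi)"
  proof (rule jensen_bound[OF F T(1,4,3) _ g0 \<beta>])
    show "R > 0" using R by simp
    fix \<theta> :: real
    let ?\<sigma> = "\<bar>sin (\<theta> / 2)\<bar>"
    define k where "k = of_real R * cis (\<theta> / 2)"
    have "k\<^sup>2 = of_real (R\<^sup>2) * (cis (\<theta> / 2))\<^sup>2" by (simp add: k_def power_mult_distrib)
    also have "(cis (\<theta> / 2))\<^sup>2 = cis \<theta>" by (simp add: power2_eq_square cis_mult)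
    finally have k2: "k\<^sup>2 = of_real (R\<^sup>2) * cis \<theta>" .
    have nk: "norm k = R" using R by (simp add: k_def norm_mult)
    have Ik: "\<bar>Im k\<bar> = R * ?\<sigma>" using R by (simp add: k_def abs_mult)
    have s: "?\<sigma> \<le> 1" "?\<sigma> \<ge> 0" by auto
    \<comment> \<open>the gain on the arc \<open>?\<sigma> \<ge> 1/2\<close>, in a form linear in \<open>?\<sigma>\<close>; the mean of \<open>1 - 2 * ?\<sigma>\<close> is \<open>1 - 4 / pi < 0\<close>\<close>
    have D: "D (R * ?\<sigma>) * max 1 (R * ?\<sigma>) powr \<gamma> \<le> exp (A + L * (1 - 2 * ?\<sigma>))"
    proof (cases "?\<sigma> \<ge> 1/2")
      case True
      then have "R * (1/2) \<le> R * ?\<sigma>" using R by (intro mult_left_mono) auto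
      then have "Y \<le> R * ?\<sigma>" using R(2) by linarith
      then have "D (R * ?\<sigma>) * max 1 (R * ?\<sigma>) powr \<gamma> < exp (- L)" by (rule Y)
      moreover have "L * ?\<sigma> \<le> L * 1" using L0 s by (intro mult_left_mono) auto
      moreover have "L * (1 - 2 * ?\<sigma>) = L - 2 * (L * ?\<sigma>)" by (simp add: algebra_simps)
      ultimately have "- L \<le> A + L * (1 - 2 * ?\<sigma>)" "D (R * ?\<sigma>) * max 1 (R * ?\<sigma>) powr \<gamma> \<le> exp (- L)"
        using A(1) by linarith+
      then show ?thesis by (meson exp_le_cancel_iff order_trans)
    next
      case False
      have "D (R * ?\<sigma>) * max 1 (R * ?\<sigma>) powr \<gamma> \<le> B" unfolding \<gamma>_def using R by (intro Dbd) auto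
      also have "\<dots> \<le> exp A" unfolding A(2) by simp
      also have "\<dots> \<le> exp (A + L * (1 - 2 * ?\<sigma>))" using False L0 by simp
      finally show ?thesis .
    qed
    have "norm (F (of_real (R\<^sup>2) * cis \<theta>)) * max 1 (R * ?\<sigma>) powr \<gamma>
        \<le> (D (R * ?\<sigma>) * exp (2 * a * (R * ?\<sigma>))) * max 1 (R * ?\<sigma>) powr \<gamma>"
      using growth[of k] nk R unfolding k2 Ik by (intro mult_right_mono) auto
    also have "\<dots> = (D (R * ?\<sigma>) * max 1 (R * ?\<sigma>) powr \<gamma>) * exp (2 * a * (R * ?\<sigma>))" by simp
    also have "\<dots> \<le> exp (A + L * (1 - 2 * ?\<sigma>)) * exp (2 * a * (R * ?\<sigma>))"
      using D by (intro mult_right_mono) auto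
    also have "\<dots> = exp ((A + L) + (2 * a * R - 2 * L) * ?\<sigma>)"
      by (simp add: exp_add[symmetric] algebra_simps)
    finally show "norm (F (of_real (R\<^sup>2) * cis \<theta>)) * max 1 (R * ?\<sigma>) powr \<gamma> \<le> exp ((A + L) + (2 * a * R - 2 * L) * ?\<sigma>)" .
  qed
  moreover have "(\<Prod>s\<in>T. R\<^sup>2 / norm s) = exp (\<Sum>s\<in>T. ln (R\<^sup>2 / norm s))"
  proof -
    have "exp (ln (R\<^sup>2 / norm s)) = R\<^sup>2 / norm s" if "s \<in> T" for s
      using that T(3) R by (intro exp_ln) (auto intro!: divide_pos_pos)
    then show ?thesis unfolding exp_sum[OF T(1)] by (intro prod.cong) auto
  qed
  moreover have "norm (F 0) = exp (ln (norm (F 0)))" using F0 by simp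
  ultimately have "exp (ln (norm (F 0)) + (\<Sum>s\<in>T. ln (R\<^sup>2 / norm s))) \<le> exp ((A + L) + \<gamma> * ln (3 / R) + 2 * (2 * a * R - 2 * L) / pi)"
    unfolding exp_add by (metis exp_add)
  then have main: "ln (norm (F 0)) + (\<Sum>s\<in>T. ln (R\<^sup>2 / norm s)) \<le> (A + L) + \<gamma> * ln (3 / R) + 2 * (2 * a * R - 2 * L) / pi"
    by simp
  have lnR: "ln R = ln b + ln (real n)" unfolding R_def using b n1 by (intro ln_mult_pos) auto
  have "(\<Sum>s\<in>T. ln (R\<^sup>2 / norm s)) = (\<Sum>s\<in>T. 2 * ln R - ln (norm s))"
    using T(3) R by (intro sum.cong refl) (subst ln_div, auto simp: ln_realpow)
  also have "\<dots> = real n * (2 * ln R) - (\<Sum>s\<in>T. ln (norm s))" by (simp add: sum_subtractf n_def)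
  finally have 1: "(\<Sum>s\<in>T. ln (R\<^sup>2 / norm s)) = 2 * real n * ln b + 2 * real n * ln (real n) - (\<Sum>s\<in>T. ln (norm s))"
    unfolding lnR by (simp add: algebra_simps)
  have 2: "(\<Sum>s\<in>T. ln (norm s)) \<le> 2 * real n * ln b + 2 * ((real n + 1/2 - \<tau>) * ln (real n) - real n + C1) + C"
    using C1[OF n1] unfolding n_def b_def
    by (intro order_trans[OF Tln] add_mono mult_left_mono order_refl) auto
  have 3: "2 * (2 * a * R - 2 * L) / pi = 2 * real n - 4 * L / pi"
    unfolding R_def b_def using a by (simp add: field_simps)
  have 4: "\<gamma> * ln (3 / R) = \<gamma> * ln 3 - \<gamma> * ln b - \<gamma> * ln (real n)"
    using R lnR by (simp add: ln_div algebra_simps)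
  have "2 * ((real n + 1/2 - \<tau>) * ln (real n) - real n + C1) = 2 * real n * ln (real n) + \<gamma> * ln (real n) - 2 * real n + 2 * C1"
    by (simp add: \<gamma>_def algebra_simps)
  with main 1 2 3 4 have "4 * L / pi - L \<le> K" unfolding K_def by linarith
  moreover have "4 * L / pi - L = \<bar>K\<bar> + 1"
  proof -
    have "L * (4 / pi - 1) = \<bar>K\<bar> + 1" using pi4 by (simp add: L_def)
    then show ?thesis by (simp add: algebra_simps)
  qed
  ultimately show False by linarith
qed

section \<open>The cross Wronskian\<close>

text \<open>If \<open>A \<le> \<epsilon> * y powr (1 / p)\<close> the first term on the right
  suffices, otherwise the second one. This replaces Hoelder's inequality and treats \<open>p = 1\<close>
  on the same footing.\<close>

lemma powr_split_le:
  fixes A y \<epsilon> p :: real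
  assumes A: "A \<ge> 0" and y: "y > 0" and e: "\<epsilon> > 0" and p: "p \<ge> 1"
  shows "A * y powr (1 - 1 / p) \<le> \<epsilon> * y + \<epsilon> powr (1 - p) * A powr p"
proof (cases "A \<le> \<epsilon> * y powr (1 / p)")
  case True
  have "A * y powr (1 - 1 / p) \<le> \<epsilon> * y powr (1 / p) * y powr (1 - 1 / p)"
    using True by (intro mult_right_mono) auto
  also have "\<dots> = \<epsilon> * (y powr (1 / p) * y powr (1 - 1 / p))" by simp
  also have "y powr (1 / p) * y powr (1 - 1 / p) = y" using y by (simp flip: powr_add)
  finally show ?thesis by (simp add: add_increasing2)
next
  case False
  then have A0: "A > 0" using e y by (smt (verit) mult_nonneg_nonneg powr_ge_zero)
  have "y powr (1 / p) \<le> A / \<epsilon>" using False e by (simp add: field_simps)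
  then have "(y powr (1 / p)) powr (p - 1) \<le> (A / \<epsilon>) powr (p - 1)" using p by (intro powr_mono2) auto
  moreover have "(y powr (1 / p)) powr (p - 1) = y powr (1 - 1 / p)"
    using p by (simp add: powr_powr field_simps)
  ultimately have "A * y powr (1 - 1 / p) \<le> A * (A / \<epsilon>) powr (p - 1)" using A by (intro mult_left_mono) auto
  also have "(A / \<epsilon>) powr (p - 1) = A powr (p - 1) / \<epsilon> powr (p - 1)" using A e by (simp add: powr_divide)
  also have "A * (A powr (p - 1) / \<epsilon> powr (p - 1)) = \<epsilon> powr (1 - p) * A powr p"
    using A0 e by (simp add: powr_diff powr_minus field_simps powr_mult_base)
  finally show ?thesis using e y by (simp add: add_increasing)
qed

lemma exp_weight_has_integral:
  fixes a y :: real
  assumes a: "a > 0" and y: "y > 0"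
  shows "((\<lambda>x. y * exp (- 2 * (a - x) * y)) has_integral (1 - exp (- 2 * a * y)) / 2) {0..a}"
proof -
  have "((\<lambda>x. y * exp (- 2 * (a - x) * y)) has_integral (exp (- 2 * (a - a) * y) / 2 - exp (- 2 * (a - 0) * y) / 2)) {0..a}"
    using a by (intro fundamental_theorem_of_calculus)
      (auto intro!: derivative_eq_intros simp: has_real_derivative_iff_has_vector_derivative[symmetric])
  then show ?thesis by (simp add: diff_divide_distrib)
qed

lemma integrable_mult_continuous_real:
  fixes f g :: "real \<Rightarrow> real"
  assumes "f absolutely_integrable_on {a..b}" "continuous_on {a..b} g"
  shows "(\<lambda>x. f x * g x) integrable_on {a..b}"
  using absolutely_integrable_mult_continuous(1)[OF assms] by (simp add: absolutely_integrable_on_def)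

text \<open>Dominated convergence along the integers; the integral is monotone in \<open>y\<close>.\<close>

lemma exp_weighted_integral_tendsto_0:
  fixes f :: "real \<Rightarrow> real"
  assumes a: "a > 0" and f: "f absolutely_integrable_on {0..a}" and f0: "\<And>x. f x \<ge> 0"
  shows "((\<lambda>y. integral {0..a} (\<lambda>x. f x * exp (- 2 * (a - x) * y))) \<longlongrightarrow> 0) at_top"
proof -
  define K where "K y = integral {0..a} (\<lambda>x. f x * exp (- 2 * (a - x) * y))" for y
  have fi: "(\<lambda>x. f x * exp (- 2 * (a - x) * y)) integrable_on {0..a}" for y
    by (intro integrable_mult_continuous_real f continuous_intros)
  have mono: "K y \<le> K y'" if "y' \<le> y" for y y'
    unfolding K_def
  proof (intro integral_le fi mult_left_mono f0)
    fix x assume "x \<in> {0..a}"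
    then have "(a - x) * y' \<le> (a - x) * y" using that by (intro mult_left_mono) auto
    then show "exp (- 2 * (a - x) * y) \<le> exp (- 2 * (a - x) * y')" by (simp add: algebra_simps)
  qed
  have K0: "K y \<ge> 0" for y unfolding K_def by (rule integral_nonneg[OF fi]) (use f0 in auto)
  have "(\<lambda>n. integral {0..a} (\<lambda>x. f x * exp (- 2 * (a - x) * real n))) \<longlonglongrightarrow> integral {0..a} (\<lambda>x. if x = a then f a else 0)"
  proof (rule dominated_convergence(2))
    show "f integrable_on {0..a}" using f by (simp add: absolutely_integrable_on_def)
    fix x assume x: "x \<in> {0..a}"
    show "norm (f x * exp (- 2 * (a - x) * real n)) \<le> f x" for n
    proof -
      have "(a - x) * real n \<ge> 0" using x by simp
      then have "exp (- 2 * (a - x) * real n) \<le> 1" by (simp add: algebra_simps)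
      from mult_left_le[OF this f0[of x]] show ?thesis using f0[of x] by (simp add: abs_mult)
    qed
    show "(\<lambda>n. f x * exp (- 2 * (a - x) * real n)) \<longlonglongrightarrow> (if x = a then f a else 0)"
    proof (cases "x = a")
      case False
      then have r: "exp (- 2 * (a - x)) < 1" using x by simp
      have "(\<lambda>n. f x * exp (- 2 * (a - x)) ^ n) \<longlonglongrightarrow> f x * 0"
        using r by (intro tendsto_intros LIMSEQ_power_zero) auto
      moreover have "exp (- 2 * (a - x)) ^ n = exp (- 2 * (a - x) * real n)" for n
        by (simp add: exp_of_nat_mult[symmetric] mult.commute)
      ultimately show ?thesis using False by simp
    qed simp
  qed (rule fi)
  moreover have "integral {0..a} (\<lambda>x. if x = a then f a else 0) = 0"
    by (rule integral_unique, rule has_integral_spike_finite[where S = "{a}" and f = "\<lambda>_. 0"]) auto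
  ultimately have lim: "(\<lambda>n. K (real n)) \<longlonglongrightarrow> 0" by (simp add: K_def)
  have "(K \<longlongrightarrow> 0) at_top"
  proof (rule tendstoI)
    fix e :: real assume "e > 0"
    then obtain n where "\<bar>K (real n)\<bar> < e"
      using lim by (metis (no_types, lifting) LIMSEQ_D order_refl diff_zero real_norm_def)
    then have "dist (K y) 0 < e" if "y \<ge> real n" for y
      using mono[OF that] K0[of y] by simp
    then show "\<forall>\<^sub>F y in at_top. dist (K y) 0 < e"
      unfolding eventually_at_top_linorder by blast
  qed
  then show ?thesis by (simp add: K_def[abs_def])
qed

text \<open>For \<open>y \<ge> 1\<close>, the expression is by \<open>powr_split_le\<close> at most
  \<open>\<epsilon> / 2\<close> plus a constant times the integral of \<open>A powr p\<close> with
  the same exponential weight, and the latter tends to zero.\<close>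

lemma Lp_exp_weighted_integral_decay:
  fixes A :: "real \<Rightarrow> real"
  assumes a: "a > 0" and p: "p \<ge> 1" and A0: "\<And>x. A x \<ge> 0"
    and A: "A absolutely_integrable_on {0..a}" and Ap: "(\<lambda>x. A x powr p) absolutely_integrable_on {0..a}"
  shows "((\<lambda>y. integral {0..a} (\<lambda>x. A x * exp (- 2 * (a - x) * y)) * max 1 y powr (1 - 1 / p)) \<longlongrightarrow> 0) at_top"
proof -
  define G where "G y = integral {0..a} (\<lambda>x. A x * exp (- 2 * (a - x) * y))" for y
  define K where "K y = integral {0..a} (\<lambda>x. A x powr p * exp (- 2 * (a - x) * y))" for y
  have Gi: "(\<lambda>x. A x * exp (- 2 * (a - x) * y)) integrable_on {0..a}" for y
    by (intro integrable_mult_continuous_real A continuous_intros)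
  have Ki: "(\<lambda>x. A x powr p * exp (- 2 * (a - x) * y)) integrable_on {0..a}" for y
    by (intro integrable_mult_continuous_real Ap continuous_intros)
  have G0: "G y \<ge> 0" for y unfolding G_def by (rule integral_nonneg[OF Gi]) (use A0 in auto)
  have Klim: "(K \<longlongrightarrow> 0) at_top"
    unfolding K_def[abs_def] by (rule exp_weighted_integral_tendsto_0[OF a Ap]) simp
  have est: "G y * max 1 y powr (1 - 1 / p) \<le> \<epsilon> / 2 + \<epsilon> powr (1 - p) * K y" if y: "y \<ge> 1" and e: "\<epsilon> > 0" for y \<epsilon>
  proof -
    have y0: "y > 0" using y by simp
    have H: "((\<lambda>x. \<epsilon> * (y * exp (- 2 * (a - x) * y)) + \<epsilon> powr (1 - p) * (A x powr p * exp (- 2 * (a - x) * y))) has_integral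
       (\<epsilon> * ((1 - exp (- 2 * a * y)) / 2) + \<epsilon> powr (1 - p) * K y)) {0..a}"
      unfolding K_def
      by (intro has_integral_add has_integral_mult_right exp_weight_has_integral a y0 integrable_integral Ki)
    have H2: "((\<lambda>x. (A x * exp (- 2 * (a - x) * y)) * y powr (1 - 1 / p)) has_integral G y * y powr (1 - 1 / p)) {0..a}"
      unfolding G_def by (intro has_integral_mult_left integrable_integral Gi)
    have "G y * y powr (1 - 1 / p) \<le> \<epsilon> * ((1 - exp (- 2 * a * y)) / 2) + \<epsilon> powr (1 - p) * K y"
    proof (rule has_integral_le[OF H2 H])
      fix x
      have "(A x * y powr (1 - 1 / p)) * exp (- 2 * (a - x) * y) \<le> (\<epsilon> * y + \<epsilon> powr (1 - p) * A x powr p) * exp (- 2 * (a - x) * y)"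
        by (intro mult_right_mono powr_split_le A0 y0 e p) auto
      then show "A x * exp (- 2 * (a - x) * y) * y powr (1 - 1 / p)
          \<le> \<epsilon> * (y * exp (- 2 * (a - x) * y)) + \<epsilon> powr (1 - p) * (A x powr p * exp (- 2 * (a - x) * y))"
        by (simp add: algebra_simps)
    qed
    also have "\<epsilon> * ((1 - exp (- 2 * a * y)) / 2) \<le> \<epsilon> * (1 / 2)" using e by (intro mult_left_mono) auto
    finally show ?thesis using y by (simp add: max_absorb2)
  qed
  have "((\<lambda>y. G y * max 1 y powr (1 - 1 / p)) \<longlongrightarrow> 0) at_top"
  proof (rule tendstoI)
    fix e :: real assume e: "e > 0"
    have t: "((\<lambda>y. e / 2 + e powr (1 - p) * K y) \<longlongrightarrow> e / 2 + e powr (1 - p) * 0) at_top"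
      by (intro tendsto_intros Klim)
    have "\<forall>\<^sub>F y in at_top. e / 2 + e powr (1 - p) * K y < e"
      by (rule order_tendstoD(2)[OF t]) (use e in simp)
    then show "\<forall>\<^sub>F y in at_top. dist (G y * max 1 y powr (1 - 1 / p)) 0 < e"
      using eventually_ge_at_top[of 1]
    proof eventually_elim
      case (elim y)
      then show ?case using est[of y e] e G0[of y] by (simp add: abs_mult)
    qed
  qed
  then show ?thesis by (simp add: G_def)
qed

lemma exp_mult_powr_tendsto_0:
  assumes "a > (0::real)"
  shows "((\<lambda>y. exp (- 2 * a * y) * max 1 y powr \<gamma>) \<longlongrightarrow> 0) at_top"
proof -
  define m where "m = nat \<lceil>\<gamma>\<rceil>"
  have "((\<lambda>y. y ^ m / exp (2 * a * y)) \<longlongrightarrow> 0) at_top"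
  proof -
    have f: "filterlim (\<lambda>y. 2 * a * y) at_top at_top"
      using assms by (intro filterlim_tendsto_pos_mult_at_top[OF tendsto_const] filterlim_ident) auto
    have "((\<lambda>y. (2 * a * y) ^ m / exp (2 * a * y)) \<longlongrightarrow> 0) at_top"
      by (rule filterlim_compose[OF tendsto_power_div_exp_0 f])
    then have "((\<lambda>y. inverse ((2 * a) ^ m) * ((2 * a * y) ^ m / exp (2 * a * y))) \<longlongrightarrow> inverse ((2 * a) ^ m) * 0) at_top"
      by (intro tendsto_intros)
    moreover have "inverse ((2 * a) ^ m) * ((2 * a * y) ^ m / exp (2 * a * y)) = y ^ m / exp (2 * a * y)" for y
      using assms by (simp add: power_mult_distrib field_simps)
    ultimately show ?thesis by simp
  qed
  then show ?thesis
  proof (rule Lim_null_comparison[rotated])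
    show "\<forall>\<^sub>F y in at_top. norm (exp (- 2 * a * y) * max 1 y powr \<gamma>) \<le> y ^ m / exp (2 * a * y)"
      using eventually_ge_at_top[of 1]
    proof eventually_elim
      case (elim y)
      have "y powr \<gamma> \<le> y powr real m" using elim unfolding m_def by (intro powr_mono) (auto simp: real_nat_ceiling_ge)
      then have "y powr \<gamma> \<le> y ^ m" using elim by (simp add: powr_realpow)
      then show ?case using elim by (simp add: exp_minus field_simps max_absorb2)
    qed
  qed
qed

text \<open>The Wronskian at \<open>1\<close> of the two solutions that satisfy the boundary conditions at
  \<open>0\<close>.\<close>

definition cross_wronskian :: "(real \<Rightarrow> real) \<Rightarrow> real \<Rightarrow> (real \<Rightarrow> real) \<Rightarrow> real \<Rightarrow> complex \<Rightarrow> complex" where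
  "cross_wronskian q\<^sub>1 h\<^sub>1 q\<^sub>2 h\<^sub>2 z = sol q\<^sub>1 1 (- of_real h\<^sub>1) z 1 * dsol q\<^sub>2 1 (- of_real h\<^sub>2) z 1
     - dsol q\<^sub>1 1 (- of_real h\<^sub>1) z 1 * sol q\<^sub>2 1 (- of_real h\<^sub>2) z 1"

lemma cross_wronskian_eq_0:
  assumes "char_fn q\<^sub>1 h\<^sub>1 H z = 0" "char_fn q\<^sub>2 h\<^sub>2 H z = 0"
  shows "cross_wronskian q\<^sub>1 h\<^sub>1 q\<^sub>2 h\<^sub>2 z = 0"
proof -
  have "dsol q\<^sub>1 1 (- of_real h\<^sub>1) z 1 = - of_real H * sol q\<^sub>1 1 (- of_real h\<^sub>1) z 1"
    "dsol q\<^sub>2 1 (- of_real h\<^sub>2) z 1 = - of_real H * sol q\<^sub>2 1 (- of_real h\<^sub>2) z 1"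
    using assms by (auto simp: char_fn_def add_eq_0_iff)
  then show ?thesis by (simp add: cross_wronskian_def)
qed

text \<open>The shift \<open>c\<close> of the energy is absorbed into the potential.\<close>

lemma sol_growth_shifted:
  assumes q: "q absolutely_integrable_on {0..1}"
  obtains C where "C > 0" "\<And>k x. norm k \<ge> 1 \<Longrightarrow> x \<in> {0..1} \<Longrightarrow>
    norm (sol q 1 (- of_real h) (of_real c + k\<^sup>2) x) \<le> C * exp (\<bar>Im k\<bar> * x)"
proof -
  define r where "r x = q x - c" for x
  have r: "r absolutely_integrable_on {0..1}"
    unfolding r_def by (intro set_integral_diff q) (auto intro: absolutely_integrable_on_const)
  define C where "C = (1 + \<bar>h\<bar>) * exp (integral {0..1} (\<lambda>t. \<bar>r t\<bar>))"
  show ?thesis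
  proof (rule that[of C])
    show "C > 0" unfolding C_def by (intro mult_pos_pos) auto
    fix k :: complex and x :: real assume k: "norm k \<ge> 1" and x: "x \<in> {0..1}"
    let ?z = "of_real c + k\<^sup>2"
    have "solves (energy_potential r (k\<^sup>2)) (\<lambda>_. 0) (sol q 1 (- of_real h) ?z) (dsol q 1 (- of_real h) ?z)"
      using sol_solves[OF q, of ?z 1 "- of_real h"] by (simp add: r_def algebra_simps)
    from solves_growth[OF r this k x]
    have "norm (sol q 1 (- of_real h) ?z x) \<le> (1 + \<bar>h\<bar> / norm k) * exp (integral {0..1} (\<lambda>t. \<bar>r t\<bar>)) * exp (\<bar>Im k\<bar> * x)"
      by (simp add: sol_at_0[OF q] dsol_at_0[OF q])
    also have "\<dots> \<le> C * exp (\<bar>Im k\<bar> * x)"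
      unfolding C_def using k by (intro mult_right_mono) (auto simp: divide_le_eq mult_le_cancel_left1)
    finally show "norm (sol q 1 (- of_real h) ?z x) \<le> C * exp (\<bar>Im k\<bar> * x)" .
  qed
qed

context
  fixes q\<^sub>1 q\<^sub>2 :: "real \<Rightarrow> real" and a :: real
  assumes q1: "q\<^sub>1 absolutely_integrable_on {0..1}" and q2: "q\<^sub>2 absolutely_integrable_on {0..1}"
    and a: "0 < a" "a \<le> 1" and ae: "AE x in lebesgue_on {a..1}. q\<^sub>1 x = q\<^sub>2 x"
begin

lemma cross_wronskian_holomorphic: "cross_wronskian q\<^sub>1 h\<^sub>1 q\<^sub>2 h\<^sub>2 holomorphic_on A"
  unfolding cross_wronskian_def[abs_def]
  by (intro holomorphic_intros sol_holomorphic[OF q1] sol_holomorphic[OF q2]) auto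

lemma cross_wronskian_integral:
  "((\<lambda>t. of_real (q\<^sub>2 t - q\<^sub>1 t) * (sol q\<^sub>1 1 (- of_real h\<^sub>1) z t * sol q\<^sub>2 1 (- of_real h\<^sub>2) z t)) has_integral
    cross_wronskian q\<^sub>1 h\<^sub>1 q\<^sub>2 h\<^sub>2 z - of_real (h\<^sub>1 - h\<^sub>2)) {0..a}"
proof -
  let ?g = "\<lambda>t. of_real (q\<^sub>2 t - q\<^sub>1 t) * (sol q\<^sub>1 1 (- of_real h\<^sub>1) z t * sol q\<^sub>2 1 (- of_real h\<^sub>2) z t)"
  have "(?g has_integral cross_wronskian q\<^sub>1 h\<^sub>1 q\<^sub>2 h\<^sub>2 z - of_real (h\<^sub>1 - h\<^sub>2)) {0..1}"
    using wronskian_has_integral[OF sol_solves[OF q1, of z 1 "- of_real h\<^sub>1"] sol_solves[OF q2, of z 1 "- of_real h\<^sub>2"], of 1]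
    by (simp add: cross_wronskian_def sol_at_0[OF q1] dsol_at_0[OF q1] sol_at_0[OF q2] dsol_at_0[OF q2] algebra_simps)
  moreover have "(?g has_integral 0) {a..1}"
  proof -
    have "AE x in lebesgue. x \<in> {a..1} \<longrightarrow> q\<^sub>1 x = q\<^sub>2 x"
      using ae by (subst (asm) AE_restrict_space_iff) auto
    then obtain N where N: "N \<in> null_sets lebesgue" "{x. \<not> (x \<in> {a..1} \<longrightarrow> q\<^sub>1 x = q\<^sub>2 x)} \<subseteq> N"
      unfolding eventually_ae_filter by auto
    then show ?thesis
      by (intro has_integral_spike[of N _ ?g "\<lambda>_. 0"] has_integral_0) (auto simp: negligible_iff_null_sets)
  qed
  ultimately have I: "integral {0..1} ?g = cross_wronskian q\<^sub>1 h\<^sub>1 q\<^sub>2 h\<^sub>2 z - of_real (h\<^sub>1 - h\<^sub>2)"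
    "integral {a..1} ?g = 0" "?g integrable_on {0..1}" by (auto simp: has_integral_iff)
  have "integral {0..a} ?g + integral {a..1} ?g = integral {0..1} ?g"
    using a by (intro Henstock_Kurzweil_Integration.integral_combine I(3)) auto
  moreover have "?g integrable_on {0..a}"
    using a by (intro integrable_subinterval_real[OF I(3)]) auto
  ultimately show ?thesis unfolding has_integral_iff I by simp
qed

lemma difference_integrable: "(\<lambda>x. \<bar>q\<^sub>1 x - q\<^sub>2 x\<bar>) absolutely_integrable_on {0..a}"
proof -
  have "(\<lambda>x. q\<^sub>1 x - q\<^sub>2 x) absolutely_integrable_on {0..1}"
    by (intro set_integral_diff q1 q2)
  then have "(\<lambda>x. q\<^sub>1 x - q\<^sub>2 x) absolutely_integrable_on {0..a}"
    by (rule absolutely_integrable_on_subinterval) (use a in auto)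
  from absolutely_integrable_norm[OF this] show ?thesis by (simp add: o_def)
qed

text \<open>Each solution is \<open>O(exp (\<bar>Im k\<bar> * x))\<close>, so the integrand in the formula for
  the cross Wronskian is
  \<open>O(\<bar>q\<^sub>1 x - q\<^sub>2 x\<bar> * exp (2 * \<bar>Im k\<bar> * x))\<close>,
  and \<open>x \<le> a\<close>.\<close>

lemma cross_wronskian_growth:
  obtains C where "C > 0" "\<And>k. norm k \<ge> 1 \<Longrightarrow> norm (cross_wronskian q\<^sub>1 h\<^sub>1 q\<^sub>2 h\<^sub>2 (of_real c + k\<^sup>2)) \<le>
    (\<bar>h\<^sub>1 - h\<^sub>2\<bar> * exp (- 2 * a * \<bar>Im k\<bar>) + C * integral {0..a} (\<lambda>x. \<bar>q\<^sub>1 x - q\<^sub>2 x\<bar> * exp (- 2 * (a - x) * \<bar>Im k\<bar>)))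
    * exp (2 * a * \<bar>Im k\<bar>)"
proof -
  obtain C1 where C1: "C1 > 0" "\<And>k x. norm k \<ge> 1 \<Longrightarrow> x \<in> {0..1} \<Longrightarrow>
    norm (sol q\<^sub>1 1 (- of_real h\<^sub>1) (of_real c + k\<^sup>2) x) \<le> C1 * exp (\<bar>Im k\<bar> * x)" using sol_growth_shifted[OF q1] by blast
  obtain C2 where C2: "C2 > 0" "\<And>k x. norm k \<ge> 1 \<Longrightarrow> x \<in> {0..1} \<Longrightarrow>
    norm (sol q\<^sub>2 1 (- of_real h\<^sub>2) (of_real c + k\<^sup>2) x) \<le> C2 * exp (\<bar>Im k\<bar> * x)" using sol_growth_shifted[OF q2] by blast
  show ?thesis
  proof (rule that[of "C1 * C2"])
    show "C1 * C2 > 0" using C1 C2 by simp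
    fix k :: complex assume k: "norm k \<ge> 1"
    let ?\<eta> = "\<bar>Im k\<bar>" and ?z = "of_real c + k\<^sup>2"
    let ?G = "integral {0..a} (\<lambda>x. \<bar>q\<^sub>1 x - q\<^sub>2 x\<bar> * exp (- 2 * (a - x) * ?\<eta>))"
    have Gi: "(\<lambda>x. \<bar>q\<^sub>1 x - q\<^sub>2 x\<bar> * exp (- 2 * (a - x) * ?\<eta>)) integrable_on {0..a}"
      by (intro integrable_mult_continuous_real difference_integrable continuous_intros)
    have H: "((\<lambda>x. (C1 * C2 * exp (2 * a * ?\<eta>)) * (\<bar>q\<^sub>1 x - q\<^sub>2 x\<bar> * exp (- 2 * (a - x) * ?\<eta>))) has_integral
        (C1 * C2 * exp (2 * a * ?\<eta>)) * ?G) {0..a}"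
      by (intro has_integral_mult_right integrable_integral Gi)
    note W = cross_wronskian_integral[of h\<^sub>1 ?z h\<^sub>2]
    have "norm (cross_wronskian q\<^sub>1 h\<^sub>1 q\<^sub>2 h\<^sub>2 ?z - of_real (h\<^sub>1 - h\<^sub>2)) \<le> (C1 * C2 * exp (2 * a * ?\<eta>)) * ?G"
      unfolding integral_unique[OF W, symmetric] integral_unique[OF H, symmetric]
    proof (rule integral_norm_bound_integral[OF has_integral_integrable[OF W] has_integral_integrable[OF H]])
      fix t assume t: "t \<in> {0..a}"
      then have t1: "t \<in> {0..1}" using a by auto
      have "norm (sol q\<^sub>1 1 (- of_real h\<^sub>1) ?z t) * norm (sol q\<^sub>2 1 (- of_real h\<^sub>2) ?z t) \<le> (C1 * exp (?\<eta> * t)) * (C2 * exp (?\<eta> * t))"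
        using C1 C2 k t1 by (intro mult_mono) auto
      also have "\<dots> = C1 * C2 * exp (2 * a * ?\<eta>) * exp (- 2 * (a - t) * ?\<eta>)"
        by (simp add: exp_add[symmetric] algebra_simps mult_exp_exp)
      finally have le: "norm (sol q\<^sub>1 1 (- of_real h\<^sub>1) ?z t) * norm (sol q\<^sub>2 1 (- of_real h\<^sub>2) ?z t)
          \<le> C1 * C2 * exp (2 * a * ?\<eta>) * exp (- 2 * (a - t) * ?\<eta>)" .
      have "norm (of_real (q\<^sub>2 t - q\<^sub>1 t) * (sol q\<^sub>1 1 (- of_real h\<^sub>1) ?z t * sol q\<^sub>2 1 (- of_real h\<^sub>2) ?z t))
          = \<bar>q\<^sub>1 t - q\<^sub>2 t\<bar> * (norm (sol q\<^sub>1 1 (- of_real h\<^sub>1) ?z t) * norm (sol q\<^sub>2 1 (- of_real h\<^sub>2) ?z t))"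
        unfolding norm_mult norm_of_real by (simp add: abs_minus_commute)
      also have "\<dots> \<le> \<bar>q\<^sub>1 t - q\<^sub>2 t\<bar> * (C1 * C2 * exp (2 * a * ?\<eta>) * exp (- 2 * (a - t) * ?\<eta>))"
        by (intro mult_left_mono le) auto
      finally show "norm (of_real (q\<^sub>2 t - q\<^sub>1 t) * (sol q\<^sub>1 1 (- of_real h\<^sub>1) ?z t * sol q\<^sub>2 1 (- of_real h\<^sub>2) ?z t))
          \<le> (C1 * C2 * exp (2 * a * ?\<eta>)) * (\<bar>q\<^sub>1 t - q\<^sub>2 t\<bar> * exp (- 2 * (a - t) * ?\<eta>))"
        by (simp only: mult_ac)
    qed
    then have "norm (cross_wronskian q\<^sub>1 h\<^sub>1 q\<^sub>2 h\<^sub>2 ?z) \<le> \<bar>h\<^sub>1 - h\<^sub>2\<bar> + (C1 * C2 * exp (2 * a * ?\<eta>)) * ?G"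
      using norm_triangle_sub[of "cross_wronskian q\<^sub>1 h\<^sub>1 q\<^sub>2 h\<^sub>2 ?z" "of_real (h\<^sub>1 - h\<^sub>2)"] by (simp only: norm_of_real)
    also have "\<dots> = (\<bar>h\<^sub>1 - h\<^sub>2\<bar> * exp (- 2 * a * ?\<eta>) + C1 * C2 * ?G) * exp (2 * a * ?\<eta>)"
      by (simp add: distrib_right mult_exp_exp)
    finally show "norm (cross_wronskian q\<^sub>1 h\<^sub>1 q\<^sub>2 h\<^sub>2 ?z) \<le> (\<bar>h\<^sub>1 - h\<^sub>2\<bar> * exp (- 2 * a * ?\<eta>) + C1 * C2 * ?G) * exp (2 * a * ?\<eta>)" .
  qed
qed

lemma cross_wronskian_zero_of_dense_zeros:
  assumes p: "p \<ge> 1" and Lp: "(\<lambda>x. \<bar>q\<^sub>1 x - q\<^sub>2 x\<bar> powr p) absolutely_integrable_on {0..a}"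
    and zeros: "\<And>N. \<exists>T. finite T \<and> card T \<ge> N \<and> 0 \<notin> T \<and> (\<forall>s\<in>T. cross_wronskian q\<^sub>1 h\<^sub>1 q\<^sub>2 h\<^sub>2 (of_real c + s) = 0) \<and>
       (\<Sum>s\<in>T. ln (norm s)) \<le> 2 * real (card T) * ln (pi / (2 * a)) + 2 * (\<Sum>j=1..card T. ln (real j - 1 / (2 * p))) + C\<^sub>0"
  shows "cross_wronskian q\<^sub>1 h\<^sub>1 q\<^sub>2 h\<^sub>2 (of_real c) = 0"
proof -
  obtain C where C: "C > 0" and growth: "\<And>k. norm k \<ge> 1 \<Longrightarrow> norm (cross_wronskian q\<^sub>1 h\<^sub>1 q\<^sub>2 h\<^sub>2 (of_real c + k\<^sup>2)) \<le>
    (\<bar>h\<^sub>1 - h\<^sub>2\<bar> * exp (- 2 * a * \<bar>Im k\<bar>) + C * integral {0..a} (\<lambda>x. \<bar>q\<^sub>1 x - q\<^sub>2 x\<bar> * exp (- 2 * (a - x) * \<bar>Im k\<bar>)))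
    * exp (2 * a * \<bar>Im k\<bar>)"
    using cross_wronskian_growth[of h\<^sub>1 h\<^sub>2 c] by blast
  define \<gamma> where "\<gamma> = 1 - 1 / p"
  have g0: "\<gamma> \<ge> 0" using p by (simp add: \<gamma>_def)
  define G where "G y = integral {0..a} (\<lambda>x. \<bar>q\<^sub>1 x - q\<^sub>2 x\<bar> * exp (- 2 * (a - x) * y))" for y
  define D where "D y = \<bar>h\<^sub>1 - h\<^sub>2\<bar> * exp (- 2 * a * y) + C * G y" for y
  have Gi: "(\<lambda>x. \<bar>q\<^sub>1 x - q\<^sub>2 x\<bar> * exp (- 2 * (a - x) * y)) integrable_on {0..a}" for y
    by (intro integrable_mult_continuous_real difference_integrable continuous_intros)
  have lim: "((\<lambda>y. D y * max 1 y powr \<gamma>) \<longlongrightarrow> 0) at_top"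
  proof -
    have "((\<lambda>y. G y * max 1 y powr \<gamma>) \<longlongrightarrow> 0) at_top"
      unfolding G_def \<gamma>_def by (rule Lp_exp_weighted_integral_decay[OF a(1) p _ difference_integrable Lp]) simp
    then have "((\<lambda>y. \<bar>h\<^sub>1 - h\<^sub>2\<bar> * (exp (- 2 * a * y) * max 1 y powr \<gamma>) + C * (G y * max 1 y powr \<gamma>)) \<longlongrightarrow> \<bar>h\<^sub>1 - h\<^sub>2\<bar> * 0 + C * 0) at_top"
      by (intro tendsto_intros exp_mult_powr_tendsto_0 a(1))
    then show ?thesis by (simp add: D_def distrib_right mult.assoc)
  qed
  obtain Y where Y: "\<And>y. y \<ge> Y \<Longrightarrow> D y * max 1 y powr \<gamma> < 1"
    using order_tendstoD(2)[OF lim zero_less_one] unfolding eventually_at_top_linorder by blast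
  define B where "B = 1 + (\<bar>h\<^sub>1 - h\<^sub>2\<bar> + C * G 0) * max 1 Y powr \<gamma>"
  have G0: "G 0 \<ge> 0" unfolding G_def by (rule integral_nonneg[OF Gi]) auto
  have bd: "D y * max 1 y powr \<gamma> \<le> B" if y: "y \<ge> 0" for y
  proof (cases "y \<ge> Y")
    case True
    have "(\<bar>h\<^sub>1 - h\<^sub>2\<bar> + C * G 0) * max 1 Y powr \<gamma> \<ge> 0" using C G0 by (intro mult_nonneg_nonneg add_nonneg_nonneg) auto
    then show ?thesis using Y[OF True] unfolding B_def by linarith
  next
    case False
    have "G y \<le> G 0"
      unfolding G_def
    proof (intro integral_le Gi mult_left_mono abs_ge_zero)
      fix x assume "x \<in> {0..a}"
      then have "(a - x) * y \<ge> 0" using y by simp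
      then show "exp (- 2 * (a - x) * y) \<le> exp (- 2 * (a - x) * 0)" by (simp add: algebra_simps)
    qed
    moreover have "exp (- 2 * a * y) \<le> 1" using y a by simp
    ultimately have "D y \<le> \<bar>h\<^sub>1 - h\<^sub>2\<bar> * 1 + C * G 0"
      unfolding D_def using C by (intro add_mono mult_left_mono) auto
    then have "D y * max 1 y powr \<gamma> \<le> (\<bar>h\<^sub>1 - h\<^sub>2\<bar> + C * G 0) * max 1 Y powr \<gamma>"
      using False g0 C G0 by (intro mult_mono powr_mono2) auto
    then show ?thesis by (simp add: B_def)
  qed
  have \<gamma>': "1 - 2 * (1 / (2 * p)) = \<gamma>" by (simp add: \<gamma>_def)
  have "(\<lambda>w. cross_wronskian q\<^sub>1 h\<^sub>1 q\<^sub>2 h\<^sub>2 (of_real c + w)) 0 = 0"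
  proof (rule entire_zero_of_dense_zeros[where a = a and \<tau> = "1 / (2 * p)" and D = D and B = B and C = C\<^sub>0, OF _ a(1)])
    have "(cross_wronskian q\<^sub>1 h\<^sub>1 q\<^sub>2 h\<^sub>2 \<circ> (\<lambda>w. of_real c + w)) holomorphic_on UNIV"
      by (rule holomorphic_on_compose_gen[OF _ cross_wronskian_holomorphic[of _ _ UNIV]]) (auto intro: holomorphic_intros)
    then show "(\<lambda>w. cross_wronskian q\<^sub>1 h\<^sub>1 q\<^sub>2 h\<^sub>2 (of_real c + w)) holomorphic_on UNIV" by (simp add: o_def)
    show "0 < 1 / (2 * p)" "1 / (2 * p) \<le> 1 / 2" using p by (auto simp: divide_simps)
    show "norm (cross_wronskian q\<^sub>1 h\<^sub>1 q\<^sub>2 h\<^sub>2 (of_real c + k\<^sup>2)) \<le> D \<bar>Im k\<bar> * exp (2 * a * \<bar>Im k\<bar>)" if "norm k \<ge> 1" for k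
      using growth[OF that] unfolding D_def G_def .
    show "D y * max 1 y powr (1 - 2 * (1 / (2 * p))) \<le> B" if "y \<ge> 0" for y
      unfolding \<gamma>' by (rule bd[OF that])
    show "((\<lambda>y. D y * max 1 y powr (1 - 2 * (1 / (2 * p)))) \<longlongrightarrow> 0) at_top"
      unfolding \<gamma>' by (rule lim)
  qed (rule zeros)
  then show ?thesis by simp
qed

end

section \<open>Sums over the common eigenvalues\<close>

lemma sum_inverse_squares_le: "(\<Sum>j=1..n. 1 / (real j)\<^sup>2) \<le> 2"
proof (cases "n = 0")
  case False
  then have "n \<ge> 1" by simp
  then have "(\<Sum>j=1..n. 1 / (real j)\<^sup>2) \<le> 2 - 1 / real n"
  proof (induction n rule: nat_induct_at_least)
    case (Suc n)
    have "1 / (real (Suc n))\<^sup>2 \<le> 1 / real n - 1 / real (Suc n)"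
      using Suc.hyps by (simp add: divide_simps) (simp add: power2_eq_square algebra_simps)
    then show ?case using Suc by simp
  qed simp
  then show ?thesis using False by (smt (verit) divide_nonneg_nonneg of_nat_0_le_iff)
qed simp

text \<open>Beyond \<open>t\<^sub>0\<close> the counting function increases by one at each point of \<open>S\<close>, and
  thus enumerates them.\<close>

lemma sum_over_counting_index:
  fixes S :: "complex set" and f :: "nat \<Rightarrow> real"
  assumes fin: "\<And>t. finite {z \<in> S. norm z \<le> t}"
    and inj: "\<And>s s'. s \<in> S \<Longrightarrow> s' \<in> S \<Longrightarrow> norm s > t\<^sub>0 \<Longrightarrow> norm s' > t\<^sub>0 \<Longrightarrow> norm s = norm s' \<Longrightarrow> s = s'"
    and t: "t \<ge> t\<^sub>0"
  shows "(\<Sum>s\<in>{z \<in> S. t\<^sub>0 < norm z \<and> norm z \<le> t}. f (counting S (norm s))) = (\<Sum>j\<in>{counting S t\<^sub>0 + 1..counting S t}. f j)"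
proof -
  let ?A = "{z \<in> S. t\<^sub>0 < norm z \<and> norm z \<le> t}" and ?\<kappa> = "\<lambda>s. counting S (norm s)"
  have finA: "finite ?A" by (rule finite_subset[OF _ fin[of t]]) auto
  have mono: "counting S r \<le> counting S r'" if "r \<le> r'" for r r'
    unfolding counting_def using that by (intro card_mono fin) auto
  have strict: "counting S r < counting S (norm s)" if "r < norm s" "s \<in> S" for r s
    unfolding counting_def
  proof (rule psubset_card_mono[OF fin])
    have "s \<in> {z \<in> S. norm z \<le> norm s} - {z \<in> S. norm z \<le> r}" using that by auto
    moreover have "{z \<in> S. norm z \<le> r} \<subseteq> {z \<in> S. norm z \<le> norm s}" using that by auto
    ultimately show "{z \<in> S. norm z \<le> r} \<subset> {z \<in> S. norm z \<le> norm s}" by blast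
  qed
  have inj': "inj_on ?\<kappa> ?A"
  proof (rule inj_onI)
    fix s s' assume "s \<in> ?A" "s' \<in> ?A" "?\<kappa> s = ?\<kappa> s'"
    then show "s = s'" using inj[of s s'] strict[of "norm s" s'] strict[of "norm s'" s]
      by (metis (no_types, lifting) less_irrefl linorder_neqE_linordered_idom mem_Collect_eq)
  qed
  have sub: "?\<kappa> ` ?A \<subseteq> {counting S t\<^sub>0 + 1..counting S t}"
    using mono strict by fastforce
  have cA: "card ?A = card {counting S t\<^sub>0 + 1..counting S t}"
  proof -
    have "{z \<in> S. norm z \<le> t} = {z \<in> S. norm z \<le> t\<^sub>0} \<union> ?A" using t by auto
    then have "card {z \<in> S. norm z \<le> t} = card {z \<in> S. norm z \<le> t\<^sub>0} + card ?A"
      by (simp only:) (rule card_Un_disjoint[OF fin finA], auto)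
    then show ?thesis by (simp add: counting_def)
  qed
  have "?\<kappa> ` ?A = {counting S t\<^sub>0 + 1..counting S t}"
    by (rule card_subset_eq[OF _ sub]) (simp_all only: card_image[OF inj'] cA finite_atLeastAtMost)
  with inj' have "bij_betw ?\<kappa> ?A {counting S t\<^sub>0 + 1..counting S t}"
    by (rule bij_betw_imageI)
  from sum.reindex_bij_betw[OF this, of f] show ?thesis .
qed

text \<open>Let \<open>j\<close> be the index of \<open>s\<close> in the enumeration of \<open>S\<close> by modulus. The
  hypothesis \<open>idx\<close> implies
  \<open>norm (s - c) \<le> (b * (j - \<tau>))\<^sup>2 + D\<close>, whose
  logarithm exceeds \<open>2 * ln b + 2 * ln (j - \<tau>)\<close> only by a
  summable term \<open>E / j\<^sup>2\<close>. The finitely many elements of modulus at most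
  \<open>t\<^sub>0\<close> contribute to the constant. The set \<open>T\<close> consists of an initial segment
  of \<open>S\<close>, translated by \<open>- c\<close>.\<close>

lemma ln_dist_sum_bound:
  fixes S :: "complex set" and b \<tau> C\<^sub>1 t\<^sub>0 c :: real
  assumes inf: "infinite S" and fin: "\<And>t. finite {z \<in> S. norm z \<le> t}" and b: "b > 0"
    and \<tau>: "0 < \<tau>" "\<tau> \<le> 1/2" and C1: "C\<^sub>1 > 0" and t0: "t\<^sub>0 > 0" and cS: "of_real c \<notin> S"
    and large: "\<And>s. s \<in> S \<Longrightarrow> norm s > t\<^sub>0 \<Longrightarrow> s = of_real (norm s)"
    and idx: "\<And>s. s \<in> S \<Longrightarrow> norm s > t\<^sub>0 \<Longrightarrow> sqrt (norm s) \<le> b * (real (counting S (norm s)) - \<tau>) + C\<^sub>1 / sqrt (norm s)"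
  obtains C where "\<And>N. \<exists>T. finite T \<and> card T \<ge> N \<and> 0 \<notin> T \<and> (\<forall>s\<in>T. of_real c + s \<in> S) \<and>
       (\<Sum>s\<in>T. ln (norm s)) \<le> 2 * real (card T) * ln b + 2 * (\<Sum>j=1..card T. ln (real j - \<tau>)) + C"
proof -
  define D where "D = 2 * C\<^sub>1 + \<bar>c\<bar>"
  define E where "E = 4 * D / b\<^sup>2"
  have D0: "D > 0" and E0: "E > 0" using C1 b by (auto simp: D_def E_def)
  define M where "M = counting S t\<^sub>0"
  define Z where "Z = (\<Sum>s\<in>{z \<in> S. norm z \<le> t\<^sub>0}. ln (norm (s - of_real c)))"
  define f where "f j = 2 * ln b + 2 * ln (real j - \<tau>) + E * (1 / (real j)\<^sup>2)" for j :: nat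
  have step: "ln (norm (s - of_real c)) \<le> f (counting S (norm s))" if s: "s \<in> S" "norm s > t\<^sub>0" for s
  proof -
    define t where "t = norm s"
    define j where "j = counting S t"
    have t: "t > 0" using s(2) t0 unfolding t_def by linarith
    have "s \<in> {z \<in> S. norm z \<le> t}" using s by (simp add: t_def)
    then have j1: "j \<ge> 1" unfolding j_def counting_def using fin[of t] by (metis (no_types, lifting) One_nat_def Suc_leI card_gt_0_iff empty_iff)
    define x where "x = real j - \<tau>"
    have x: "x \<ge> real j / 2" "x > 0" using j1 \<tau> by (auto simp: x_def)
    have "sqrt t \<le> b * x + C\<^sub>1 / sqrt t" using idx[OF s] by (simp add: t_def j_def x_def)
    then have "sqrt t * sqrt t \<le> (b * x + C\<^sub>1 / sqrt t) * sqrt t" using t by (intro mult_right_mono) auto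
    then have "t \<le> b * x * sqrt t + C\<^sub>1" using t by (simp add: distrib_right)
    \<comment> \<open>the arithmetic-geometric mean inequality turns the bound on \<open>sqrt t\<close> into one on \<open>t\<close>\<close>
    moreover have "2 * (b * x * sqrt t) \<le> (b * x)\<^sup>2 + t"
      using zero_le_power2[of "b * x - sqrt t"] t by (simp add: power2_diff)
    ultimately have tb: "t \<le> (b * x)\<^sup>2 + 2 * C\<^sub>1" by linarith
    have "norm (s - of_real c) \<le> t + \<bar>c\<bar>" unfolding t_def by (metis norm_of_real norm_triangle_ineq4)
    also have "\<dots> \<le> (b * x)\<^sup>2 + D" using tb by (simp add: D_def)
    also have "\<dots> = (b * x)\<^sup>2 * (1 + D / (b * x)\<^sup>2)" using b x by (simp add: field_simps)
    finally have le: "norm (s - of_real c) \<le> (b * x)\<^sup>2 * (1 + D / (b * x)\<^sup>2)" .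
    have "s - of_real c \<noteq> 0" using cS s by auto
    then have pos: "0 < norm (s - of_real c)" by simp
    have "ln (norm (s - of_real c)) \<le> ln ((b * x)\<^sup>2 * (1 + D / (b * x)\<^sup>2))"
      using ln_le_cancel_iff[OF pos less_le_trans[OF pos le]] le by blast
    also have "\<dots> = ln ((b * x)\<^sup>2) + ln (1 + D / (b * x)\<^sup>2)"
      using b x D0 by (intro ln_mult_pos add_pos_pos divide_pos_pos) auto
    also have "ln ((b * x)\<^sup>2) = 2 * ln b + 2 * ln x" using b x by (simp add: ln_realpow ln_mult_pos)
    also have "ln (1 + D / (b * x)\<^sup>2) \<le> D / (b * x)\<^sup>2"
      using D0 by (intro ln_add_one_self_le_self) auto
    also have "D / (b * x)\<^sup>2 \<le> D / (b * (real j / 2))\<^sup>2"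
      using D0 b x j1 by (intro divide_left_mono power_mono mult_left_mono) auto
    also have "\<dots> = E * (1 / (real j)\<^sup>2)" by (simp add: E_def power2_eq_square mult_ac)
    finally show ?thesis unfolding f_def j_def[symmetric] t_def[symmetric] x_def by linarith
  qed
  have main: "(\<Sum>s\<in>{z \<in> S. norm z \<le> t}. ln (norm (s - of_real c)))
      \<le> 2 * real (counting S t) * ln b + 2 * (\<Sum>j=1..counting S t. ln (real j - \<tau>)) + (Z - 2 * real M * ln b - 2 * (\<Sum>j=1..M. ln (real j - \<tau>)) + 2 * E)"
    if t: "t \<ge> t\<^sub>0" for t
  proof -
    let ?A = "{z \<in> S. t\<^sub>0 < norm z \<and> norm z \<le> t}" and ?n = "counting S t"
    have Mn: "M \<le> ?n" unfolding M_def counting_def using t by (intro card_mono fin) auto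
    have finA: "finite ?A" by (rule finite_subset[OF _ fin[of t]]) auto
    have "{z \<in> S. norm z \<le> t} = {z \<in> S. norm z \<le> t\<^sub>0} \<union> ?A" using t by auto
    then have "(\<Sum>s\<in>{z \<in> S. norm z \<le> t}. ln (norm (s - of_real c))) = Z + (\<Sum>s\<in>?A. ln (norm (s - of_real c)))"
      unfolding Z_def by (simp only:) (rule sum.union_disjoint[OF fin finA], auto)
    also have "(\<Sum>s\<in>?A. ln (norm (s - of_real c))) \<le> (\<Sum>s\<in>?A. f (counting S (norm s)))"
      by (intro sum_mono step) auto
    also have "(\<Sum>s\<in>?A. f (counting S (norm s))) = (\<Sum>j\<in>{M+1..?n}. f j)"
      unfolding M_def by (rule sum_over_counting_index[OF fin _ t]) (use large in metis)
    also have "\<dots> = (\<Sum>j=1..?n. f j) - (\<Sum>j=1..M. f j)"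
    proof -
      have "{1..?n} = {1..M} \<union> {M+1..?n}" using Mn by auto
      then have "(\<Sum>j=1..?n. f j) = (\<Sum>j=1..M. f j) + (\<Sum>j\<in>{M+1..?n}. f j)"
        by (simp only:) (rule sum.union_disjoint, auto)
      then show ?thesis by simp
    qed
    finally have le: "(\<Sum>s\<in>{z \<in> S. norm z \<le> t}. ln (norm (s - of_real c))) \<le> Z + ((\<Sum>j=1..?n. f j) - (\<Sum>j=1..M. f j))"
      by simp
    have "(\<Sum>j=1..m. f j) = 2 * real m * ln b + 2 * (\<Sum>j=1..m. ln (real j - \<tau>)) + E * (\<Sum>j=1..m. 1 / (real j)\<^sup>2)" for m
      by (simp add: f_def sum.distrib sum_distrib_left)
    note le[unfolded this]
    moreover have "E * (\<Sum>j=1..?n. 1 / (real j)\<^sup>2) \<le> E * 2" using E0 sum_inverse_squares_le by (intro mult_left_mono) auto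
    moreover have "E * (\<Sum>j=1..M. 1 / (real j)\<^sup>2) \<ge> 0" using E0 by (intro mult_nonneg_nonneg sum_nonneg) auto
    ultimately show ?thesis by linarith
  qed
  show ?thesis
  proof (rule that)
    fix N :: nat
    obtain X where X: "X \<subseteq> S" "finite X" "card X = N" using infinite_arbitrarily_large[OF inf] by blast
    define t where "t = Max (insert t\<^sub>0 (norm ` X))"
    have t: "t \<ge> t\<^sub>0" "\<And>s. s \<in> X \<Longrightarrow> norm s \<le> t" using X(2) by (auto simp: t_def)
    let ?St = "{z \<in> S. norm z \<le> t}"
    define T where "T = (\<lambda>s. s - of_real c) ` ?St"
    have inj: "inj_on (\<lambda>s. s - of_real c) ?St" by (rule inj_onI) simp
    have cT: "card T = counting S t" unfolding T_def counting_def by (rule card_image[OF inj])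
    have "card X \<le> counting S t" unfolding counting_def using X t by (intro card_mono fin) auto
    moreover have "(\<Sum>s\<in>T. ln (norm s)) = (\<Sum>s\<in>?St. ln (norm (s - of_real c)))"
      unfolding T_def by (simp add: sum.reindex[OF inj])
    ultimately show "\<exists>T. finite T \<and> card T \<ge> N \<and> 0 \<notin> T \<and> (\<forall>s\<in>T. of_real c + s \<in> S) \<and>
       (\<Sum>s\<in>T. ln (norm s)) \<le> 2 * real (card T) * ln b + 2 * (\<Sum>j=1..card T. ln (real j - \<tau>))
         + (Z - 2 * real M * ln b - 2 * (\<Sum>j=1..M. ln (real j - \<tau>)) + 2 * E)"
      using X(3) main[OF t(1)] cT cS fin by (intro exI[of _ T]) (auto simp: T_def)
  qed
qed

section \<open>The Borg-Marchenko theorem\<close>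

lemma absolutely_integrable_reflect_unit:
  fixes q :: "real \<Rightarrow> real"
  assumes "q absolutely_integrable_on {0..1}"
  shows "(\<lambda>x. q (1 - x)) absolutely_integrable_on {0..1}"
proof -
  have w: "(\<lambda>x. complex_of_real (q x)) absolutely_integrable_on {0..1}"
    using absolutely_integrable_linear[OF assms bounded_linear_of_real] by (simp add: o_def)
  have "AC_with_derivative (\<lambda>x. integral {0..x} (\<lambda>x. complex_of_real (q x))) (\<lambda>x. complex_of_real (q x))"
    unfolding AC_with_derivative_iff using w by simp
  from AC_absolutely_integrable[OF AC_cmult[OF AC_reflect[OF this], of "-1"]]
  have "(\<lambda>x. complex_of_real (q (1 - x))) absolutely_integrable_on {0..1}" by simp
  from absolutely_integrable_linear[OF this bounded_linear_Re] show ?thesis by (simp add: o_def)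
qed

lemma solves_reflect:
  assumes "solves Q f u v"
  shows "solves (\<lambda>x. Q (1 - x)) (\<lambda>x. f (1 - x)) (\<lambda>x. u (1 - x)) (\<lambda>x. - v (1 - x))"
proof -
  have "AC_with_derivative u v" "AC_with_derivative v (\<lambda>x. Q x * u x - f x)"
    using assms by (auto simp: solves_def)
  from AC_reflect[OF this(1)] AC_cmult[OF AC_reflect[OF this(2)], of "-1"] show ?thesis
    by (simp add: solves_def)
qed

lemma sol_decompose:
  assumes q: "q absolutely_integrable_on {0..1}" and x: "x \<in> {0..1}"
  shows "sol q \<alpha> \<beta> z x = \<alpha> * sol q 1 0 z x + \<beta> * sol q 0 1 z x"
proof -
  have "solves (energy_potential q z) (\<lambda>_. 0) (\<lambda>x. \<alpha> * sol q 1 0 z x + \<beta> * sol q 0 1 z x) (\<lambda>x. \<alpha> * dsol q 1 0 z x + \<beta> * dsol q 0 1 z x)"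
    using solves_linear[OF solves_cmult[OF sol_solves[OF q, of z 1 0], of \<alpha>] sol_solves[OF q, of z 0 1], of \<beta>] by simp
  from sol_eqI(1)[OF q this x] show ?thesis by (simp add: sol_at_0[OF q] dsol_at_0[OF q])
qed

text \<open>On these circles \<open>cos k\<close>, the leading term, has modulus at least
  \<open>exp \<bar>Im k\<bar> / 4\<close>.\<close>

lemma sol_end_lower_bound:
  assumes q: "q absolutely_integrable_on {0..1}"
  obtains N where "\<And>k m. m \<ge> N \<Longrightarrow> norm k = real m * pi \<Longrightarrow> exp \<bar>Im k\<bar> / 8 \<le> norm (sol q 1 (- of_real h) (k\<^sup>2) 1)"
proof -
  define I where "I = integral {0..1} (\<lambda>t. \<bar>q t\<bar>)"
  have I0: "I \<ge> 0" unfolding I_def by (rule integral_nonneg) (use q in \<open>auto simp: absolutely_integrable_on_def\<close>)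
  define C where "C = (1 + \<bar>h\<bar>) * exp I * I + \<bar>h\<bar>"
  have C0: "C \<ge> 0" using I0 by (simp add: C_def)
  obtain N :: nat where N: "real N > 8 * C" using reals_Archimedean2 by blast
  show ?thesis
  proof (rule that[of "N + 1"])
    fix k :: complex and m :: nat assume m: "m \<ge> N + 1" and k: "norm k = real m * pi"
    let ?E = "exp \<bar>Im k\<bar>" and ?u = "sol q 1 (- of_real h) (k\<^sup>2)"
    have "real m * 1 \<le> real m * pi" using pi_gt3 by (intro mult_left_mono) auto
    moreover have "real N + 1 \<le> real m" using m by simp
    ultimately have nk: "norm k \<ge> real N + 1" using k by linarith
    then have k1: "norm k \<ge> 1" by simp
    have hk: "\<bar>h\<bar> / norm k \<le> \<bar>h\<bar>" using k1 by (simp add: divide_le_eq mult_le_cancel_left1)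
    have "norm (?u 1 - (cos k - of_real h * (sin k / k))) \<le> (1 + \<bar>h\<bar> / norm k) * exp I * I * ?E / norm k"
      using solves_asymptotics(1)[OF q sol_solves[OF q, of "k\<^sup>2" 1 "- of_real h"] k1]
      by (simp add: sol_at_0[OF q] dsol_at_0[OF q] I_def)
    also have "\<dots> \<le> (1 + \<bar>h\<bar>) * exp I * I * ?E / norm k"
      using hk I0 by (intro divide_right_mono mult_right_mono) auto
    finally have 1: "norm (?u 1 - (cos k - of_real h * (sin k / k))) \<le> (1 + \<bar>h\<bar>) * exp I * I * ?E / norm k" .
    have 2: "norm (of_real h * (sin k / k)) \<le> \<bar>h\<bar> * ?E / norm k"
      using norm_sin_cos_mult_of_real_le(1)[of 1 k] by (simp add: norm_mult norm_divide divide_right_mono mult_left_mono)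
    have 3: "?E / 4 \<le> norm (cos k)" by (rule norm_cos_lower_bound[OF k]) (use m in simp)
    have "norm (cos k) \<le> norm (?u 1) + norm (?u 1 - (cos k - of_real h * (sin k / k))) + norm (of_real h * (sin k / k))"
      using norm_triangle_ineq4[of "?u 1" "?u 1 - (cos k - of_real h * (sin k / k))"]
        norm_triangle_ineq[of "cos k - of_real h * (sin k / k)" "of_real h * (sin k / k)"] by simp
    also have "\<dots> \<le> norm (?u 1) + (1 + \<bar>h\<bar>) * exp I * I * ?E / norm k + \<bar>h\<bar> * ?E / norm k"
      using 1 2 by (intro add_mono) auto
    also have "\<dots> = norm (?u 1) + C / norm k * ?E" by (simp add: C_def add_divide_distrib distrib_right)
    also have "C / norm k * ?E \<le> 1 / 8 * ?E"
      using nk N C0 by (intro mult_right_mono) (auto simp: divide_le_eq)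
    finally show "?E / 8 \<le> norm (?u 1)" using 3 by simp
  qed
qed

text \<open>Bennewitz's argument. In the reflected variable let \<open>S\<^sub>j\<close> and \<open>T\<^sub>j\<close> be
  the solutions with Cauchy data \<open>(0, 1)\<close> and \<open>(1, 0)\<close> at the endpoint
  \<open>1\<close>, and let \<open>\<phi>\<^sub>j\<close> be the solution satisfying the boundary condition at
  \<open>0\<close>. The function
  \<open>E = S\<^sub>1 * T\<^sub>2 - S\<^sub>2 * T\<^sub>1\<close> is entire in the
  energy. As the cross Wronskian vanishes, \<open>E\<close> equals
  \<open>S\<^sub>1 * \<phi>\<^sub>2 / \<phi>\<^sub>2 1 - S\<^sub>2 * \<phi>\<^sub>1 / \<phi>\<^sub>1 1\<close>;
  here the exponential growth of \<open>S\<^sub>j\<close> from one endpoint and of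
  \<open>\<phi>\<^sub>j\<close> from the other is cancelled by the denominators, which leaves
  \<open>O(1 / norm k)\<close> on the circles \<open>norm k = m * pi\<close>. By the
  maximum principle \<open>E\<close> is zero.\<close>

lemma transfer_entire_zero:
  assumes q1: "q\<^sub>1 absolutely_integrable_on {0..1}" and q2: "q\<^sub>2 absolutely_integrable_on {0..1}"
    and W: "\<And>z. cross_wronskian q\<^sub>1 h\<^sub>1 q\<^sub>2 h\<^sub>2 z = 0" and x: "x \<in> {0..1}"
  shows "sol q\<^sub>1 1 (- of_real h\<^sub>1) z 1 * sol (\<lambda>x. q\<^sub>1 (1 - x)) 0 1 z x * sol q\<^sub>2 1 (- of_real h\<^sub>2) z (1 - x)
       = sol q\<^sub>2 1 (- of_real h\<^sub>2) z 1 * sol (\<lambda>x. q\<^sub>2 (1 - x)) 0 1 z x * sol q\<^sub>1 1 (- of_real h\<^sub>1) z (1 - x)"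
proof -
  define r\<^sub>1 where "r\<^sub>1 x = q\<^sub>1 (1 - x)" for x
  define r\<^sub>2 where "r\<^sub>2 x = q\<^sub>2 (1 - x)" for x
  have r1: "r\<^sub>1 absolutely_integrable_on {0..1}" and r2: "r\<^sub>2 absolutely_integrable_on {0..1}"
    unfolding r\<^sub>1_def r\<^sub>2_def by (intro absolutely_integrable_reflect_unit q1 q2)+
  have x': "1 - x \<in> {0..1}" using x by auto
  define \<phi>\<^sub>1 where "\<phi>\<^sub>1 = sol q\<^sub>1 1 (- of_real h\<^sub>1)"
  define \<phi>\<^sub>2 where "\<phi>\<^sub>2 = sol q\<^sub>2 1 (- of_real h\<^sub>2)"
  define S\<^sub>1 where "S\<^sub>1 z = sol r\<^sub>1 0 1 z x" for z
  define S\<^sub>2 where "S\<^sub>2 z = sol r\<^sub>2 0 1 z x" for z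
  define E where "E z = S\<^sub>1 z * sol r\<^sub>2 1 0 z x - S\<^sub>2 z * sol r\<^sub>1 1 0 z x" for z
  have refl: "sol q 1 \<beta> z (1 - x) = sol q 1 \<beta> z 1 * sol (\<lambda>x. q (1 - x)) 1 0 z x - dsol q 1 \<beta> z 1 * sol (\<lambda>x. q (1 - x)) 0 1 z x"
    if q: "q absolutely_integrable_on {0..1}" for q \<beta> z
    using sol_eqI(1)[OF absolutely_integrable_reflect_unit[OF q] solves_reflect[OF sol_solves[OF q, of z 1 \<beta>]] x]
      sol_decompose[OF absolutely_integrable_reflect_unit[OF q] x, of "sol q 1 \<beta> z 1" "- dsol q 1 \<beta> z 1" z] by simp
  have id: "\<phi>\<^sub>1 z 1 * \<phi>\<^sub>2 z 1 * E z = \<phi>\<^sub>1 z 1 * S\<^sub>1 z * \<phi>\<^sub>2 z (1 - x) - \<phi>\<^sub>2 z 1 * S\<^sub>2 z * \<phi>\<^sub>1 z (1 - x)" for z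
  proof -
    have "\<phi>\<^sub>1 z 1 * S\<^sub>1 z * \<phi>\<^sub>2 z (1 - x) - \<phi>\<^sub>2 z 1 * S\<^sub>2 z * \<phi>\<^sub>1 z (1 - x)
        = \<phi>\<^sub>1 z 1 * \<phi>\<^sub>2 z 1 * E z - cross_wronskian q\<^sub>1 h\<^sub>1 q\<^sub>2 h\<^sub>2 z * S\<^sub>1 z * S\<^sub>2 z"
      unfolding E_def S\<^sub>1_def S\<^sub>2_def r\<^sub>1_def r\<^sub>2_def \<phi>\<^sub>1_def \<phi>\<^sub>2_def refl[OF q1] refl[OF q2] cross_wronskian_def
      by (simp add: algebra_simps)
    then show ?thesis by (simp add: W)
  qed
  have Ehol: "E holomorphic_on A" for A
    unfolding E_def S\<^sub>1_def S\<^sub>2_def by (intro holomorphic_intros sol_holomorphic r1 r2 x)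
  obtain N1 where N1: "\<And>k m. m \<ge> N1 \<Longrightarrow> norm k = real m * pi \<Longrightarrow> exp \<bar>Im k\<bar> / 8 \<le> norm (\<phi>\<^sub>1 (k\<^sup>2) 1)"
    unfolding \<phi>\<^sub>1_def using sol_end_lower_bound[OF q1] by blast
  obtain N2 where N2: "\<And>k m. m \<ge> N2 \<Longrightarrow> norm k = real m * pi \<Longrightarrow> exp \<bar>Im k\<bar> / 8 \<le> norm (\<phi>\<^sub>2 (k\<^sup>2) 1)"
    unfolding \<phi>\<^sub>2_def using sol_end_lower_bound[OF q2] by blast
  obtain C1 where C1: "C1 > 0" "\<And>k x. norm k \<ge> 1 \<Longrightarrow> x \<in> {0..1} \<Longrightarrow> norm (\<phi>\<^sub>1 (k\<^sup>2) x) \<le> C1 * exp (\<bar>Im k\<bar> * x)"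
    unfolding \<phi>\<^sub>1_def using sol_growth_shifted[OF q1, of h\<^sub>1 0] by auto
  obtain C2 where C2: "C2 > 0" "\<And>k x. norm k \<ge> 1 \<Longrightarrow> x \<in> {0..1} \<Longrightarrow> norm (\<phi>\<^sub>2 (k\<^sup>2) x) \<le> C2 * exp (\<bar>Im k\<bar> * x)"
    unfolding \<phi>\<^sub>2_def using sol_growth_shifted[OF q2, of h\<^sub>2 0] by auto
  define c1 where "c1 = exp (integral {0..1} (\<lambda>t. \<bar>r\<^sub>1 t\<bar>))"
  define c2 where "c2 = exp (integral {0..1} (\<lambda>t. \<bar>r\<^sub>2 t\<bar>))"
  have S1b: "norm (S\<^sub>1 (k\<^sup>2)) \<le> c1 / norm k * exp (\<bar>Im k\<bar> * x)" if "norm k \<ge> 1" for k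
    using solves_growth[OF r1 sol_solves[OF r1, of "k\<^sup>2" 0 1] that x]
    by (simp add: S\<^sub>1_def c1_def sol_at_0[OF r1] dsol_at_0[OF r1])
  have S2b: "norm (S\<^sub>2 (k\<^sup>2)) \<le> c2 / norm k * exp (\<bar>Im k\<bar> * x)" if "norm k \<ge> 1" for k
    using solves_growth[OF r2 sol_solves[OF r2, of "k\<^sup>2" 0 1] that x]
    by (simp add: S\<^sub>2_def c2_def sol_at_0[OF r2] dsol_at_0[OF r2])
  define K where "K = 8 * (c1 * C2 + c2 * C1)"
  have quot: "norm (S * p / d) \<le> 8 * (c * C) / norm k"
    if "norm S \<le> c / norm k * exp (\<bar>Im k\<bar> * x)" "norm p \<le> C * exp (\<bar>Im k\<bar> * (1 - x))" "exp \<bar>Im k\<bar> / 8 \<le> norm d" "c \<ge> 0" "C \<ge> 0"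
    for S p d k :: complex and c C :: real
  proof -
    have "norm S * norm p \<le> (c / norm k * exp (\<bar>Im k\<bar> * x)) * (C * exp (\<bar>Im k\<bar> * (1 - x)))"
      using that by (intro mult_mono) auto
    also have "\<dots> = (c * C / norm k) * exp \<bar>Im k\<bar>" by (simp add: mult_exp_exp algebra_simps flip: exp_add)
    finally have "norm S * norm p / norm d \<le> ((c * C / norm k) * exp \<bar>Im k\<bar>) / (exp \<bar>Im k\<bar> / 8)"
      using that by (intro frac_le) auto
    then show ?thesis by (simp add: norm_mult norm_divide mult_ac)
  qed
  have circle: "norm (E z) \<le> K / (real m * pi)" if m: "m \<ge> max 1 (max N1 N2)" and z: "norm z = (real m * pi)\<^sup>2" for z m
  proof -
    define k where "k = csqrt z"
    have zk: "z = k\<^sup>2" by (simp add: k_def)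
    have "(norm k)\<^sup>2 = (real m * pi)\<^sup>2" using z unfolding zk norm_power .
    then have nk: "norm k = real m * pi" by (simp add: power2_eq_iff_nonneg)
    have "real m * pi \<ge> 1 * 1" using m pi_gt3 by (intro mult_mono) auto
    then have k1: "norm k \<ge> 1" using nk by simp
    have d1: "exp \<bar>Im k\<bar> / 8 \<le> norm (\<phi>\<^sub>1 z 1)" and d2: "exp \<bar>Im k\<bar> / 8 \<le> norm (\<phi>\<^sub>2 z 1)"
      unfolding zk using N1[OF _ nk] N2[OF _ nk] m by auto
    have "exp \<bar>Im k\<bar> / 8 > 0" by simp
    then have nz: "\<phi>\<^sub>1 z 1 \<noteq> 0" "\<phi>\<^sub>2 z 1 \<noteq> 0" using d1 d2 by (metis norm_zero not_le)+
    have "E z = (\<phi>\<^sub>1 z 1 * \<phi>\<^sub>2 z 1 * E z) / (\<phi>\<^sub>1 z 1 * \<phi>\<^sub>2 z 1)" using nz by simp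
    also have "\<dots> = S\<^sub>1 z * \<phi>\<^sub>2 z (1 - x) / \<phi>\<^sub>2 z 1 - S\<^sub>2 z * \<phi>\<^sub>1 z (1 - x) / \<phi>\<^sub>1 z 1"
      unfolding id using nz by (simp add: field_simps)
    finally have "norm (E z) \<le> norm (S\<^sub>1 z * \<phi>\<^sub>2 z (1 - x) / \<phi>\<^sub>2 z 1) + norm (S\<^sub>2 z * \<phi>\<^sub>1 z (1 - x) / \<phi>\<^sub>1 z 1)"
      by (metis norm_triangle_ineq4)
    also have "\<dots> \<le> 8 * (c1 * C2) / norm k + 8 * (c2 * C1) / norm k"
      using S1b[OF k1] S2b[OF k1] C1 C2 k1 x' d1 d2 unfolding zk
      by (intro add_mono quot) (auto simp: c1_def c2_def)
    also have "\<dots> = K / (real m * pi)" by (simp add: K_def nk add_divide_distrib distrib_left)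
    finally show ?thesis .
  qed
  have E0: "E z = 0" for z
  proof -
    have K0: "K \<ge> 0" using C1(1) C2(1) by (simp add: K_def c1_def c2_def)
    have le: "norm (E z) \<le> e" if e: "e > 0" for e
    proof -
      obtain m :: nat where m: "real m > max (real (max 1 (max N1 N2))) (max (norm z) (K / e))" using reals_Archimedean2 by blast
      then have m1: "m \<ge> max 1 (max N1 N2)" "real m > norm z" "real m > K / e" "real m \<ge> 1" by auto
      have "real m * pi \<ge> real m * 1" using pi_gt3 by (intro mult_left_mono) auto
      then have mpi: "real m * pi \<ge> real m" by simp
      have "norm (E z) \<le> K / (real m * pi)"
      proof (rule maximum_modulus_frontier[where f = E and S = "cball 0 ((real m * pi)\<^sup>2)"])
        show "continuous_on (closure (cball 0 ((real m * pi)\<^sup>2))) E" by (rule holomorphic_on_imp_continuous_on[OF Ehol])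
        show "norm (E w) \<le> K / (real m * pi)" if "w \<in> frontier (cball 0 ((real m * pi)\<^sup>2))" for w
          using that m1 by (intro circle[OF m1(1)]) (simp add: frontier_cball)
        have "1 \<le> real m * pi" using mpi m1(4) by linarith
        then have "real m * 1 \<le> (real m * pi) * (real m * pi)" using mpi by (intro mult_mono) auto
        then show "z \<in> cball 0 ((real m * pi)\<^sup>2)" using m1(2) by (simp add: power2_eq_square)
      qed (auto intro: Ehol)
      also have "\<dots> \<le> K / real m" using K0 mpi m1(4) by (intro divide_left_mono) auto
      also have "\<dots> \<le> e" using m1(3,4) e by (simp add: divide_less_eq divide_le_eq mult.commute)
      finally show ?thesis .
    qed
    have "norm (E z) \<le> 0"
    proof (rule field_le_epsilon)
      fix e :: real assume "e > 0"
      from le[OF this] show "norm (E z) \<le> 0 + e" by simp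
    qed
    then show ?thesis by simp
  qed
  show ?thesis using id[of z] E0[of z] by (simp add: \<phi>\<^sub>1_def \<phi>\<^sub>2_def S\<^sub>1_def S\<^sub>2_def r\<^sub>1_def[abs_def] r\<^sub>2_def[abs_def])
qed

text \<open>With \<open>\<psi>\<^sub>j = \<phi>\<^sub>j / \<phi>\<^sub>j 1\<close> the preceding lemma says
  \<open>S\<^sub>1 / \<psi>\<^sub>1 = S\<^sub>2 / \<psi>\<^sub>2\<close>. The Wronskian of
  \<open>\<psi>\<^sub>j\<close> and \<open>S\<^sub>j\<close> is \<open>1\<close>, so the derivative of
  \<open>S\<^sub>j / \<psi>\<^sub>j\<close> is \<open>1 / \<psi>\<^sub>j\<^sup>2\<close>. Hence
  \<open>\<psi>\<^sub>1\<^sup>2 = \<psi>\<^sub>2\<^sup>2\<close>, and by continuity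
  \<open>\<psi>\<^sub>1 = \<psi>\<^sub>2\<close>. As both \<open>\<phi>\<^sub>j\<close> are
  \<open>1\<close> at \<open>0\<close>, they coincide, and the potentials and boundary parameters can be read
  off from the equation and the initial values.\<close>

theorem borg_marchenko:
  assumes q1: "q\<^sub>1 absolutely_integrable_on {0..1}" and q2: "q\<^sub>2 absolutely_integrable_on {0..1}"
    and W: "\<And>z. cross_wronskian q\<^sub>1 h\<^sub>1 q\<^sub>2 h\<^sub>2 z = 0"
  shows "h\<^sub>1 = h\<^sub>2 \<and> (AE x in lebesgue_on {0..1}. q\<^sub>1 x = q\<^sub>2 x)"
proof -
  \<comment> \<open>a non-real energy, at which neither solution has zeros on the unit interval\<close>
  let ?z = "\<i>"
  define \<phi>\<^sub>1 where "\<phi>\<^sub>1 = sol q\<^sub>1 1 (- of_real h\<^sub>1) ?z"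
  define \<phi>\<^sub>2 where "\<phi>\<^sub>2 = sol q\<^sub>2 1 (- of_real h\<^sub>2) ?z"
  define \<phi>\<^sub>1' where "\<phi>\<^sub>1' = dsol q\<^sub>1 1 (- of_real h\<^sub>1) ?z"
  define \<phi>\<^sub>2' where "\<phi>\<^sub>2' = dsol q\<^sub>2 1 (- of_real h\<^sub>2) ?z"
  have sol1: "solves (energy_potential q\<^sub>1 ?z) (\<lambda>_. 0) \<phi>\<^sub>1 \<phi>\<^sub>1'" and sol2: "solves (energy_potential q\<^sub>2 ?z) (\<lambda>_. 0) \<phi>\<^sub>2 \<phi>\<^sub>2'"
    unfolding \<phi>\<^sub>1_def \<phi>\<^sub>1'_def \<phi>\<^sub>2_def \<phi>\<^sub>2'_def by (rule sol_solves[OF q1], rule sol_solves[OF q2])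
  have nz1: "\<phi>\<^sub>1 x \<noteq> 0" and nz2: "\<phi>\<^sub>2 x \<noteq> 0" if "x \<in> {0..1}" for x
    unfolding \<phi>\<^sub>1_def \<phi>\<^sub>2_def using sol_nonreal_nonzero[OF q1 _ that] sol_nonreal_nonzero[OF q2 _ that] by auto
  have one: "(1::real) \<in> {0..1}" by simp
  let ?r1 = "\<lambda>x. q\<^sub>1 (1 - x)" and ?r2 = "\<lambda>x. q\<^sub>2 (1 - x)"
  have r1: "?r1 absolutely_integrable_on {0..1}" and r2: "?r2 absolutely_integrable_on {0..1}"
    by (intro absolutely_integrable_reflect_unit q1 q2)+
  define S\<^sub>1 where "S\<^sub>1 = sol ?r1 0 1 ?z"
  define S\<^sub>2 where "S\<^sub>2 = sol ?r2 0 1 ?z"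
  define S\<^sub>1' where "S\<^sub>1' = dsol ?r1 0 1 ?z"
  define S\<^sub>2' where "S\<^sub>2' = dsol ?r2 0 1 ?z"
  define \<psi>\<^sub>1 where "\<psi>\<^sub>1 x = inverse (\<phi>\<^sub>1 1) * \<phi>\<^sub>1 (1 - x)" for x
  define \<psi>\<^sub>2 where "\<psi>\<^sub>2 x = inverse (\<phi>\<^sub>2 1) * \<phi>\<^sub>2 (1 - x)" for x
  define \<psi>\<^sub>1' where "\<psi>\<^sub>1' x = inverse (\<phi>\<^sub>1 1) * (- \<phi>\<^sub>1' (1 - x))" for x
  define \<psi>\<^sub>2' where "\<psi>\<^sub>2' x = inverse (\<phi>\<^sub>2 1) * (- \<phi>\<^sub>2' (1 - x))" for x
  have s1: "solves (energy_potential ?r1 ?z) (\<lambda>_. 0) S\<^sub>1 S\<^sub>1'" and s2: "solves (energy_potential ?r2 ?z) (\<lambda>_. 0) S\<^sub>2 S\<^sub>2'"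
    unfolding S\<^sub>1_def S\<^sub>1'_def S\<^sub>2_def S\<^sub>2'_def by (rule sol_solves[OF r1], rule sol_solves[OF r2])
  have p1: "solves (energy_potential ?r1 ?z) (\<lambda>_. 0) \<psi>\<^sub>1 \<psi>\<^sub>1'"
    using solves_cmult[OF solves_reflect[OF sol1], of "inverse (\<phi>\<^sub>1 1)"] by (simp add: \<psi>\<^sub>1_def[abs_def] \<psi>\<^sub>1'_def[abs_def])
  have p2: "solves (energy_potential ?r2 ?z) (\<lambda>_. 0) \<psi>\<^sub>2 \<psi>\<^sub>2'"
    using solves_cmult[OF solves_reflect[OF sol2], of "inverse (\<phi>\<^sub>2 1)"] by (simp add: \<psi>\<^sub>2_def[abs_def] \<psi>\<^sub>2'_def[abs_def])
  have init: "S\<^sub>1 0 = 0" "S\<^sub>1' 0 = 1" "S\<^sub>2 0 = 0" "S\<^sub>2' 0 = 1" "\<psi>\<^sub>1 0 = 1" "\<psi>\<^sub>2 0 = 1"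
    using nz1[OF one] nz2[OF one]
    by (simp_all add: S\<^sub>1_def S\<^sub>1'_def S\<^sub>2_def S\<^sub>2'_def \<psi>\<^sub>1_def \<psi>\<^sub>2_def sol_at_0[OF r1] sol_at_0[OF r2] dsol_at_0[OF r1] dsol_at_0[OF r2])
  have wr: "\<psi> x * S' x - \<psi>' x * S x = 1" if "solves Q (\<lambda>_. 0) \<psi> \<psi>'" "solves Q (\<lambda>_. 0) S S'" "S 0 = 0" "S' 0 = 1" "\<psi> 0 = 1" "x \<in> {0..1}"
    for Q \<psi> \<psi>' S S' x
  proof -
    have "((\<lambda>_. 0) has_integral (\<psi> x * S' x - \<psi>' x * S x - 1)) {0..x}"
      using wronskian_has_integral[OF that(1,2,6)] that(3-5) by simp
    then have "\<psi> x * S' x - \<psi>' x * S x - 1 = 0" using has_integral_0 has_integral_unique by blast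
    then show ?thesis by simp
  qed
  have SP: "S\<^sub>1 x * \<psi>\<^sub>2 x = S\<^sub>2 x * \<psi>\<^sub>1 x" if x: "x \<in> {0..1}" for x
    using transfer_entire_zero[OF q1 q2 W x, of ?z] nz1[OF one] nz2[OF one]
    by (simp add: \<psi>\<^sub>1_def \<psi>\<^sub>2_def S\<^sub>1_def S\<^sub>2_def \<phi>\<^sub>1_def \<phi>\<^sub>2_def field_simps)
  have deriv: "(u has_vector_derivative v x) (at x within {0..1})" if "solves Q f u v" "x \<in> {0..1}" for Q f u v x
    using that AC_has_vector_derivative AC_continuous unfolding solves_def by blast
  have sq: "(\<psi>\<^sub>1 x)\<^sup>2 = (\<psi>\<^sub>2 x)\<^sup>2" if x: "x \<in> {0..1}" for x
  proof -
    have d1: "((\<lambda>x. S\<^sub>1 x * \<psi>\<^sub>2 x) has_vector_derivative S\<^sub>1 x * \<psi>\<^sub>2' x + S\<^sub>1' x * \<psi>\<^sub>2 x) (at x within {0..1})"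
      by (intro has_vector_derivative_mult deriv[OF s1 x] deriv[OF p2 x])
    have d2: "((\<lambda>x. S\<^sub>2 x * \<psi>\<^sub>1 x) has_vector_derivative S\<^sub>2 x * \<psi>\<^sub>1' x + S\<^sub>2' x * \<psi>\<^sub>1 x) (at x within {0..1})"
      by (intro has_vector_derivative_mult deriv[OF s2 x] deriv[OF p1 x])
    have "((\<lambda>x. S\<^sub>1 x * \<psi>\<^sub>2 x) has_vector_derivative S\<^sub>2 x * \<psi>\<^sub>1' x + S\<^sub>2' x * \<psi>\<^sub>1 x) (at x within {0..1})"
      by (rule has_vector_derivative_transform[OF x _ d2]) (rule SP)
    then have e: "S\<^sub>1 x * \<psi>\<^sub>2' x + S\<^sub>1' x * \<psi>\<^sub>2 x = S\<^sub>2 x * \<psi>\<^sub>1' x + S\<^sub>2' x * \<psi>\<^sub>1 x"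
      using vector_derivative_unique_within_closed_interval[of 0 1 x "\<lambda>x. S\<^sub>1 x * \<psi>\<^sub>2 x"] d1 x by auto
    have w1: "\<psi>\<^sub>1 x * S\<^sub>1' x - \<psi>\<^sub>1' x * S\<^sub>1 x = 1" by (rule wr[OF p1 s1 init(1,2,5) x])
    have w2: "\<psi>\<^sub>2 x * S\<^sub>2' x - \<psi>\<^sub>2' x * S\<^sub>2 x = 1" by (rule wr[OF p2 s2 init(3,4,6) x])
    show ?thesis using e w1 w2 SP[OF x] by algebra
  qed
  have nzp: "\<psi>\<^sub>1 x \<noteq> 0" "\<psi>\<^sub>2 x \<noteq> 0" if "x \<in> {0..1}" for x
    using nz1[OF one] nz2[OF one] nz1[of "1 - x"] nz2[of "1 - x"] that by (auto simp: \<psi>\<^sub>1_def \<psi>\<^sub>2_def)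
  have eq: "\<psi>\<^sub>1 x = \<psi>\<^sub>2 x" if x: "x \<in> {0..1}" for x
  proof -
    have pm: "\<psi>\<^sub>1 x / \<psi>\<^sub>2 x \<in> {1, -1}" if "x \<in> {0..1}" for x
    proof -
      have "(\<psi>\<^sub>1 x / \<psi>\<^sub>2 x)\<^sup>2 = 1" using sq[OF that] nzp(2)[OF that] by (simp add: power_divide)
      then show ?thesis by (simp add: power2_eq_1_iff)
    qed
    have "(\<lambda>x. \<psi>\<^sub>1 x / \<psi>\<^sub>2 x) constant_on {0..1}"
    proof (rule continuous_finite_range_constant)
      show "continuous_on {0..1} (\<lambda>x. \<psi>\<^sub>1 x / \<psi>\<^sub>2 x)"
        using p1 p2 AC_continuous nzp(2) by (intro continuous_intros) (auto simp: solves_def)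
      show "finite ((\<lambda>x. \<psi>\<^sub>1 x / \<psi>\<^sub>2 x) ` {0..1})"
        by (rule finite_subset[of _ "{1, -1}"], use pm in blast, simp)
    qed simp
    then have "\<psi>\<^sub>1 x / \<psi>\<^sub>2 x = \<psi>\<^sub>1 0 / \<psi>\<^sub>2 0" using x unfolding constant_on_def by fastforce
    then show ?thesis using init(5,6) nzp(2)[OF x] by simp
  qed
  have "\<psi>\<^sub>1 1 = \<psi>\<^sub>2 1" by (rule eq[OF one])
  then have "\<phi>\<^sub>1 1 = \<phi>\<^sub>2 1"
    by (simp add: \<psi>\<^sub>1_def \<psi>\<^sub>2_def \<phi>\<^sub>1_def \<phi>\<^sub>2_def sol_at_0[OF q1] sol_at_0[OF q2])
  then have \<phi>: "\<phi>\<^sub>1 x = \<phi>\<^sub>2 x" if "x \<in> {0..1}" for x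
    using eq[of "1 - x"] that nz2[OF one] by (simp add: \<psi>\<^sub>1_def \<psi>\<^sub>2_def)
  have \<phi>': "\<phi>\<^sub>1' x = \<phi>\<^sub>2' x" if x: "x \<in> {0..1}" for x
  proof -
    have "(\<phi>\<^sub>1 has_vector_derivative \<phi>\<^sub>2' x) (at x within {0..1})"
      by (rule has_vector_derivative_transform[OF x _ deriv[OF sol2 x]]) (rule \<phi>)
    then show ?thesis
      using vector_derivative_unique_within_closed_interval[of 0 1 x \<phi>\<^sub>1] deriv[OF sol1 x] x by auto
  qed
  have "h\<^sub>1 = h\<^sub>2"
    using \<phi>'[of 0] by (simp add: \<phi>\<^sub>1'_def \<phi>\<^sub>2'_def dsol_at_0[OF q1] dsol_at_0[OF q2])
  moreover have "AE x in lebesgue_on {0..1}. q\<^sub>1 x = q\<^sub>2 x"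
  proof -
    have "AC_with_derivative \<phi>\<^sub>1' (\<lambda>x. energy_potential q\<^sub>1 ?z x * \<phi>\<^sub>1 x)" "AC_with_derivative \<phi>\<^sub>2' (\<lambda>x. energy_potential q\<^sub>2 ?z x * \<phi>\<^sub>2 x)"
      using sol1 sol2 by (auto simp: solves_def)
    moreover from this(2) have "AC_with_derivative \<phi>\<^sub>1' (\<lambda>x. energy_potential q\<^sub>2 ?z x * \<phi>\<^sub>1 x)"
      by (rule AC_cong) (auto simp: \<phi> \<phi>')
    ultimately have "AE x in lebesgue_on {0..1}. energy_potential q\<^sub>1 ?z x * \<phi>\<^sub>1 x = energy_potential q\<^sub>2 ?z x * \<phi>\<^sub>1 x"
      by (intro AC_derivative_unique)
    then show ?thesis
    proof (rule AE_mp, intro AE_I2 impI)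
      fix x assume "x \<in> space (lebesgue_on {0..1})" and e: "energy_potential q\<^sub>1 ?z x * \<phi>\<^sub>1 x = energy_potential q\<^sub>2 ?z x * \<phi>\<^sub>1 x"
      then have "\<phi>\<^sub>1 x \<noteq> 0" using nz1 by simp
      with e show "q\<^sub>1 x = q\<^sub>2 x" by simp
    qed
  qed
  ultimately show ?thesis by blast
qed

lemma Lp_on_absolutely_integrable:
  fixes f :: "real \<Rightarrow> real"
  assumes "Lp_on p {a..b} f"
  shows "(\<lambda>x. \<bar>f x\<bar> powr p) absolutely_integrable_on {a..b}"
  using assms by (simp add: Lp_on_def set_integrable_def integrable_restrict_space)

lemma Lp_on_1_absolutely_integrable:
  fixes f :: "real \<Rightarrow> real"
  assumes "Lp_on 1 {a..b} f"
  shows "f absolutely_integrable_on {a..b}"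
  using assms by (simp add: Lp_on_def absolutely_integrable_measurable o_def)

theorem theorem1p1:
  fixes q\<^sub>1 q\<^sub>2 q :: "real \<Rightarrow> real" and h\<^sub>1 h\<^sub>2 h H a p :: real and S :: "complex set"
  assumes "Lp_on 1 {0..1} q\<^sub>1" and "Lp_on 1 {0..1} q\<^sub>2"
    and "infinite S"
    and "S \<subseteq> spectrum q\<^sub>1 h\<^sub>1 H \<inter> spectrum q\<^sub>2 h\<^sub>2 H"
    and "0 < a" and "a \<le> 1 / 2" and "1 \<le> p"
    and "AE x in lebesgue_on {a..1}. q\<^sub>1 x = q\<^sub>2 x"
    and "Lp_on p {0..a} (\<lambda>x. q\<^sub>1 x - q\<^sub>2 x)"
    and "(q, h) = (q\<^sub>1, h\<^sub>1) \<or> (q, h) = (q\<^sub>2, h\<^sub>2)"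
    and "\<exists>C. \<forall>\<^sub>F t in at_top. complex_of_real t \<in> S \<longrightarrow>
           2 * a * real (counting (spectrum q h H) t) + C \<ge> real (counting S t)
         \<and> real (counting S t) \<ge> 2 * a * real (counting (spectrum q h H) t) + 1 / (2 * p) - 2 * a"
  shows "h\<^sub>1 = h\<^sub>2 \<and> (AE x in lebesgue_on {0..1}. q\<^sub>1 x = q\<^sub>2 x)"
proof -
  note a = assms(5) and p = assms(7)
  have a1: "a \<le> 1" using assms(6) by simp
  have q1: "q\<^sub>1 absolutely_integrable_on {0..1}" and q2: "q\<^sub>2 absolutely_integrable_on {0..1}"
    using assms(1,2) by (auto intro: Lp_on_1_absolutely_integrable)
  have q: "q absolutely_integrable_on {0..1}" using assms(10) q1 q2 by auto
  have S1: "char_fn q\<^sub>1 h\<^sub>1 H s = 0" and S2: "char_fn q\<^sub>2 h\<^sub>2 H s = 0" if "s \<in> S" for s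
    using that assms(4) spectrum_eq_zeros[OF q1] spectrum_eq_zeros[OF q2] by auto
  have Sq: "char_fn q h H s = 0" if "s \<in> S" for s using S1[OF that] S2[OF that] assms(10) by auto
  have fin: "finite {z \<in> S. norm z \<le> t}" for t
    by (rule finite_subset[OF _ char_fn_zeros_finite[OF q, of h H t]]) (use Sq in auto)
  define b where "b = pi / (2 * a)"
  have b: "b > 0" using a by (simp add: b_def)
  define \<tau> where "\<tau> = 1 / (2 * p)"
  have \<tau>: "0 < \<tau>" "\<tau> \<le> 1/2" using p by (auto simp: \<tau>_def divide_simps)
  obtain C T where T: "T > 0" and C: "C > 0"
    and lower: "\<And>t. t \<ge> T \<Longrightarrow> char_fn q h H (of_real t) = 0 \<Longrightarrow> sqrt t / pi + 1 - C / sqrt t \<le> real (counting (spectrum q h H) t)"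
    by (rule counting_spectrum_lower[OF q, of h H]) blast
  obtain B where B: "\<And>z. char_fn q h H z = 0 \<Longrightarrow> Re z \<ge> - B" by (rule char_fn_zeros_bounded_below[OF q]) blast
  obtain T' where T': "\<And>t. t \<ge> T' \<Longrightarrow> complex_of_real t \<in> S \<Longrightarrow>
      real (counting S t) \<ge> 2 * a * real (counting (spectrum q h H) t) + 1 / (2 * p) - 2 * a"
    using assms(11) unfolding eventually_at_top_linorder by blast
  \<comment> \<open>beyond \<open>t\<^sub>0\<close> the elements of \<open>S\<close> are positive reals to which both counting estimates apply\<close>
  define t\<^sub>0 where "t\<^sub>0 = max T (max T' (max B 1))"
  have t0: "t\<^sub>0 > 0" using T by (simp add: t\<^sub>0_def)
  have large: "s = of_real (norm s)" if s: "s \<in> S" "norm s > t\<^sub>0" for s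
  proof -
    have im: "Im s = 0" by (rule char_fn_zero_real[OF q Sq[OF s(1)]])
    have "Re s \<ge> - B" by (rule B[OF Sq[OF s(1)]])
    moreover have "norm s = \<bar>Re s\<bar>" using im by (simp add: cmod_eq_Re)
    ultimately have "norm s = Re s" using s(2) unfolding t\<^sub>0_def by linarith
    then show ?thesis using im by (simp add: complex_eq_iff)
  qed
  have idx: "sqrt (norm s) \<le> b * (real (counting S (norm s)) - \<tau>) + (pi * C) / sqrt (norm s)" if s: "s \<in> S" "norm s > t\<^sub>0" for s
  proof -
    define t where "t = norm s"
    have st: "s = of_real t" using large[OF s] by (simp add: t_def)
    have t: "t \<ge> T" "t \<ge> T'" "t > 0" using s(2) t0 by (auto simp: t_def t\<^sub>0_def)
    have "sqrt t / pi + 1 - C / sqrt t \<le> real (counting (spectrum q h H) t)"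
      by (rule lower[OF t(1)]) (use Sq[OF s(1)] st in simp)
    then have "2 * a * (sqrt t / pi + 1 - C / sqrt t) \<le> 2 * a * real (counting (spectrum q h H) t)"
      using a by (intro mult_left_mono) auto
    also have "\<dots> \<le> real (counting S t) - \<tau> + 2 * a" using T'[OF t(2)] s(1) st by (simp add: \<tau>_def)
    finally have "b * (2 * a * (sqrt t / pi + 1 - C / sqrt t)) \<le> b * (real (counting S t) - \<tau> + 2 * a)"
      using b by (intro mult_left_mono) auto
    moreover have "b * (2 * a * (sqrt t / pi + 1 - C / sqrt t)) = sqrt t + pi - pi * C / sqrt t"
      using a t(3) by (simp add: b_def field_simps)
    moreover have "b * (real (counting S t) - \<tau> + 2 * a) = b * (real (counting S t) - \<tau>) + pi"
      using a by (simp add: b_def field_simps)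
    ultimately show ?thesis unfolding t_def by linarith
  qed
  have real_zero: "cross_wronskian q\<^sub>1 h\<^sub>1 q\<^sub>2 h\<^sub>2 (of_real c) = 0" for c
  proof (cases "of_real c \<in> S")
    case True
    then show ?thesis using cross_wronskian_eq_0[OF S1 S2] by blast
  next
    case False
    obtain C\<^sub>0 where C0: "\<And>N. \<exists>T. finite T \<and> card T \<ge> N \<and> 0 \<notin> T \<and> (\<forall>s\<in>T. of_real c + s \<in> S) \<and>
       (\<Sum>s\<in>T. ln (norm s)) \<le> 2 * real (card T) * ln b + 2 * (\<Sum>j=1..card T. ln (real j - \<tau>)) + C\<^sub>0"
      by (rule ln_dist_sum_bound[OF assms(3) fin b \<tau> _ t0 False large idx]) (use C in auto)
    show ?thesis
    proof (rule cross_wronskian_zero_of_dense_zeros[OF q1 q2 a a1 assms(8) p Lp_on_absolutely_integrable[OF assms(9)]])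
      fix N :: nat
      show "\<exists>T. finite T \<and> card T \<ge> N \<and> 0 \<notin> T \<and> (\<forall>s\<in>T. cross_wronskian q\<^sub>1 h\<^sub>1 q\<^sub>2 h\<^sub>2 (of_real c + s) = 0) \<and>
        (\<Sum>s\<in>T. ln (norm s)) \<le> 2 * real (card T) * ln (pi / (2 * a)) + 2 * (\<Sum>j=1..card T. ln (real j - 1 / (2 * p))) + C\<^sub>0"
        using C0[of N] cross_wronskian_eq_0[OF S1 S2] unfolding b_def \<tau>_def by blast
    qed
  qed
  have "cross_wronskian q\<^sub>1 h\<^sub>1 q\<^sub>2 h\<^sub>2 z = 0" for z
  proof (rule analytic_continuation[of "cross_wronskian q\<^sub>1 h\<^sub>1 q\<^sub>2 h\<^sub>2" UNIV \<real> 0 z])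
    show "cross_wronskian q\<^sub>1 h\<^sub>1 q\<^sub>2 h\<^sub>2 holomorphic_on UNIV"
      by (rule cross_wronskian_holomorphic[OF q1 q2 a a1 assms(8)])
    show "(0::complex) islimpt \<real>"
    proof (rule islimptI)
      fix U :: "complex set" assume "0 \<in> U" "open U"
      then obtain e where e: "e > 0" "ball 0 e \<subseteq> U" using openE by blast
      then have "complex_of_real (e / 2) \<in> U" by (auto simp: subset_iff)
      then show "\<exists>y\<in>\<real>. y \<in> U \<and> y \<noteq> 0" using e(1) by (intro bexI[of _ "of_real (e / 2)"]) auto
    qed
  qed (use real_zero in \<open>auto simp: Reals_def\<close>)
  then show ?thesis by (rule borg_marchenko[OF q1 q2])
qed

end
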